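(* Let $M=(M_k)$ and $L=(L_k)$ be weight sequences and assume that $M$ is log-convex. Let $E,F,G$ be convenient vector spaces. Then: \begin{align*} f\in\mathcal B_{\ge1}(F,G),\ g\in\mathcal S_{\ge1}(E,F)&\Longrightarrow f\circ g\in\mathcal S_{\ge1}(E,G),\\ f\in\mathcal B^{[M]}_{\ge1}(F,G),\ g\in\mathcal S^{[M]}_{[L],\ge1}(E,F)&\Longrightarrow f\circ g\in\mathcal S^{[M]}_{[L],\ge1}(E,G), \end{align*} where $[M]$ (and $[L]$) stands either for $(M)$ (and $(L)$) throughout or for $\{M\}$ (and $\{L\}$) throughout; the statement holds in both cases.
   Context: A weight sequence is a sequence $M=(M_k)_{k\in\mathbb N}$, $\mathbb N=\{0,1,\dots\}$, of positive reals with $M_0=1\le M_1$; it is log-convex if $M_k^2\le M_{k-1}M_{k+1}$ for $k\ge1$. Convenient vector spaces are Mackey complete locally convex spaces; a mapping is $C^\infty$ if it maps $C^\infty$-curves to $C^\infty$-curves. For a closed absolutely convex bounded $B\subseteq E$, $E_B$ is the linear span of $B$ normed by the Minkowski functional of $B$, $i_B:E_B\to E$ the inclusion. For a Banach space $X$ (operator norms on Fréchet derivatives): - $\mathcal B_{\ge1}(X,\mathbb R)$: all $h\in C^\infty(X,\mathbb R)$ with $\sup_{x\in X}\|h^{(k)}(x)\|<\infty$ for all $k\ge1$; - $\mathcal B^{(M)}_{\ge1}(X,\mathbb R)$ (resp. $\mathcal B^{\{M\}}_{\ge1}(X,\mathbb R)$): all $h\in C^\infty(X,\mathbb R)$ such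 that for all (resp. some) $\rho>0$, $\sup_{k\ge1,x\in X}\frac{\|h^{(k)}(x)\|}{\rho^kk!M_k}<\infty$; - $\mathcal S_{\ge1}(X,\mathbb R)$: all $h\in C^\infty(X,\mathbb R)$ with $\sup_{x\in X}(1+\|x\|)^k\|h^{(\ell)}(x)\|<\infty$ for all $k\in\mathbb N$, $\ell\ge1$; - $\mathcal S^{(M)}_{(L),\ge1}(X,\mathbb R)$ (resp. $\mathcal S^{\{M\}}_{\{L\},\ge1}(X,\mathbb R)$): all $h\in C^\infty(X,\mathbb R)$ such that for all (resp. some) $\sigma>0$, $\sup_{k\in\mathbb N,\ell\ge1,x\in X}\frac{(1+\|x\|)^k\|h^{(\ell)}(x)\|}{\sigma^{k+\ell}k!\ell!L_kM_\ell}<\infty$. For convenient $E,F$ and $\mathcal A$ any of these classes, $\mathcal A(E,F)$ is the set of $f\in C^\infty(E,F)$ with $\lambda\circ f\circ i_B\in\mathcal A(E_B,\mathbb R)$ for all continuous linear functionals $\lambda$ on $F$ and all closed absolutely convex bounded $B\subseteq E$. *)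

theory Defs
  imports "HOL-Analysis.Analysis"
begin

section \<open>Convenient vector spaces\<close>

text \<open>The constant \<^const>\<open>convex\<close> is not available inside a class specification and is written out.\<close>

class locally_convex_space = real_vector + t2_space + topological_ab_group_add +
  assumes tendsto_scaleR_lcs:
      "filterlim (\<lambda>z. fst z *\<^sub>R snd z) (nhds (a *\<^sub>R x)) (nhds a \<times>\<^sub>F nhds x)"
    and locally_convex_at_0:
      "open U \<Longrightarrow> 0 \<in> U \<Longrightarrow> \<exists>V. open V \<and> 0 \<in> V \<and> V \<subseteq> U \<and>
        (\<forall>x\<in>V. \<forall>y\<in>V. \<forall>u\<ge>0. \<forall>v\<ge>0. u + v = 1 \<longrightarrow> u *\<^sub>R x + v *\<^sub>R y \<in> V)"

definition (in real_vector) absolutely_convex :: "'a set \<Rightarrow> bool" where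
  "absolutely_convex B \<longleftrightarrow> B \<noteq> {} \<and>
     (\<forall>x\<in>B. \<forall>y\<in>B. \<forall>a b. \<bar>a\<bar> + \<bar>b\<bar> \<le> 1 \<longrightarrow> a *\<^sub>R x + b *\<^sub>R y \<in> B)"

text \<open>Boundedness in the sense of topological vector spaces (\<^const>\<open>bounded\<close> is the metric notion).\<close>

definition (in locally_convex_space) vn_bounded :: "'a set \<Rightarrow> bool" where
  "vn_bounded B \<longleftrightarrow> (\<forall>U. open U \<and> 0 \<in> U \<longrightarrow> (\<exists>r>0. B \<subseteq> (*\<^sub>R) r ` U))"

text \<open>A sequence is Mackey-Cauchy if it is a Cauchy sequence with respect to the Minkowski
  functional of some bounded absolutely convex set.\<close>

definition (in locally_convex_space) Mackey_Cauchy :: "(nat \<Rightarrow> 'a) \<Rightarrow> bool" where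
  "Mackey_Cauchy x \<longleftrightarrow> (\<exists>B. absolutely_convex B \<and> vn_bounded B \<and>
     (\<forall>e>0. \<exists>N. \<forall>m\<ge>N. \<forall>n\<ge>N. x m - x n \<in> (*\<^sub>R) e ` B))"

class convenient_space = locally_convex_space +
  assumes Mackey_complete: "Mackey_Cauchy x \<Longrightarrow> \<exists>l. filterlim x (nhds l) sequentially"

instance real_normed_vector \<subseteq> locally_convex_space
proof
  show "filterlim (\<lambda>z. fst z *\<^sub>R snd z) (nhds (a *\<^sub>R x)) (nhds a \<times>\<^sub>F nhds x)"
    for a and x :: 'a
    by (intro tendsto_scaleR filterlim_fst filterlim_snd)
  fix U :: "'a set" assume "open U" "0 \<in> U"
  then obtain e where "e > 0" "ball 0 e \<subseteq> U"
    by (auto simp: open_contains_ball)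
  then show "\<exists>V. open V \<and> 0 \<in> V \<and> V \<subseteq> U \<and>
      (\<forall>x\<in>V. \<forall>y\<in>V. \<forall>u\<ge>0. \<forall>v\<ge>0. u + v = 1 \<longrightarrow> u *\<^sub>R x + v *\<^sub>R y \<in> V)"
    using convex_ball[of "0 :: 'a" e] unfolding convex_def
    by (intro exI[of _ "ball 0 e"]) auto
qed

instance banach \<subseteq> convenient_space
proof
  fix x :: "nat \<Rightarrow> 'a" assume "Mackey_Cauchy x"
  then obtain B where B: "vn_bounded B"
    and C: "\<And>e. e > 0 \<Longrightarrow> \<exists>N. \<forall>m\<ge>N. \<forall>n\<ge>N. x m - x n \<in> (*\<^sub>R) e ` B"
    unfolding Mackey_Cauchy_def by blast
  from B obtain r where r: "r > 0" "B \<subseteq> (*\<^sub>R) r ` ball 0 1"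
    unfolding vn_bounded_def by (meson centre_in_ball open_ball zero_less_one)
  have nB: "norm b < r" if "b \<in> B" for b
  proof -
    have "b \<in> (*\<^sub>R) r ` ball 0 1" using r that by blast
    then obtain u where "norm u < 1" "b = r *\<^sub>R u" by auto
    then show ?thesis using r by simp
  qed
  have "Cauchy x"
  proof (rule metric_CauchyI)
    fix e :: real assume e: "e > 0"
    with C[of "e / r"] r obtain N
      where N: "\<forall>m\<ge>N. \<forall>n\<ge>N. x m - x n \<in> (*\<^sub>R) (e / r) ` B" by auto
    have "dist (x m) (x n) < e" if mn: "m \<ge> N" "n \<ge> N" for m n
    proof -
      obtain b where b: "b \<in> B" "x m - x n = (e / r) *\<^sub>R b" using N mn by blast
      then show ?thesis using nB[OF b(1)] r e
        by (simp add: dist_norm field_simps)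
    qed
    then show "\<exists>N. \<forall>m\<ge>N. \<forall>n\<ge>N. dist (x m) (x n) < e" by blast
  qed
  then show "\<exists>l. x \<longlonglongrightarrow> l"
    by (simp add: Cauchy_convergent_iff convergent_def)
qed

section \<open>Smooth mappings between convenient vector spaces\<close>

definition smooth_curve :: "(real \<Rightarrow> 'a::locally_convex_space) \<Rightarrow> bool" where
  "smooth_curve c \<longleftrightarrow> (\<exists>D :: nat \<Rightarrow> real \<Rightarrow> 'a. D 0 = c \<and>
     (\<forall>k t. ((\<lambda>s. (D k (t + s) - D k t) /\<^sub>R s) \<longlongrightarrow> D (Suc k) t) (at 0)))"

definition smooth_maps ::
    "('a::locally_convex_space \<Rightarrow> 'b::locally_convex_space) set" where
  "smooth_maps = {f. \<forall>c. smooth_curve c \<longrightarrow> smooth_curve (f \<circ> c)}"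

section \<open>Smooth functions on Banach spaces\<close>

text \<open>The Banach spaces that occur are the spaces \<open>E\<^sub>B\<close>, which are subspaces of \<open>E\<close> and not
  types. A normed space is therefore a pair of a linear subspace \<open>S\<close> of a real vector space and a
  function \<open>p\<close> that is a norm on \<open>S\<close>; functions on it are considered on \<open>S\<close> only. A \<open>k\<close>-linear form
  is a function on lists of length \<open>k\<close>.\<close>

definition smooth_curve_on :: "'a::real_vector set \<Rightarrow> ('a \<Rightarrow> real) \<Rightarrow> (real \<Rightarrow> 'a) \<Rightarrow> bool" where
  "smooth_curve_on S p c \<longleftrightarrow> (\<exists>D :: nat \<Rightarrow> real \<Rightarrow> 'a. D 0 = c \<and> (\<forall>k t. D k t \<in> S) \<and>
     (\<forall>k t. ((\<lambda>s. p ((D k (t + s) - D k t) /\<^sub>R s - D (Suc k) t)) \<longlongrightarrow> 0) (at 0)))"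

definition smooth_functions_on :: "'a::real_vector set \<Rightarrow> ('a \<Rightarrow> real) \<Rightarrow> ('a \<Rightarrow> real) set" where
  "smooth_functions_on S p = {h. \<forall>c. smooth_curve_on S p c \<longrightarrow> smooth_curve (h \<circ> c)}"

definition multilinear_form_on :: "'a::real_vector set \<Rightarrow> nat \<Rightarrow> ('a list \<Rightarrow> real) \<Rightarrow> bool" where
  "multilinear_form_on S k T \<longleftrightarrow>
     (\<forall>us vs x y a b. length us + 1 + length vs = k \<and> set us \<subseteq> S \<and> set vs \<subseteq> S \<and> x \<in> S \<and> y \<in> S \<longrightarrow>
        T (us @ (a *\<^sub>R x + b *\<^sub>R y) # vs) = a * T (us @ x # vs) + b * T (us @ y # vs))"

definition bounded_form_on ::
    "'a::real_vector set \<Rightarrow> ('a \<Rightarrow> real) \<Rightarrow> nat \<Rightarrow> ('a list \<Rightarrow> real) \<Rightarrow> bool" where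
  "bounded_form_on S p k T \<longleftrightarrow>
     (\<exists>C. \<forall>vs. length vs = k \<and> set vs \<subseteq> S \<longrightarrow> \<bar>T vs\<bar> \<le> C * prod_list (map p vs))"

definition opnorm_on :: "'a::real_vector set \<Rightarrow> ('a \<Rightarrow> real) \<Rightarrow> nat \<Rightarrow> ('a list \<Rightarrow> real) \<Rightarrow> real" where
  "opnorm_on S p k T = Sup {\<bar>T vs\<bar> | vs. length vs = k \<and> set vs \<subseteq> S \<and> (\<forall>v\<in>set vs. p v \<le> 1)}"

text \<open>\<open>D k x\<close> is the \<open>k\<close>-th Frechet derivative of \<open>h\<close> at \<open>x\<close>: a bounded \<open>k\<close>-linear form, where
  \<open>D (k + 1)\<close> is the Frechet derivative of \<open>D k\<close> with respect to the operator norm, bounded linear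
  maps into bounded \<open>k\<close>-linear forms being identified with bounded \<open>(k + 1)\<close>-linear forms.\<close>

definition frechet_derivatives_on ::
    "'a::real_vector set \<Rightarrow> ('a \<Rightarrow> real) \<Rightarrow> ('a \<Rightarrow> real) \<Rightarrow> (nat \<Rightarrow> 'a \<Rightarrow> 'a list \<Rightarrow> real) \<Rightarrow> bool" where
  "frechet_derivatives_on S p h D \<longleftrightarrow>
     (\<forall>x\<in>S. D 0 x [] = h x) \<and>
     (\<forall>k. \<forall>x\<in>S. multilinear_form_on S k (D k x) \<and> bounded_form_on S p k (D k x)) \<and>
     (\<forall>k. \<forall>x\<in>S. \<forall>e>0. \<exists>d>0. \<forall>y\<in>S. p (y - x) < d \<longrightarrow>
        opnorm_on S p k (\<lambda>vs. D k y vs - D k x vs - D (Suc k) x ((y - x) # vs)) \<le> e * p (y - x))"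

text \<open>Smooth functions (in the sense of curves) on a Banach space have Frechet derivatives of all
  orders, and these are uniquely determined. Hence the existential quantifier over \<open>D\<close> below only
  gives a name to them.\<close>

definition B_ge1 :: "'a::real_vector set \<Rightarrow> ('a \<Rightarrow> real) \<Rightarrow> ('a \<Rightarrow> real) set" where
  "B_ge1 S p = {h \<in> smooth_functions_on S p. \<exists>D. frechet_derivatives_on S p h D \<and>
     (\<forall>k\<ge>1. bdd_above {opnorm_on S p k (D k x) | x. x \<in> S})}"

definition B_Beurling_ge1 ::
    "(nat \<Rightarrow> real) \<Rightarrow> 'a::real_vector set \<Rightarrow> ('a \<Rightarrow> real) \<Rightarrow> ('a \<Rightarrow> real) set" where
  "B_Beurling_ge1 M S p = {h \<in> smooth_functions_on S p. \<exists>D. frechet_derivatives_on S p h D \<and>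
     (\<forall>\<rho>>0. bdd_above {opnorm_on S p k (D k x) / (\<rho> ^ k * fact k * M k) | k x. k \<ge> 1 \<and> x \<in> S})}"

definition B_Roumieu_ge1 ::
    "(nat \<Rightarrow> real) \<Rightarrow> 'a::real_vector set \<Rightarrow> ('a \<Rightarrow> real) \<Rightarrow> ('a \<Rightarrow> real) set" where
  "B_Roumieu_ge1 M S p = {h \<in> smooth_functions_on S p. \<exists>D. frechet_derivatives_on S p h D \<and>
     (\<exists>\<rho>>0. bdd_above {opnorm_on S p k (D k x) / (\<rho> ^ k * fact k * M k) | k x. k \<ge> 1 \<and> x \<in> S})}"

definition S_ge1 :: "'a::real_vector set \<Rightarrow> ('a \<Rightarrow> real) \<Rightarrow> ('a \<Rightarrow> real) set" where
  "S_ge1 S p = {h \<in> smooth_functions_on S p. \<exists>D. frechet_derivatives_on S p h D \<and>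
     (\<forall>k. \<forall>l\<ge>1. bdd_above {(1 + p x) ^ k * opnorm_on S p l (D l x) | x. x \<in> S})}"

definition S_Beurling_ge1 ::
    "(nat \<Rightarrow> real) \<Rightarrow> (nat \<Rightarrow> real) \<Rightarrow> 'a::real_vector set \<Rightarrow> ('a \<Rightarrow> real) \<Rightarrow> ('a \<Rightarrow> real) set" where
  "S_Beurling_ge1 L M S p = {h \<in> smooth_functions_on S p. \<exists>D. frechet_derivatives_on S p h D \<and>
     (\<forall>\<sigma>>0. bdd_above {(1 + p x) ^ k * opnorm_on S p l (D l x) /
         (\<sigma> ^ (k + l) * fact k * fact l * L k * M l) | k l x. l \<ge> 1 \<and> x \<in> S})}"

definition S_Roumieu_ge1 ::
    "(nat \<Rightarrow> real) \<Rightarrow> (nat \<Rightarrow> real) \<Rightarrow> 'a::real_vector set \<Rightarrow> ('a \<Rightarrow> real) \<Rightarrow> ('a \<Rightarrow> real) set" where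
  "S_Roumieu_ge1 L M S p = {h \<in> smooth_functions_on S p. \<exists>D. frechet_derivatives_on S p h D \<and>
     (\<exists>\<sigma>>0. bdd_above {(1 + p x) ^ k * opnorm_on S p l (D l x) /
         (\<sigma> ^ (k + l) * fact k * fact l * L k * M l) | k l x. l \<ge> 1 \<and> x \<in> S})}"

section \<open>The corresponding classes of mappings between convenient vector spaces\<close>

definition Minkowski_functional :: "'a::real_vector set \<Rightarrow> 'a \<Rightarrow> real" where
  "Minkowski_functional B x = Inf {r. r > 0 \<and> x \<in> (*\<^sub>R) r ` B}"

text \<open>The space \<open>E\<^sub>B\<close> is the pair \<^term>\<open>span B\<close>, \<^term>\<open>Minkowski_functional B\<close>. The inclusion
  \<open>i\<^sub>B\<close> is not written, as only values on \<^term>\<open>span B\<close> matter for membership in \<open>\<A>\<close>.\<close>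

definition convenient_maps ::
    "('a set \<Rightarrow> ('a \<Rightarrow> real) \<Rightarrow> ('a \<Rightarrow> real) set) \<Rightarrow>
     ('a::convenient_space \<Rightarrow> 'b::convenient_space) set" where
  "convenient_maps \<A> = {f \<in> smooth_maps.
     \<forall>\<phi> :: 'b \<Rightarrow> real. linear \<phi> \<and> continuous_on UNIV \<phi> \<longrightarrow>
       (\<forall>B. closed B \<and> absolutely_convex B \<and> vn_bounded B \<longrightarrow>
         \<phi> \<circ> f \<in> \<A> (span B) (Minkowski_functional B))}"

section \<open>Weight sequences\<close>

definition weight_sequence :: "(nat \<Rightarrow> real) \<Rightarrow> bool" where
  "weight_sequence M \<longleftrightarrow> (\<forall>k. 0 < M k) \<and> M 0 = 1 \<and> 1 \<le> M 1"

definition log_convex_sequence :: "(nat \<Rightarrow> real) \<Rightarrow> bool" where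
  "log_convex_sequence M \<longleftrightarrow> (\<forall>k\<ge>1. (M k)\<^sup>2 \<le> M (k - 1) * M (k + 1))"

end

theory Submission
  imports Defs
begin

text \<open>The derivatives of \<open>g\<close> are known through continuous functionals only. Difference quotients converge
  with a rate against each functional, hence, as weakly bounded sets are bounded (Mackey), they are
  Mackey--Cauchy sequences and \<open>g\<close> has vector valued derivatives. For bounds \<open>c \<phi>\<close> of the values of the
  functionals \<open>\<phi>\<close>, the set of all \<open>z\<close> with \<open>\<bar>\<phi> z\<bar> \<le> c \<phi>\<close> for all \<open>\<phi>\<close> is closed, absolutely convex and
  bounded, so that the suitably weighted derivatives of \<open>g\<close> lie in the unit ball of one space \<open>F\<^sub>B\<close>.
  There Faa di Bruno's formula applies; the decay in \<open>x\<close> is charged to a single block of each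
  partition, log-convexity yields \<open>M\<^sub>j M\<^sub>\<alpha>\<^sub>1 \<dots> M\<^sub>\<alpha>\<^sub>j \<le> M\<^sub>1\<^sup>j M\<^sub>l\<close>, and the sum of \<open>\<kappa>\<^sup>j j! \<alpha>\<^sub>1! \<dots> \<alpha>\<^sub>j!\<close> over
  all partitions of an \<open>l\<close>-element set is at most \<open>(\<kappa> + 2)\<^sup>l l!\<close>. In the Roumieu case the radii depend on
  the functional; there, geometric growth is tested against rapidly decreasing submultiplicative
  sequences instead.\<close>

section \<open>Minkowski functionals\<close>

text \<open>The hypothesis on \<open>f\<close> says something only on the spaces belonging to
  bounded sets, while \<open>g\<close> is known only one functional at a time, each with constants
  of its own. Before a chain rule can be used, the values of \<open>g\<close> and its derivatives
  must therefore be placed in the space of one bounded set, and that set must be fixed before the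
  constants of \<open>f\<close> are asked for, since these depend on it. Polars achieve this: a
  separate constant for each functional costs nothing, but a separate geometric rate would. Hence
  the Beurling case prescribes a rate, and the Roumieu case replaces the rates by one weight
  \<open>inverse (r n)\<close>. Such weights are supermultiplicative, as powers are, so that
  products over the blocks of a partition collapse. The decay is charged to one block because
  \<open>L\<close> is an arbitrary weight sequence: a product of several values of \<open>L\<close>
  could not be compared with a single one, whereas the other blocks are taken with exponent 0 and
  contribute \<open>L 0 = 1\<close>. The number \<open>\<kappa>\<close> becomes
  \<open>\<rho> * M 1\<close>, with \<open>\<rho>\<close> the rate of \<open>f\<close>, and
  \<open>\<rho> * M 1 + 2\<close> is the loss per derivative.\<close>

locale seminorm_on =
  fixes S :: "'a::real_vector set" and p :: "'a \<Rightarrow> real"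
  assumes subspace: "subspace S"
    and nonneg: "x \<in> S \<Longrightarrow> 0 \<le> p x"
    and scale: "x \<in> S \<Longrightarrow> p (a *\<^sub>R x) = \<bar>a\<bar> * p x"
    and triangle: "x \<in> S \<Longrightarrow> y \<in> S \<Longrightarrow> p (x + y) \<le> p x + p y"

lemma absolutely_convex_combination:
  "absolutely_convex B \<Longrightarrow> x \<in> B \<Longrightarrow> y \<in> B \<Longrightarrow> \<bar>a\<bar> + \<bar>b\<bar> \<le> 1 \<Longrightarrow> a *\<^sub>R x + b *\<^sub>R y \<in> B"
  unfolding absolutely_convex_def by blast

lemma absolutely_convex_scaleR:
  assumes "absolutely_convex B" "x \<in> B" "\<bar>a\<bar> \<le> 1"
  shows "a *\<^sub>R x \<in> B"
  using absolutely_convex_combination[OF assms(1,2,2), of a 0] assms(3) by simp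

lemma absolutely_convex_0: "absolutely_convex B \<Longrightarrow> 0 \<in> B"
  using absolutely_convex_scaleR[of B _ 0] unfolding absolutely_convex_def by fastforce

lemma dilation_mono:
  assumes "absolutely_convex B" "x \<in> (*\<^sub>R) r ` B" "0 < r" "r \<le> s"
  shows "x \<in> (*\<^sub>R) s ` B"
proof -
  obtain b where b: "b \<in> B" "x = r *\<^sub>R b" using assms(2) by blast
  have "(r / s) *\<^sub>R b \<in> B" by (rule absolutely_convex_scaleR[OF assms(1) b(1)]) (use assms in auto)
  moreover have "x = s *\<^sub>R ((r / s) *\<^sub>R b)" using b assms by simp
  ultimately show ?thesis by blast
qed

lemma dilation_add:
  assumes "absolutely_convex B" "x \<in> (*\<^sub>R) r ` B" "y \<in> (*\<^sub>R) s ` B" "0 < r" "0 < s"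
  shows "x + y \<in> (*\<^sub>R) (r + s) ` B"
proof -
  obtain b c where b: "b \<in> B" "x = r *\<^sub>R b" and c: "c \<in> B" "y = s *\<^sub>R c" using assms(2,3) by blast
  have "\<bar>r / (r + s)\<bar> + \<bar>s / (r + s)\<bar> \<le> 1" using assms by (simp add: add_divide_distrib[symmetric])
  from absolutely_convex_combination[OF assms(1) b(1) c(1) this]
  have "(r / (r + s)) *\<^sub>R b + (s / (r + s)) *\<^sub>R c \<in> B" .
  moreover have "x + y = (r + s) *\<^sub>R ((r / (r + s)) *\<^sub>R b + (s / (r + s)) *\<^sub>R c)"
    using b c assms by (simp add: scaleR_right_distrib)
  ultimately show ?thesis by blast
qed

text \<open>Guarantees that the infimum in \<open>Minkowski_functional\<close> runs over a nonempty
  set for every point of the span. The points absorbed by \<open>B\<close> form a subspace because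
  dilates add up.\<close>

lemma span_absorbed:
  assumes B: "absolutely_convex B" and "x \<in> span B"
  shows "\<exists>r>0. x \<in> (*\<^sub>R) r ` B"
  using assms(2)
proof (rule span_induct)
  show "subspace {x. \<exists>r>0. x \<in> (*\<^sub>R) r ` B}"
  proof (rule subspaceI; clarify)
    show "\<exists>r>0. 0 \<in> (*\<^sub>R) r ` B"
      using absolutely_convex_0[OF B] by (intro exI[of _ 1]) auto
  next
    fix x y and r s :: real assume "0 < r" "x \<in> B" "0 < s" "y \<in> B"
    then show "\<exists>t>0. r *\<^sub>R x + s *\<^sub>R y \<in> (*\<^sub>R) t ` B"
      using dilation_add[OF B, of "r *\<^sub>R x" r "s *\<^sub>R y" s] by (intro exI[of _ "r + s"]) auto
  next
    fix c x and r :: real assume "0 < r" and b: "x \<in> B"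
    \<comment> \<open>The summand 1 keeps \<open>t\<close> positive when \<open>c\<close> is
      0.\<close>
    define t where "t = \<bar>c\<bar> * r + 1"
    have t: "0 < t" using \<open>0 < r\<close> unfolding t_def by (simp add: add_nonneg_pos)
    have "(c * r / t) *\<^sub>R x \<in> B"
      using t \<open>0 < r\<close> by (intro absolutely_convex_scaleR[OF B b]) (auto simp: t_def abs_mult)
    moreover have "c *\<^sub>R r *\<^sub>R x = t *\<^sub>R ((c * r / t) *\<^sub>R x)" using t by simp
    ultimately show "\<exists>t>0. c *\<^sub>R r *\<^sub>R x \<in> (*\<^sub>R) t ` B" using t by blast
  qed
next
  fix x assume "x \<in> B"
  then show "\<exists>r>0. x \<in> (*\<^sub>R) r ` B" by (intro exI[of _ 1]) auto
qed

lemma Minkowski_functional_le: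
  assumes "0 < r" "x \<in> (*\<^sub>R) r ` B"
  shows "Minkowski_functional B x \<le> r"
  unfolding Minkowski_functional_def
  by (rule cInf_lower) (use assms in \<open>auto intro!: bdd_belowI[of _ 0]\<close>)

lemma Minkowski_functional_nonneg:
  assumes "absolutely_convex B" "x \<in> span B"
  shows "0 \<le> Minkowski_functional B x"
  unfolding Minkowski_functional_def
  by (rule cInf_greatest) (use span_absorbed[OF assms] in auto)

text \<open>The infimum need not be attained, so membership in a dilate follows only from a strict
  inequality; hence the passages through an additional \<open>e\<close> or through all larger radii
  below.\<close>

lemma Minkowski_functional_less:
  assumes "absolutely_convex B" "x \<in> span B" "Minkowski_functional B x < r"
  shows "x \<in> (*\<^sub>R) r ` B"
proof -
  have "{r. r > 0 \<and> x \<in> (*\<^sub>R) r ` B} \<noteq> {}" using span_absorbed[OF assms(1,2)] by auto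
  from cInf_lessD[OF this assms(3)[unfolded Minkowski_functional_def]]
  obtain s where "0 < s" "x \<in> (*\<^sub>R) s ` B" "s < r" by blast
  then show ?thesis using dilation_mono[OF assms(1)] by force
qed

lemma seminorm_on_Minkowski_functional:
  fixes B :: "'a::real_vector set"
  assumes B: "absolutely_convex B"
  shows "seminorm_on (span B) (Minkowski_functional B)"
proof
  let ?p = "Minkowski_functional B"
  show "subspace (span B)" by simp
  show nn: "0 \<le> ?p x" if "x \<in> span B" for x
    using Minkowski_functional_nonneg[OF B that] .
  \<comment> \<open>Only one inequality needs an approximation; the opposite one is the same
    inequality for \<open>inverse a\<close> and the point \<open>a *\<^sub>R x\<close>.\<close>
  have le: "?p (a *\<^sub>R x) \<le> \<bar>a\<bar> * ?p x" if x: "x \<in> span B" and "a \<noteq> 0" for a x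
  proof (rule field_le_epsilon)
    fix e :: real assume "0 < e"
    define r where "r = ?p x + e / \<bar>a\<bar>"
    have r: "?p x < r" using \<open>a \<noteq> 0\<close> \<open>0 < e\<close> unfolding r_def by simp
    then have "0 < r" using nn[OF x] by simp
    obtain b where b: "b \<in> B" "x = r *\<^sub>R b" using Minkowski_functional_less[OF B x r] by blast
    have "sgn a *\<^sub>R b \<in> B" (is "?b \<in> B") using \<open>a \<noteq> 0\<close> by (intro absolutely_convex_scaleR[OF B b(1)]) (simp add: abs_sgn_eq)
    moreover have "a *\<^sub>R x = (\<bar>a\<bar> * r) *\<^sub>R ?b"
      using b by (auto simp: sgn_if)
    ultimately have "a *\<^sub>R x \<in> (*\<^sub>R) (\<bar>a\<bar> * r) ` B" by (rule image_eqI[rotated])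
    then have "?p (a *\<^sub>R x) \<le> \<bar>a\<bar> * r"
      using \<open>0 < r\<close> \<open>a \<noteq> 0\<close> by (intro Minkowski_functional_le) auto
    then show "?p (a *\<^sub>R x) \<le> \<bar>a\<bar> * ?p x + e"
      using \<open>a \<noteq> 0\<close> unfolding r_def by (simp add: algebra_simps)
  qed
  show "?p (a *\<^sub>R x) = \<bar>a\<bar> * ?p x" if x: "x \<in> span B" for a x
  proof (cases "a = 0")
    case True
    have "?p 0 \<le> e" if "0 < e" for e
      using absolutely_convex_0[OF B] that by (intro Minkowski_functional_le) (auto simp: image_iff intro!: bexI[of _ 0])
    then have "?p 0 \<le> 0" by (meson dense_ge)
    then show ?thesis using True nn[of 0] by (simp add: span_zero)
  next
    case False
    have "?p x = ?p (inverse a *\<^sub>R (a *\<^sub>R x))" using False by simp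
    also have "\<dots> \<le> \<bar>inverse a\<bar> * ?p (a *\<^sub>R x)"
      using False x by (intro le) (auto simp: span_scale)
    finally have "\<bar>a\<bar> * ?p x \<le> ?p (a *\<^sub>R x)" using False by (simp add: field_simps)
    with le[OF x False] show ?thesis by simp
  qed
  show "?p (x + y) \<le> ?p x + ?p y" if x: "x \<in> span B" and y: "y \<in> span B" for x y
  proof (rule field_le_epsilon)
    fix e :: real assume "0 < e"
    have "x \<in> (*\<^sub>R) (?p x + e / 2) ` B" "y \<in> (*\<^sub>R) (?p y + e / 2) ` B"
      using \<open>0 < e\<close> by (auto intro!: Minkowski_functional_less B x y)
    from dilation_add[OF B this] have "x + y \<in> (*\<^sub>R) (?p x + e / 2 + (?p y + e / 2)) ` B"
      using nn[OF x] nn[OF y] \<open>0 < e\<close> by simp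
    from Minkowski_functional_le[OF _ this] show "?p (x + y) \<le> ?p x + ?p y + e"
      using nn[OF x] nn[OF y] \<open>0 < e\<close> by simp
  qed
qed

section \<open>Continuous functionals on locally convex spaces\<close>

lemma tendsto_scaleR_locally_convex:
  fixes g :: "'b \<Rightarrow> 'a::locally_convex_space"
  assumes "(f \<longlongrightarrow> a) F" "(g \<longlongrightarrow> x) F"
  shows "((\<lambda>t. f t *\<^sub>R g t) \<longlongrightarrow> a *\<^sub>R x) F"
  using filterlim_compose[OF tendsto_scaleR_lcs filterlim_Pair[OF assms]] by simp

text \<open>The axiom \<open>locally_convex_at_0\<close> provides convex neighbourhoods only.
  Intersecting with the reflected set makes the neighbourhood symmetric, and convexity together with
  0 then gives stability under all factors of modulus at most 1.\<close>

lemma absolutely_convex_neighbourhood: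
  fixes U :: "'a::locally_convex_space set"
  assumes "open U" "0 \<in> U"
  shows "\<exists>W. open W \<and> absolutely_convex W \<and> W \<subseteq> U"
proof -
  obtain V where V: "open V" "0 \<in> V" "V \<subseteq> U"
    and "\<forall>x\<in>V. \<forall>y\<in>V. \<forall>u\<ge>0. \<forall>v\<ge>0. u + v = 1 \<longrightarrow> u *\<^sub>R x + v *\<^sub>R y \<in> V"
    using locally_convex_at_0[OF assms] by (elim exE conjE)
  then have cv: "u *\<^sub>R x + v *\<^sub>R y \<in> V" if "x \<in> V" "y \<in> V" "0 \<le> u" "0 \<le> v" "u + v = 1" for x y u v
    using that by simp
  define W where "W = V \<inter> uminus -` V"
  have "continuous_on UNIV (uminus :: 'a \<Rightarrow> 'a)" by (intro continuous_intros)
  then have "open W" unfolding W_def using V(1) by (intro open_Int open_vimage)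
  have cW: "u *\<^sub>R x + v *\<^sub>R y \<in> W" if "x \<in> W" "y \<in> W" "0 \<le> u" "0 \<le> v" "u + v = 1" for x y u v
    using cv[of x y u v] cv[of "- x" "- y" u v] that unfolding W_def by simp
  have W0: "0 \<in> W" using V unfolding W_def by simp
  have sW: "a *\<^sub>R x \<in> W" if "x \<in> W" "\<bar>a\<bar> \<le> 1" for a x
  proof -
    have "\<bar>a\<bar> *\<^sub>R x + (1 - \<bar>a\<bar>) *\<^sub>R 0 \<in> W" using that by (intro cW W0) auto
    then show ?thesis unfolding W_def by (cases "0 \<le> a") auto
  qed
  have "a *\<^sub>R x + b *\<^sub>R y \<in> W" if "x \<in> W" "y \<in> W" "\<bar>a\<bar> + \<bar>b\<bar> \<le> 1" for x y a b
  proof (cases "a = 0 \<and> b = 0")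
    case True then show ?thesis using W0 by simp
  next
    case False
    define t where "t = \<bar>a\<bar> + \<bar>b\<bar>"
    have t: "0 < t" using False unfolding t_def by auto
    \<comment> \<open>A convex combination with weights \<open>\<bar>a\<bar> / t\<close> and
      \<open>\<bar>b\<bar> / t\<close>; the points are rescaled by \<open>sgn a * t\<close> and
      \<open>sgn b * t\<close>, of modulus at most 1, so that the factors \<open>t\<close>
      cancel.\<close>
    have "(\<bar>a\<bar> / t) *\<^sub>R (sgn a * t) *\<^sub>R x + (\<bar>b\<bar> / t) *\<^sub>R (sgn b * t) *\<^sub>R y \<in> W"
      using that t by (intro cW sW) (auto simp: abs_mult abs_sgn_eq t_def add_divide_distrib[symmetric])
    moreover have "\<bar>c\<bar> / t * (sgn c * t) = c" for c
      using t by (simp add: sgn_if)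
    ultimately show ?thesis by simp
  qed
  then have "absolutely_convex W" using W0 unfolding absolutely_convex_def by blast
  then show ?thesis using \<open>open W\<close> V(3) unfolding W_def by blast
qed

text \<open>The points \<open>x / n\<close> tend to 0, hence enter every neighbourhood of 0.
  Consequently the gauge of an absolutely convex open set is a seminorm on the whole space.\<close>

lemma span_neighbourhood:
  fixes W :: "'a::locally_convex_space set"
  assumes "open W" "0 \<in> W"
  shows "span W = UNIV"
proof -
  have "x \<in> span W" for x
  proof -
    have "((\<lambda>n. inverse (real (Suc n)) *\<^sub>R x) \<longlongrightarrow> 0 *\<^sub>R x) sequentially"
      by (rule tendsto_scaleR_locally_convex[OF LIMSEQ_inverse_real_of_nat tendsto_const])
    then have "eventually (\<lambda>n. inverse (real (Suc n)) *\<^sub>R x \<in> W) sequentially"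
      using assms by (intro topological_tendstoD) simp_all
    then obtain n where "inverse (real (Suc n)) *\<^sub>R x \<in> W" by (auto simp: eventually_sequentially)
    then have "real (Suc n) *\<^sub>R (inverse (real (Suc n)) *\<^sub>R x) \<in> span W" by (intro span_scale span_base)
    then show ?thesis by simp
  qed
  then show ?thesis by blast
qed

definition dual :: "('a::locally_convex_space \<Rightarrow> real) \<Rightarrow> bool" where
  "dual \<phi> \<longleftrightarrow> linear \<phi> \<and> continuous_on UNIV \<phi>"

lemma dual_add: "dual \<phi> \<Longrightarrow> \<phi> (x + y) = \<phi> x + \<phi> y"
  and dual_diff: "dual \<phi> \<Longrightarrow> \<phi> (x - y) = \<phi> x - \<phi> y"
  and dual_scaleR: "dual \<phi> \<Longrightarrow> \<phi> (a *\<^sub>R x) = a * \<phi> x"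
  and dual_0: "dual \<phi> \<Longrightarrow> \<phi> 0 = 0"
  unfolding dual_def by (simp_all add: linear_add linear_diff linear_cmul linear_0)

lemma dual_tendsto:
  assumes "dual \<phi>" "(f \<longlongrightarrow> x) F"
  shows "((\<lambda>t. \<phi> (f t)) \<longlongrightarrow> \<phi> x) F"
proof -
  have "(\<phi> \<longlongrightarrow> \<phi> x) (at x)"
    using assms(1) by (simp add: dual_def continuous_on_def)
  then show ?thesis using assms(2) by (rule tendsto_compose)
qed

text \<open>Continuity at \<open>x\<close> holds because \<open>y - x\<close> eventually lies in any
  prescribed dilate of \<open>W\<close>, where the gauge is small. It is needed because Hahn-Banach
  and the gliding hump deliver functionals that are dominated by a gauge.\<close>

lemma dualI:
  fixes \<phi> :: "'a::locally_convex_space \<Rightarrow> real"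
  assumes W: "open W" "absolutely_convex W" and lin: "linear \<phi>"
    and le: "\<And>x. \<bar>\<phi> x\<bar> \<le> C * Minkowski_functional W x"
  shows "dual \<phi>"
proof -
  have 0: "0 \<in> W" using absolutely_convex_0[OF W(2)] .
  have "(\<phi> \<longlongrightarrow> \<phi> x) (at x)" for x
  proof (rule tendstoI)
    fix e :: real assume "0 < e"
    define d where "d = e / (\<bar>C\<bar> + 1)"
    have d: "0 < d" using \<open>0 < e\<close> unfolding d_def by (simp add: add_nonneg_pos)
    have "((\<lambda>y. inverse d *\<^sub>R (y - x)) \<longlongrightarrow> inverse d *\<^sub>R (x - x)) (at x)"
      by (intro tendsto_scaleR_locally_convex tendsto_intros)
    then have "eventually (\<lambda>y. inverse d *\<^sub>R (y - x) \<in> W) (at x)"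
      using W(1) 0 by (intro topological_tendstoD) simp_all
    then show "eventually (\<lambda>y. dist (\<phi> y) (\<phi> x) < e) (at x)"
    proof eventually_elim
      case (elim y)
      have "y - x = d *\<^sub>R (inverse d *\<^sub>R (y - x))" using d by simp
      then have "y - x \<in> (*\<^sub>R) d ` W" using elim by blast
      then have m: "Minkowski_functional W (y - x) \<le> d" using d by (rule Minkowski_functional_le[rotated])
      have m0: "0 \<le> Minkowski_functional W (y - x)"
        by (rule Minkowski_functional_nonneg[OF W(2)]) (simp add: span_neighbourhood[OF W(1) 0])
      have "\<bar>\<phi> y - \<phi> x\<bar> = \<bar>\<phi> (y - x)\<bar>" using lin by (simp add: linear_diff)
      also have "\<dots> \<le> C * Minkowski_functional W (y - x)" by (rule le)
      also have "\<dots> \<le> \<bar>C\<bar> * Minkowski_functional W (y - x)" using m0 by (intro mult_right_mono) auto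
      also have "\<dots> \<le> \<bar>C\<bar> * d" using m by (intro mult_left_mono) auto
      also have "\<dots> < (\<bar>C\<bar> + 1) * d" using d by simp
      also have "\<dots> = e" unfolding d_def by (simp add: add_nonneg_pos less_imp_neq[symmetric] field_simps)
      finally show ?case by (simp add: dist_real_def)
    qed
  qed
  then show ?thesis using lin unfolding dual_def continuous_on_def by simp
qed

section \<open>The theorems of Hahn--Banach and Mackey\<close>

definition sublinear :: "('a::real_vector \<Rightarrow> real) \<Rightarrow> bool" where
  "sublinear q \<longleftrightarrow> (\<forall>x y. q (x + y) \<le> q x + q y) \<and> (\<forall>a\<ge>0. \<forall>x. q (a *\<^sub>R x) = a * q x)"

lemma sublinear_add: "sublinear q \<Longrightarrow> q (x + y) \<le> q x + q y"
  and sublinear_scale: "sublinear q \<Longrightarrow> 0 \<le> a \<Longrightarrow> q (a *\<^sub>R x) = a * q x"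
  unfolding sublinear_def by blast+

lemma sublinear_0: "sublinear q \<Longrightarrow> q 0 = 0"
  using sublinear_scale[of q 0 0] by simp

lemma sublinear_uminus: "sublinear q \<Longrightarrow> - q (- x) \<le> q x"
  using sublinear_add[of q x "- x"] sublinear_0[of q] by simp

text \<open>The new functional at \<open>x\<close> is the infimum of
  \<open>q (x + t *\<^sub>R b) - t * q b\<close> over \<open>t \<ge> 0\<close>; the choice
  \<open>t = 1\<close> gives the bound at \<open>- b\<close>. Applied to a minimal sublinear
  functional \<open>m\<close>, it forces \<open>m (- b) \<le> - m b\<close> for every
  \<open>b\<close>, and a sublinear functional that is odd is linear.\<close>

lemma sublinear_decrease:
  fixes q :: "'a::real_vector \<Rightarrow> real"
  assumes q: "sublinear q"
  shows "\<exists>q'. sublinear q' \<and> q' \<le> q \<and> q' (- b) \<le> - q b"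
proof -
  define A where "A x = {q (x + t *\<^sub>R b) - t * q b | t. 0 \<le> t}" for x
  define q' where "q' x = Inf (A x)" for x
  have ne: "A x \<noteq> {}" for x unfolding A_def by force
  \<comment> \<open>This lower bound, independent of \<open>t\<close>, keeps the infimum
    finite.\<close>
  have lb: "- q (- x) \<le> q (x + t *\<^sub>R b) - t * q b" if "0 \<le> t" for x t
  proof -
    have "t * q b = q ((x + t *\<^sub>R b) + (- x))" using sublinear_scale[OF q that] by simp
    also have "\<dots> \<le> q (x + t *\<^sub>R b) + q (- x)" by (rule sublinear_add[OF q])
    finally show ?thesis by simp
  qed
  have bdd: "bdd_below (A x)" for x
    unfolding A_def by (rule bdd_belowI[of _ "- q (- x)"]) (use lb in auto)
  have le: "q' x \<le> q (x + t *\<^sub>R b) - t * q b" if "0 \<le> t" for x t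
    unfolding q'_def by (rule cInf_lower[OF _ bdd]) (use that in \<open>auto simp: A_def\<close>)
  have gr: "z \<le> q' x" if "\<And>t. 0 \<le> t \<Longrightarrow> z \<le> q (x + t *\<^sub>R b) - t * q b" for x z
    unfolding q'_def by (rule cInf_greatest[OF ne]) (use that in \<open>auto simp: A_def\<close>)
  have add: "q' (x + y) \<le> q' x + q' y" for x y
  proof -
    have "q' (x + y) - (q (y + s *\<^sub>R b) - s * q b) \<le> q' x" if s: "0 \<le> s" for s
    proof (rule gr)
      fix t :: real assume t: "0 \<le> t"
      have "q' (x + y) \<le> q ((x + t *\<^sub>R b) + (y + s *\<^sub>R b)) - (t + s) * q b"
        using le[of "t + s" "x + y"] s t by (simp add: algebra_simps)
      also have "\<dots> \<le> q (x + t *\<^sub>R b) + q (y + s *\<^sub>R b) - (t + s) * q b"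
        using sublinear_add[OF q] by simp
      finally show "q' (x + y) - (q (y + s *\<^sub>R b) - s * q b) \<le> q (x + t *\<^sub>R b) - t * q b"
        by (simp add: algebra_simps)
    qed
    then have "q' (x + y) - q' x \<le> q' y" by (intro gr) (simp add: algebra_simps)
    then show ?thesis by simp
  qed
  have scale_le: "q' (a *\<^sub>R x) \<le> a * q' x" if a: "0 < a" for a x
  proof -
    have "q' (a *\<^sub>R x) / a \<le> q' x"
    proof (rule gr)
      fix t :: real assume t: "0 \<le> t"
      have "q' (a *\<^sub>R x) \<le> q (a *\<^sub>R x + (a * t) *\<^sub>R b) - (a * t) * q b" using le[of "a * t"] a t by simp
      also have "a *\<^sub>R x + (a * t) *\<^sub>R b = a *\<^sub>R (x + t *\<^sub>R b)" by (simp add: scaleR_right_distrib)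
      also have "q \<dots> = a * q (x + t *\<^sub>R b)" using a by (intro sublinear_scale[OF q]) simp
      finally show "q' (a *\<^sub>R x) / a \<le> q (x + t *\<^sub>R b) - t * q b"
        using a by (simp add: field_simps)
    qed
    then show ?thesis using a by (simp add: field_simps)
  qed
  have q'0: "q' 0 = 0"
  proof (rule antisym)
    show "q' 0 \<le> 0" using le[of 0 0] sublinear_0[OF q] by simp
    show "0 \<le> q' 0" by (rule gr) (simp add: sublinear_scale[OF q])
  qed
  have scale: "q' (a *\<^sub>R x) = a * q' x" if a: "0 \<le> a" for a x
  proof (cases "a = 0")
    case False
    then have a: "0 < a" using a by simp
    have "q' x = q' (inverse a *\<^sub>R (a *\<^sub>R x))" using a by simp
    also have "\<dots> \<le> inverse a * q' (a *\<^sub>R x)" using a by (intro scale_le) simp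
    finally have "a * q' x \<le> q' (a *\<^sub>R x)" using a by (simp add: field_simps)
    then show ?thesis using scale_le[OF a, of x] by simp
  qed (simp add: q'0)
  have "q' (- b) \<le> - q b" using le[of 1 "- b"] sublinear_0[OF q] by simp
  moreover have "q' \<le> q" using le[of 0] by (simp add: le_fun_def)
  moreover have "sublinear q'" using add scale unfolding sublinear_def by blast
  ultimately show ?thesis by blast
qed

text \<open>Zorn's lemma for the reversed pointwise order. The pointwise infimum of a chain is again
  sublinear, and it is finite because every sublinear functional below \<open>q\<close> takes at
  \<open>x\<close> a value of at least \<open>- q (- x)\<close>.\<close>

lemma minimal_sublinear_exists:
  fixes q :: "'a::real_vector \<Rightarrow> real"
  assumes q: "sublinear q"
  shows "\<exists>m. sublinear m \<and> m \<le> q \<and> (\<forall>r. sublinear r \<longrightarrow> r \<le> m \<longrightarrow> r = m)"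
proof -
  define A where "A = {r. sublinear r \<and> r \<le> q}"
  have "\<exists>m\<in>A. \<forall>r\<in>A. r \<le> m \<longrightarrow> r = m"
  proof (rule predicate_Zorn[of A "\<lambda>x y. y \<le> x", simplified])
    show "partial_order_on A (relation_of (\<lambda>x y. y \<le> x) A)"
      by (rule partial_order_on_relation_ofI) auto
    fix C assume C: "C \<in> Chains (relation_of (\<lambda>x y. y \<le> x) A)"
    show "\<exists>u\<in>A. \<forall>a\<in>C. u \<le> a"
    proof (cases "C = {}")
      case True then show ?thesis using q unfolding A_def by auto
    next
      case False
      have CA: "r \<in> A" if "r \<in> C" for r
        using C that unfolding Chains_def relation_of_def by blast
      have tot: "r \<le> s \<or> s \<le> r" if "r \<in> C" "s \<in> C" for r s
        using C that unfolding Chains_def relation_of_def by blast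
      have sub: "sublinear r" "r x \<le> q x" if "r \<in> C" for r x
        using CA[OF that] unfolding A_def by (auto simp: le_fun_def)
      define u where "u x = (INF r\<in>C. r x)" for x
      have bdd: "bdd_below ((\<lambda>r. r x) ` C)" for x
      proof (rule bdd_belowI2)
        fix r assume r: "r \<in> C"
        show "- q (- x) \<le> r x" using sublinear_uminus[OF sub(1)[OF r], of x] sub(2)[OF r, of "- x"] by simp
      qed
      have le: "u x \<le> r x" if "r \<in> C" for r x unfolding u_def by (rule cINF_lower[OF bdd that])
      have gr: "z \<le> u x" if "\<And>r. r \<in> C \<Longrightarrow> z \<le> r x" for z x
        unfolding u_def by (rule cINF_greatest[OF False that])
      have "u (x + y) \<le> u x + u y" for x y
      proof -
        have "u (x + y) - s y \<le> u x" if s: "s \<in> C" for s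
        proof (rule gr)
          fix r assume r: "r \<in> C"
          \<comment> \<open>Subadditivity of the infimum needs one functional below both
            \<open>r\<close> and \<open>s\<close>; this is where the chain property enters.\<close>
          define m where "m = (if r \<le> s then r else s)"
          have m: "m \<in> C" "m \<le> r" "m \<le> s" using tot[OF r s] r s unfolding m_def by auto
          have "u (x + y) \<le> m x + m y" using le[OF m(1), of "x + y"] sublinear_add[OF sub(1)[OF m(1)], of x y] by simp
          also have "\<dots> \<le> r x + s y" using m(2,3) by (simp add: le_fun_def add_mono)
          finally show "u (x + y) - s y \<le> r x" by simp
        qed
        then have "u (x + y) - u x \<le> u y" by (intro gr) (simp add: algebra_simps)
        then show ?thesis by simp
      qed
      moreover have "u (a *\<^sub>R x) = a * u x" if a: "0 \<le> a" for a x
      proof (cases "a = 0")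
        case True
        obtain r where r: "r \<in> C" using False by blast
        have "u 0 = 0"
        proof (rule antisym)
          show "u 0 \<le> 0" using le[OF r, of 0] sublinear_0[OF sub(1)[OF r]] by simp
          show "0 \<le> u 0" by (rule gr) (simp add: sublinear_0[OF sub(1)])
        qed
        then show ?thesis using True by simp
      next
        case False
        then have a: "0 < a" using a by simp
        show ?thesis
        proof (rule antisym)
          have "u (a *\<^sub>R x) / a \<le> u x"
          proof (rule gr)
            fix r assume r: "r \<in> C"
            show "u (a *\<^sub>R x) / a \<le> r x"
              using le[OF r, of "a *\<^sub>R x"] sublinear_scale[OF sub(1)[OF r], of a x] a
              by (simp add: field_simps)
          qed
          then show "u (a *\<^sub>R x) \<le> a * u x" using a by (simp add: field_simps)
          show "a * u x \<le> u (a *\<^sub>R x)"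
          proof (rule gr)
            fix r assume r: "r \<in> C"
            show "a * u x \<le> r (a *\<^sub>R x)"
              using le[OF r, of x] sublinear_scale[OF sub(1)[OF r], of a x] a by simp
          qed
        qed
      qed
      ultimately have "sublinear u" unfolding sublinear_def by blast
      moreover have "u \<le> q"
        using le sub False by (meson ex_in_conv le_funI order_trans)
      ultimately show ?thesis using le unfolding A_def by (auto simp: le_fun_def)
    qed
  qed
  then show ?thesis unfolding A_def by (blast intro: order_trans)
qed

text \<open>Decreasing \<open>q\<close> at \<open>a\<close> first makes the value at
  \<open>- a\<close> at most \<open>- q a\<close>. Any linear functional below the result is then
  forced to take the value \<open>q a\<close> at \<open>a\<close>, so passing to a minimal one loses
  nothing.\<close>

lemma Hahn_Banach_sublinear:
  fixes q :: "'a::real_vector \<Rightarrow> real"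
  assumes q: "sublinear q"
  shows "\<exists>\<phi>. linear \<phi> \<and> \<phi> \<le> q \<and> \<phi> a = q a"
proof -
  obtain q' where q': "sublinear q'" "q' \<le> q" "q' (- a) \<le> - q a"
    using sublinear_decrease[OF q] by blast
  obtain m where m: "sublinear m" "m \<le> q'" and min: "\<And>r. sublinear r \<Longrightarrow> r \<le> m \<Longrightarrow> r = m"
    using minimal_sublinear_exists[OF q'(1)] by blast
  have odd: "m (- b) = - m b" for b
  proof -
    obtain r where "sublinear r" "r \<le> m" "r (- b) \<le> - m b" using sublinear_decrease[OF m(1)] by blast
    then have "m (- b) \<le> - m b" using min by blast
    then show ?thesis using sublinear_uminus[OF m(1), of b] by simp
  qed
  have "linear m"
  proof (rule linearI)
    fix x y
    have "m (- x + - y) \<le> m (- x) + m (- y)" by (rule sublinear_add[OF m(1)])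
    then have "m x + m y \<le> m (x + y)" using odd[of x] odd[of y] odd[of "x + y"] by simp
    then show "m (x + y) = m x + m y" using sublinear_add[OF m(1), of x y] by simp
  next
    fix c :: real and x
    show "m (c *\<^sub>R x) = c *\<^sub>R m x"
      using sublinear_scale[OF m(1), of c x] sublinear_scale[OF m(1), of "- c" x] odd[of "c *\<^sub>R x"]
      by (cases "0 \<le> c") auto
  qed
  moreover have "m a = q a"
  proof (rule antisym)
    show "m a \<le> q a" using m(2) q'(2) by (auto simp: le_fun_def intro: order_trans)
    have "m (- a) \<le> - q a" using m(2) q'(3) by (auto simp: le_fun_def intro: order_trans)
    then show "q a \<le> m a" using odd[of a] by simp
  qed
  ultimately show ?thesis using m(2) q'(2) by (meson order_trans)
qed

lemma Hahn_Banach_norming: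
  fixes W :: "'a::locally_convex_space set"
  assumes W: "open W" "absolutely_convex W"
  shows "\<exists>\<phi>. linear \<phi> \<and> (\<forall>x. \<bar>\<phi> x\<bar> \<le> Minkowski_functional W x) \<and> \<phi> a = Minkowski_functional W a"
proof -
  let ?p = "Minkowski_functional W"
  interpret seminorm_on UNIV ?p
    using seminorm_on_Minkowski_functional[OF W(2)]
    by (simp add: span_neighbourhood[OF W(1) absolutely_convex_0[OF W(2)]])
  have "sublinear ?p" unfolding sublinear_def using triangle scale by simp
  from Hahn_Banach_sublinear[OF this] obtain \<phi>
    where \<phi>: "linear \<phi>" "\<And>x. \<phi> x \<le> ?p x" "\<phi> a = ?p a" by (auto simp: le_fun_def)
  have "\<bar>\<phi> x\<bar> \<le> ?p x" for x
    using \<phi>(2)[of x] \<phi>(2)[of "- x"] scale[of x "- 1"] \<phi>(1) by (simp add: linear_neg)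
  then show ?thesis using \<phi> by blast
qed

text \<open>A nonzero \<open>z\<close> is missed by some absolutely convex open \<open>W\<close>,
  whose gauge at \<open>z\<close> is then at least 1 and is attained by a norming functional. Vector
  identities can thus be tested against functionals.\<close>

lemma dual_separates:
  fixes z :: "'a::locally_convex_space"
  assumes "\<And>\<phi>. dual \<phi> \<Longrightarrow> \<phi> z = 0"
  shows "z = 0"
proof (rule ccontr)
  assume "z \<noteq> 0"
  then obtain U where "open U" "0 \<in> U" "z \<notin> U" using t1_space[of 0 z] by metis
  then obtain W where W: "open W" "absolutely_convex W" "W \<subseteq> U"
    using absolutely_convex_neighbourhood by blast
  obtain \<phi> where \<phi>: "linear \<phi>" "\<And>x. \<bar>\<phi> x\<bar> \<le> Minkowski_functional W x" "\<phi> z = Minkowski_functional W z"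
    using Hahn_Banach_norming[OF W(1,2)] by blast
  have "dual \<phi>" using dualI[OF W(1,2) \<phi>(1), of 1] \<phi>(2) by simp
  then have "Minkowski_functional W z < 1" using assms[of \<phi>] \<phi>(3) by simp
  then have "z \<in> W"
    using Minkowski_functional_less[OF W(2), of z 1] span_neighbourhood[OF W(1) absolutely_convex_0[OF W(2)]] by simp
  then show False using W \<open>z \<notin> U\<close> by blast
qed

text \<open>Gliding hump: if the gauge of a neighbourhood were unbounded along \<open>a n\<close>, then, with norming
  functionals \<open>\<mu> n\<close> of \<open>a n\<close> and suitable signs, the sum of the \<open>\<plusminus> \<mu> n / 3 ^ n\<close> would be a continuous
  functional that is unbounded along \<open>a n\<close>.\<close>

theorem vn_bounded_if_weakly_bounded:
  fixes A :: "'a::locally_convex_space set"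
  assumes wb: "\<And>\<phi>. dual \<phi> \<Longrightarrow> \<exists>C. \<forall>a\<in>A. \<bar>\<phi> a\<bar> \<le> C"
  shows "vn_bounded A"
  unfolding vn_bounded_def
proof (intro allI impI, elim conjE)
  fix U :: "'a set" assume "open U" "0 \<in> U"
  then obtain W where W: "open W" "absolutely_convex W" "W \<subseteq> U"
    using absolutely_convex_neighbourhood by blast
  let ?P = "Minkowski_functional W"
  have sp: "span W = UNIV" using span_neighbourhood[OF W(1) absolutely_convex_0[OF W(2)]] .
  interpret seminorm_on UNIV ?P
    using seminorm_on_Minkowski_functional[OF W(2)] by (simp add: sp)
  have "\<exists>C. \<forall>a\<in>A. ?P a \<le> C"
  proof (rule ccontr)
    assume neg: "\<nexists>C. \<forall>a\<in>A. ?P a \<le> C"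
    \<comment> \<open>After division by \<open>3 ^ n\<close> the n-th hump has height above
      \<open>2 * n\<close>; all later terms together amount to at most half of it, so at least
      \<open>n\<close> survives.\<close>
    have "\<exists>a. a \<in> A \<and> 2 * real n * 3 ^ n < ?P a" for n using neg by (meson not_le)
    then obtain a where a: "\<And>n. a n \<in> A" "\<And>n. 2 * real n * 3 ^ n < ?P (a n)" by metis
    have "\<exists>\<mu>. linear \<mu> \<and> (\<forall>x. \<bar>\<mu> x\<bar> \<le> ?P x) \<and> \<mu> (a n) = ?P (a n)" for n
      by (rule Hahn_Banach_norming[OF W(1,2)])
    then obtain \<mu> where \<mu>: "\<And>n. linear (\<mu> n)" "\<And>n x. \<bar>\<mu> n x\<bar> \<le> ?P x" "\<And>n. \<mu> n (a n) = ?P (a n)" by metis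
    \<comment> \<open>Partial sums with signs chosen one after another: the new term has the sign of
      the preceding partial sum at \<open>a n\<close>, so the two cannot cancel there.\<close>
    define L where "L = rec_nat (\<lambda>x. 0) (\<lambda>n l x. l x + (if l (a n) \<ge> 0 then 1 else - 1) * (1/3)^n * \<mu> n x)"
    have L0: "L 0 x = 0" for x unfolding L_def by simp
    have LS: "L (Suc n) x = L n x + (if L n (a n) \<ge> 0 then 1 else - 1) * (1/3)^n * \<mu> n x" for n x
      unfolding L_def by simp
    define d where "d n x = L (Suc n) x - L n x" for n x
    have d_le: "norm (d n x) \<le> (1/3)^n * ?P x" for n x
      using \<mu>(2)[of n x] unfolding d_def LS by (auto simp: abs_mult)
    have linL: "linear (L n)" for n
      by (induction n) (auto simp: L0 LS linear_iff algebra_simps linear_add[OF \<mu>(1)] linear_scale[OF \<mu>(1)])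
    have sg: "summable (\<lambda>n. (1/3)^n * ?P x)" for x
      by (intro summable_mult2 summable_geometric) simp
    have sd: "summable (\<lambda>n. d n x)" for x
      by (rule summable_comparison_test'[OF sg]) (use d_le in auto)
    define \<phi> where "\<phi> x = (\<Sum>n. d n x)" for x
    have dlin: "d n (x + y) = d n x + d n y" "d n (c *\<^sub>R x) = c * d n x" for n x y c
      unfolding d_def by (simp_all add: linear_add[OF linL] linear_scale[OF linL] algebra_simps)
    have "linear \<phi>"
      by (rule linearI) (simp_all add: \<phi>_def dlin suminf_add[OF sd sd, symmetric] suminf_mult[OF sd])
    moreover have "\<bar>\<phi> x\<bar> \<le> (3/2) * ?P x" for x
    proof -
      have "norm (\<phi> x) \<le> (\<Sum>n. (1/3)^n * ?P x)" unfolding \<phi>_def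
        by (rule norm_suminf_le[OF d_le sg])
      also have "\<dots> = (\<Sum>n. (1/3::real)^n) * ?P x"
        by (rule suminf_mult2[symmetric]) (simp add: summable_geometric)
      also have "\<dots> = (3/2) * ?P x" by (simp add: suminf_geometric)
      finally show ?thesis by simp
    qed
    ultimately have "dual \<phi>" by (rule dualI[OF W(1,2)])
    then obtain C where C: "\<And>n. \<bar>\<phi> (a n)\<bar> \<le> C" using wb a(1) by meson
    have "real n \<le> \<bar>\<phi> (a n)\<bar>" for n
    proof -
      have P: "0 \<le> ?P (a n)" by (rule nonneg) simp
      have "(\<Sum>i<Suc n. d i x) = L (Suc n) x" for x
        unfolding d_def using sum_lessThan_telescope[of "\<lambda>i. L i x" "Suc n"] L0 by simp
      then have \<phi>L: "\<phi> x - L (Suc n) x = (\<Sum>i. d (i + Suc n) x)" for x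
        unfolding \<phi>_def using suminf_minus_initial_segment[OF sd[of x], of "Suc n"] by simp
      have "norm (\<Sum>i. d (i + Suc n) (a n)) \<le> (\<Sum>i. (1/3)^(i + Suc n) * ?P (a n))"
        by (rule norm_suminf_le[OF d_le]) (rule summable_ignore_initial_segment[OF sg])
      also have "\<dots> = (\<Sum>i. (1/3::real)^i * ((1/3)^Suc n * ?P (a n)))"
        by (simp add: power_add mult_ac)
      also have "\<dots> = (\<Sum>i. (1/3::real)^i) * ((1/3)^Suc n * ?P (a n))"
        by (rule suminf_mult2[symmetric]) (simp add: summable_geometric)
      also have "\<dots> = (1/2) * (1/3)^n * ?P (a n)" by (simp add: suminf_geometric)
      finally have tail: "\<bar>\<phi> (a n) - L (Suc n) (a n)\<bar> \<le> (1/2) * (1/3)^n * ?P (a n)"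
        unfolding \<phi>L by simp
      have "(1/3)^n * ?P (a n) \<le> \<bar>L (Suc n) (a n)\<bar>"
        unfolding LS \<mu>(3) using P by auto
      with tail have "(1/2) * (1/3)^n * ?P (a n) \<le> \<bar>\<phi> (a n)\<bar>" by linarith
      moreover have "real n \<le> (1/2) * (1/3)^n * ?P (a n)"
        using a(2)[of n] by (simp add: field_simps power_divide)
      ultimately show ?thesis by simp
    qed
    then have "real n \<le> C" for n using C order_trans by blast
    then show False by (meson not_le reals_Archimedean2)
  qed
  then obtain C where C: "\<And>a. a \<in> A \<Longrightarrow> ?P a \<le> C" by blast
  have "A \<subseteq> (*\<^sub>R) (\<bar>C\<bar> + 1) ` U"
  proof
    fix a assume "a \<in> A"
    then have "?P a < \<bar>C\<bar> + 1" using C by fastforce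
    from Minkowski_functional_less[OF W(2) _ this] sp W(3) show "a \<in> (*\<^sub>R) (\<bar>C\<bar> + 1) ` U" by auto
  qed
  then show "\<exists>r>0. A \<subseteq> (*\<^sub>R) r ` U" by (intro exI[of _ "\<bar>C\<bar> + 1"]) auto
qed

section \<open>Polars of families of bounds on functionals\<close>

definition polar :: "(('a::locally_convex_space \<Rightarrow> real) \<Rightarrow> real) \<Rightarrow> 'a set" where
  "polar c = {z. \<forall>\<phi>. dual \<phi> \<longrightarrow> \<bar>\<phi> z\<bar> \<le> c \<phi>}"

lemma closed_polar: "closed (polar c)"
proof -
  have "polar c = (\<Inter>\<phi>\<in>{\<phi>. dual \<phi>}. {z. \<bar>\<phi> z\<bar> \<le> c \<phi>})" unfolding polar_def by blast
  moreover have "closed {z. \<bar>\<phi> z\<bar> \<le> c \<phi>}" if "dual \<phi>" for \<phi> :: "'a \<Rightarrow> real"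
    using that unfolding dual_def by (intro closed_Collect_le continuous_intros) auto
  ultimately show ?thesis by (simp add: closed_INT)
qed

lemma vn_bounded_polar: "vn_bounded (polar c)"
  by (rule vn_bounded_if_weakly_bounded) (auto simp: polar_def)

lemma absolutely_convex_polar:
  assumes c: "\<And>\<phi>. dual \<phi> \<Longrightarrow> 0 \<le> c \<phi>"
  shows "absolutely_convex (polar c)"
  unfolding absolutely_convex_def
proof (intro conjI ballI allI impI)
  have "0 \<in> polar c" unfolding polar_def using c by (simp add: dual_0)
  then show "polar c \<noteq> {}" by blast
  fix x y and a b :: real assume xy: "x \<in> polar c" "y \<in> polar c" "\<bar>a\<bar> + \<bar>b\<bar> \<le> 1"
  have "\<bar>\<phi> (a *\<^sub>R x + b *\<^sub>R y)\<bar> \<le> c \<phi>" if \<phi>: "dual \<phi>" for \<phi>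
  proof -
    have "\<bar>\<phi> (a *\<^sub>R x + b *\<^sub>R y)\<bar> \<le> \<bar>a\<bar> * \<bar>\<phi> x\<bar> + \<bar>b\<bar> * \<bar>\<phi> y\<bar>"
      using abs_triangle_ineq[of "a * \<phi> x" "b * \<phi> y"] by (simp add: dual_add[OF \<phi>] dual_scaleR[OF \<phi>] abs_mult)
    also have "\<dots> \<le> \<bar>a\<bar> * c \<phi> + \<bar>b\<bar> * c \<phi>"
      using xy \<phi> unfolding polar_def by (intro add_mono mult_left_mono) auto
    also have "\<dots> = (\<bar>a\<bar> + \<bar>b\<bar>) * c \<phi>" by (simp add: algebra_simps)
    also have "\<dots> \<le> 1 * c \<phi>" using xy c[OF \<phi>] by (intro mult_right_mono)
    finally show ?thesis by simp
  qed
  then show "a *\<^sub>R x + b *\<^sub>R y \<in> polar c" unfolding polar_def by blast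
qed

lemma polar_dilationI:
  assumes s: "0 < s" and z: "\<And>\<phi>. dual \<phi> \<Longrightarrow> \<bar>\<phi> z\<bar> \<le> s * c \<phi>"
  shows "z \<in> (*\<^sub>R) s ` polar c"
proof -
  have "\<bar>\<phi> (inverse s *\<^sub>R z)\<bar> \<le> c \<phi>" if \<phi>: "dual \<phi>" for \<phi>
    using z[OF \<phi>] s by (simp add: dual_scaleR[OF \<phi>] abs_mult field_simps)
  then have "inverse s *\<^sub>R z \<in> polar c" unfolding polar_def by blast
  moreover have "z = s *\<^sub>R (inverse s *\<^sub>R z)" using s by simp
  ultimately show ?thesis by blast
qed

text \<open>Turns an estimate against every functional into one for the gauge. Since
  \<open>r = 0\<close> is allowed, which is not an admissible dilation factor, the proof passes
  through all \<open>s > r\<close>.\<close>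

lemma polar_gauge_le:
  assumes c: "\<And>\<phi>. dual \<phi> \<Longrightarrow> 0 \<le> c \<phi>" and r: "0 \<le> r"
    and z: "\<And>\<phi>. dual \<phi> \<Longrightarrow> \<bar>\<phi> z\<bar> \<le> r * c \<phi>"
  shows "z \<in> span (polar c)" "Minkowski_functional (polar c) z \<le> r"
proof -
  have *: "z \<in> (*\<^sub>R) s ` polar c" if s: "r < s" for s
  proof (rule polar_dilationI)
    show "0 < s" using r s by simp
    show "\<bar>\<phi> z\<bar> \<le> s * c \<phi>" if \<phi>: "dual \<phi>" for \<phi>
      using z[OF \<phi>] mult_right_mono[of r s "c \<phi>"] s c[OF \<phi>] by simp
  qed
  show "z \<in> span (polar c)" using *[of "r + 1"] by (auto intro: span_scale span_base)
  show "Minkowski_functional (polar c) z \<le> r"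
    by (rule dense_ge) (use * r in \<open>auto intro!: Minkowski_functional_le\<close>)
qed

section \<open>Frechet derivatives on seminormed subspaces\<close>

text \<open>On every subspace these agree with the Frechet derivatives. Hence the latter do not depend on the
  bounded set \<open>B\<close> that defines the subspace \<open>E\<^sub>B\<close>.\<close>

primrec dder :: "('a::real_vector \<Rightarrow> real) \<Rightarrow> 'a list \<Rightarrow> 'a \<Rightarrow> real" where
  "dder h [] x = h x"
| "dder h (v # vs) x = deriv (\<lambda>t. dder h vs (x + t *\<^sub>R v)) 0"

text \<open>Along a line, differentiability at an arbitrary parameter reduces to parameter 0 at a
  shifted base point. The product and chain rules below are therefore proved at 0 only.\<close>

lemma DERIV_line_shift:
  fixes F :: "'a::real_vector \<Rightarrow> real"
  assumes "((\<lambda>s. F ((x + t *\<^sub>R v) + s *\<^sub>R v)) has_real_derivative d) (at 0)"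
  shows "((\<lambda>s. F (x + s *\<^sub>R v)) has_real_derivative d) (at t)"
proof -
  have "(x + t *\<^sub>R v) + s *\<^sub>R v = x + (t + s) *\<^sub>R v" for s by (simp add: scaleR_left_distrib)
  then have "((\<lambda>s. F (x + (t + s) *\<^sub>R v)) has_real_derivative d) (at 0)" using assms by (simp only:)
  then show ?thesis using DERIV_at_within_shift[of "\<lambda>s. F (x + s *\<^sub>R v)" d t 0 UNIV] by simp
qed

text \<open>The mean value inequality, applied first to \<open>\<phi>'\<close> and then to
  \<open>\<phi>\<close> minus its tangent. The constant is twice that of Taylor's formula; what
  matters is that it depends on \<open>C\<close> alone.\<close>

lemma second_order_remainder:
  fixes \<phi> :: "real \<Rightarrow> real"
  assumes 1: "\<And>t. (\<phi> has_real_derivative \<phi>' t) (at t)"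
    and 2: "\<And>t. (\<phi>' has_real_derivative \<phi>'' t) (at t)"
    and C: "\<And>t. \<bar>\<phi>'' t\<bar> \<le> C"
  shows "\<bar>\<phi> t - \<phi> 0 - t * \<phi>' 0\<bar> \<le> C * t\<^sup>2"
proof -
  have C0: "0 \<le> C" using C[of 0] by simp
  have b: "\<bar>\<phi>' s - \<phi>' 0\<bar> \<le> C * \<bar>s\<bar>" for s
    using field_differentiable_bound[of UNIV \<phi>' \<phi>'' C s 0] 2 C by (simp add: has_field_derivative_at_within)
  have "\<bar>(\<phi> t - t * \<phi>' 0) - (\<phi> 0 - 0 * \<phi>' 0)\<bar> \<le> C * \<bar>t\<bar> * \<bar>t - 0\<bar>"
    unfolding real_norm_def[symmetric]
  proof (rule field_differentiable_bound[of "closed_segment 0 t" "\<lambda>s. \<phi> s - s * \<phi>' 0" "\<lambda>s. \<phi>' s - \<phi>' 0"])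
    fix s assume s: "s \<in> closed_segment 0 t"
    show "((\<lambda>s. \<phi> s - s * \<phi>' 0) has_field_derivative \<phi>' s - \<phi>' 0) (at s within closed_segment 0 t)"
      by (rule has_field_derivative_at_within) (auto intro!: derivative_eq_intros 1)
    have "\<bar>s\<bar> \<le> \<bar>t\<bar>" using s by (auto simp: closed_segment_eq_real_ivl split: if_splits)
    then show "norm (\<phi>' s - \<phi>' 0) \<le> C * norm t"
      using b[of s] mult_left_mono[of "\<bar>s\<bar>" "\<bar>t\<bar>" C] C0 by simp
  qed auto
  then show ?thesis by (simp add: power2_eq_square abs_mult_self_eq mult.assoc)
qed

section \<open>Multilinear forms and operator norms\<close>

lemma multilinear_form_add:
  assumes "multilinear_form_on S (Suc (length us + length vs)) T"
    "set us \<subseteq> S" "set vs \<subseteq> S" "x \<in> S" "y \<in> S"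
  shows "T (us @ (x + y) # vs) = T (us @ x # vs) + T (us @ y # vs)"
  using assms(1)[unfolded multilinear_form_on_def, rule_format, of us vs x y 1 1] assms by simp

lemma multilinear_form_scaleR:
  assumes "multilinear_form_on S (Suc (length us + length vs)) T"
    "set us \<subseteq> S" "set vs \<subseteq> S" "x \<in> S"
  shows "T (us @ (a *\<^sub>R x) # vs) = a * T (us @ x # vs)"
  using assms(1)[unfolded multilinear_form_on_def, rule_format, of us vs x x a 0] assms by simp

text \<open>The list \<open>us\<close> takes up the slots that are already done, so that the
  induction can move through the remaining ones from left to right.\<close>

lemma multilinear_form_scaleR_all:
  assumes "multilinear_form_on S (length us + length vs) T" "subspace S" "set us \<subseteq> S" "set vs \<subseteq> S"
  shows "T (us @ map (\<lambda>v. c v *\<^sub>R v) vs) = prod_list (map c vs) * T (us @ vs)"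
  using assms
proof (induction vs arbitrary: us)
  case (Cons v vs)
  have sub: "set (map (\<lambda>v. c v *\<^sub>R v) vs) \<subseteq> S" using Cons.prems by (auto intro: subspace_scale)
  have "T (us @ map (\<lambda>v. c v *\<^sub>R v) (v # vs)) = c v * T ((us @ [v]) @ map (\<lambda>v. c v *\<^sub>R v) vs)"
    using multilinear_form_scaleR[of S us "map (\<lambda>v. c v *\<^sub>R v) vs" T v "c v"] Cons.prems sub by simp
  also have "T ((us @ [v]) @ map (\<lambda>v. c v *\<^sub>R v) vs) = prod_list (map c vs) * T ((us @ [v]) @ vs)"
    using Cons.prems by (intro Cons.IH) auto
  finally show ?case by simp
qed simp

context seminorm_on begin

lemma p_0: "p 0 = 0"
  using scale[of 0 0] subspace_0[OF subspace] by simp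

lemma diff_in: "x \<in> S \<Longrightarrow> y \<in> S \<Longrightarrow> x - y \<in> S"
  and add_in: "x \<in> S \<Longrightarrow> y \<in> S \<Longrightarrow> x + y \<in> S"
  and scale_in: "x \<in> S \<Longrightarrow> a *\<^sub>R x \<in> S"
  using subspace by (simp_all add: subspace_diff subspace_add subspace_scale)

lemma prod_list_p_nonneg: "set vs \<subseteq> S \<Longrightarrow> 0 \<le> prod_list (map p vs)"
  by (induction vs) (auto intro!: mult_nonneg_nonneg nonneg)

lemma opnorm_le:
  assumes "0 \<le> C" "\<And>vs. length vs = k \<Longrightarrow> set vs \<subseteq> S \<Longrightarrow> \<bar>T vs\<bar> \<le> C * prod_list (map p vs)"
  shows "opnorm_on S p k T \<le> C"
  unfolding opnorm_on_def
proof (rule cSup_least)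
  \<comment> \<open>The list of zeros shows that the supremum is not taken over the empty
    set.\<close>
  show "{\<bar>T vs\<bar> | vs. length vs = k \<and> set vs \<subseteq> S \<and> (\<forall>v\<in>set vs. p v \<le> 1)} \<noteq> {}"
    using subspace_0[OF subspace] p_0 by (auto intro!: exI[of _ "replicate k 0"])
  fix z assume "z \<in> {\<bar>T vs\<bar> | vs. length vs = k \<and> set vs \<subseteq> S \<and> (\<forall>v\<in>set vs. p v \<le> 1)}"
  then obtain vs where vs: "z = \<bar>T vs\<bar>" "length vs = k" "set vs \<subseteq> S" "\<forall>v\<in>set vs. p v \<le> 1" by blast
  have "prod_list (map p ws) \<le> 1" if "set ws \<subseteq> S" "\<forall>v\<in>set ws. p v \<le> 1" for ws
    using that by (induction ws) (auto intro!: mult_le_one prod_list_p_nonneg)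
  then show "z \<le> C" using assms(2)[OF vs(2,3)] mult_left_mono[of "prod_list (map p vs)" 1 C] vs assms(1)
    by fastforce
qed

lemma opnorm_upper:
  assumes b: "bounded_form_on S p k T" and vs: "length vs = k" "set vs \<subseteq> S" "\<forall>v\<in>set vs. p v \<le> 1"
  shows "\<bar>T vs\<bar> \<le> opnorm_on S p k T"
  unfolding opnorm_on_def
proof (rule cSup_upper)
  show "\<bar>T vs\<bar> \<in> {\<bar>T vs\<bar> | vs. length vs = k \<and> set vs \<subseteq> S \<and> (\<forall>v\<in>set vs. p v \<le> 1)}" using vs by blast
  obtain C where C: "\<And>vs. length vs = k \<Longrightarrow> set vs \<subseteq> S \<Longrightarrow> \<bar>T vs\<bar> \<le> C * prod_list (map p vs)"
    using b unfolding bounded_form_on_def by blast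
  have "prod_list (map p ws) \<le> 1" if "set ws \<subseteq> S" "\<forall>v\<in>set ws. p v \<le> 1" for ws
    using that by (induction ws) (auto intro!: mult_le_one prod_list_p_nonneg)
  then have "\<bar>T ws\<bar> \<le> \<bar>C\<bar>" if "length ws = k" "set ws \<subseteq> S" "\<forall>v\<in>set ws. p v \<le> 1" for ws
    using C[OF that(1,2)] that prod_list_p_nonneg[OF that(2)]
      mult_mono[of C "\<bar>C\<bar>" "prod_list (map p ws)" 1] by fastforce
  then show "bdd_above {\<bar>T vs\<bar> | vs. length vs = k \<and> set vs \<subseteq> S \<and> (\<forall>v\<in>set vs. p v \<le> 1)}"
    by (intro bdd_aboveI[of _ "\<bar>C\<bar>"]) auto
qed

lemma opnorm_nonneg:
  assumes "bounded_form_on S p k T"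
  shows "0 \<le> opnorm_on S p k T"
proof -
  have "\<bar>T (replicate k 0)\<bar> \<le> opnorm_on S p k T"
    using subspace_0[OF subspace] p_0 by (intro opnorm_upper[OF assms]) auto
  then show ?thesis by simp
qed

text \<open>Each vector is rescaled to length 1. As \<open>p\<close> is only a seminorm, this fails
  for vectors with \<open>p v = 0\<close>; then the form vanishes, being bounded by a multiple of
  the product of the lengths.\<close>

lemma opnorm_bound:
  assumes T: "multilinear_form_on S k T" and b: "bounded_form_on S p k T"
    and vs: "length vs = k" "set vs \<subseteq> S"
  shows "\<bar>T vs\<bar> \<le> opnorm_on S p k T * prod_list (map p vs)"
proof (cases "0 \<in> set (map p vs)")
  case True
  then have "prod_list (map p vs) = 0" by (simp add: prod_list_zero_iff)
  moreover obtain C where "\<bar>T vs\<bar> \<le> C * prod_list (map p vs)"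
    using b vs unfolding bounded_form_on_def by blast
  ultimately show ?thesis by simp
next
  case False
  define c where "c v = inverse (p v)" for v
  have pos: "0 < p v" if "v \<in> set vs" for v
    using False that vs nonneg[of v] by (metis image_eqI less_eq_real_def list.set_map subsetD)
  have "\<bar>T (map (\<lambda>v. c v *\<^sub>R v) vs)\<bar> \<le> opnorm_on S p k T"
  proof (rule opnorm_upper[OF b])
    show "\<forall>v\<in>set (map (\<lambda>v. c v *\<^sub>R v) vs). p v \<le> 1"
    proof clarsimp
      fix v assume v: "v \<in> set vs"
      then have "p (c v *\<^sub>R v) = \<bar>inverse (p v)\<bar> * p v" using vs by (auto simp: scale c_def)
      then show "p (c v *\<^sub>R v) \<le> 1" using pos[OF v] by simp
    qed
  qed (use vs in \<open>auto intro: scale_in\<close>)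
  then have "\<bar>prod_list (map c vs)\<bar> * \<bar>T vs\<bar> \<le> opnorm_on S p k T"
    using multilinear_form_scaleR_all[of S "[]" vs T c] T vs subspace by (simp add: abs_mult)
  moreover have "prod_list (map c ws) * prod_list (map p ws) = 1 \<and> 0 < prod_list (map p ws)"
    if "\<And>v. v \<in> set ws \<Longrightarrow> 0 < p v" for ws
    using that
  proof (induction ws)
    case (Cons w ws)
    then have "0 < p w" "prod_list (map c ws) * prod_list (map p ws) = 1" "0 < prod_list (map p ws)" by auto
    moreover have "c w * p w = 1" using \<open>0 < p w\<close> unfolding c_def by simp
    moreover have "prod_list (map c (w # ws)) * prod_list (map p (w # ws)) =
        (c w * p w) * (prod_list (map c ws) * prod_list (map p ws))" by (simp add: mult_ac)
    ultimately show ?case by simp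
  qed simp
  from this[OF pos, of vs]
  have P: "prod_list (map c vs) * prod_list (map p vs) = 1 \<and> 0 < prod_list (map p vs)" by simp
  have "0 < prod_list (map c vs)" using P zero_less_mult_pos2 zero_less_one by metis
  ultimately have "\<bar>T vs\<bar> * (prod_list (map c vs) * prod_list (map p vs)) \<le> opnorm_on S p k T * prod_list (map p vs)"
    using P mult_right_mono[of "prod_list (map c vs) * \<bar>T vs\<bar>" "opnorm_on S p k T" "prod_list (map p vs)"]
    by (simp add: mult_ac)
  then show ?thesis using P by simp
qed

lemma frechet_derivatives_on_0: "frechet_derivatives_on S p h D \<Longrightarrow> x \<in> S \<Longrightarrow> D 0 x [] = h x"
  and frechet_derivatives_on_multilinear:
    "frechet_derivatives_on S p h D \<Longrightarrow> x \<in> S \<Longrightarrow> multilinear_form_on S k (D k x)"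
  and frechet_derivatives_on_bounded:
    "frechet_derivatives_on S p h D \<Longrightarrow> x \<in> S \<Longrightarrow> bounded_form_on S p k (D k x)"
  unfolding frechet_derivatives_on_def by blast+

text \<open>The definition speaks of the operator norm, which controls individual values through
  \<open>opnorm_bound\<close>, that is, for bounded multilinear forms. The proof checks that the
  remainder is such a form.\<close>

lemma frechet_derivatives_on_remainder:
  assumes D: "frechet_derivatives_on S p h D" and x: "x \<in> S" and e: "0 < e"
  shows "\<exists>d>0. \<forall>y\<in>S. p (y - x) < d \<longrightarrow> (\<forall>vs. length vs = k \<longrightarrow> set vs \<subseteq> S \<longrightarrow>
    \<bar>D k y vs - D k x vs - D (Suc k) x ((y - x) # vs)\<bar> \<le> e * p (y - x) * prod_list (map p vs))"
proof -
  obtain d where d: "d > 0" and le: "\<And>y. y \<in> S \<Longrightarrow> p (y - x) < d \<Longrightarrow>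
      opnorm_on S p k (\<lambda>vs. D k y vs - D k x vs - D (Suc k) x ((y - x) # vs)) \<le> e * p (y - x)"
    using D x e unfolding frechet_derivatives_on_def by blast
  have "\<bar>D k y vs - D k x vs - D (Suc k) x ((y - x) # vs)\<bar> \<le> e * p (y - x) * prod_list (map p vs)"
    if y: "y \<in> S" "p (y - x) < d" and vs: "length vs = k" "set vs \<subseteq> S" for y vs
  proof -
    let ?T = "\<lambda>vs. D k y vs - D k x vs - D (Suc k) x ((y - x) # vs)"
    have yx: "y - x \<in> S" using diff_in y x by blast
    have "multilinear_form_on S k ?T"
      unfolding multilinear_form_on_def
    proof (intro allI impI, elim conjE)
      fix us vs u v and a b :: real
      assume *: "length us + 1 + length vs = k" "set us \<subseteq> S" "set vs \<subseteq> S" "u \<in> S" "v \<in> S"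
      note m = frechet_derivatives_on_multilinear[OF D, unfolded multilinear_form_on_def, rule_format]
      show "?T (us @ (a *\<^sub>R u + b *\<^sub>R v) # vs) = a * ?T (us @ u # vs) + b * ?T (us @ v # vs)"
        using m[OF y(1), of us vs k u v a b] m[OF x, of us vs k u v a b]
          m[OF x, of "(y - x) # us" vs "Suc k" u v a b] * yx
        by (simp add: algebra_simps)
    qed
    moreover have "bounded_form_on S p k ?T"
    proof -
      obtain A where A: "\<And>vs. length vs = k \<Longrightarrow> set vs \<subseteq> S \<Longrightarrow> \<bar>D k y vs\<bar> \<le> A * prod_list (map p vs)"
        using frechet_derivatives_on_bounded[OF D y(1), of k] unfolding bounded_form_on_def by blast
      obtain B where B: "\<And>vs. length vs = k \<Longrightarrow> set vs \<subseteq> S \<Longrightarrow> \<bar>D k x vs\<bar> \<le> B * prod_list (map p vs)"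
        using frechet_derivatives_on_bounded[OF D x, of k] unfolding bounded_form_on_def by blast
      obtain C where C: "\<And>vs. length vs = Suc k \<Longrightarrow> set vs \<subseteq> S \<Longrightarrow> \<bar>D (Suc k) x vs\<bar> \<le> C * prod_list (map p vs)"
        using frechet_derivatives_on_bounded[OF D x, of "Suc k"] unfolding bounded_form_on_def by blast
      have "\<bar>?T vs\<bar> \<le> (A + B + C * p (y - x)) * prod_list (map p vs)" if "length vs = k" "set vs \<subseteq> S" for vs
        using A[OF that] B[OF that] C[of "(y - x) # vs"] that yx by (simp add: algebra_simps)
      then show ?thesis unfolding bounded_form_on_def by blast
    qed
    ultimately have "\<bar>?T vs\<bar> \<le> opnorm_on S p k ?T * prod_list (map p vs)"
      using vs by (rule opnorm_bound)
    also have "\<dots> \<le> e * p (y - x) * prod_list (map p vs)"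
      using le[OF y] prod_list_p_nonneg[OF vs(2)] by (rule mult_right_mono)
    finally show ?thesis .
  qed
  then show ?thesis using d by blast
qed

text \<open>The remainder at \<open>y + s *\<^sub>R v\<close>, divided by \<open>s\<close>, is at
  most \<open>e'\<close> times a fixed product of lengths. The new direction stands at the head of
  the list, in agreement with \<open>dder\<close>.\<close>

lemma frechet_derivatives_on_line:
  assumes D: "frechet_derivatives_on S p h D" and x: "x \<in> S" and v: "v \<in> S" and vs: "set vs \<subseteq> S"
  shows "((\<lambda>t. D (length vs) (x + t *\<^sub>R v) vs) has_real_derivative D (Suc (length vs)) (x + t *\<^sub>R v) (v # vs)) (at t)"
proof (rule DERIV_line_shift)
  let ?k = "length vs"
  define y where "y = x + t *\<^sub>R v"
  have y: "y \<in> S" unfolding y_def using x v by (intro add_in scale_in)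
  let ?P = "p v * prod_list (map p vs)"
  have P: "0 \<le> ?P" using nonneg[OF v] prod_list_p_nonneg[OF vs] by simp
  have "((\<lambda>s. (D ?k (y + s *\<^sub>R v) vs - D ?k y vs) / s) \<longlongrightarrow> D (Suc ?k) y (v # vs)) (at 0)"
  proof (rule tendstoI)
    fix e :: real assume e: "0 < e"
    define e' where "e' = e / (?P + 1)"
    have e': "0 < e'" "e' * ?P < e" using e P unfolding e'_def by (simp_all add: field_simps add_pos_nonneg)
    obtain d where d: "d > 0" and le: "\<And>z vs'. z \<in> S \<Longrightarrow> p (z - y) < d \<Longrightarrow> length vs' = ?k \<Longrightarrow> set vs' \<subseteq> S \<Longrightarrow>
        \<bar>D ?k z vs' - D ?k y vs' - D (Suc ?k) y ((z - y) # vs')\<bar> \<le> e' * p (z - y) * prod_list (map p vs')"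
      using frechet_derivatives_on_remainder[OF D y e'(1), of ?k] by blast
    have "((\<lambda>s. \<bar>s\<bar> * p v) \<longlongrightarrow> \<bar>0\<bar> * p v) (at 0)" by (intro tendsto_intros)
    then have "eventually (\<lambda>s. \<bar>s\<bar> * p v < d) (at 0)" using d by (intro order_tendstoD) simp_all
    moreover have "eventually (\<lambda>s::real. s \<noteq> 0) (at 0)" by (simp add: eventually_at_filter)
    ultimately show "eventually (\<lambda>s. dist ((D ?k (y + s *\<^sub>R v) vs - D ?k y vs) / s) (D (Suc ?k) y (v # vs)) < e) (at 0)"
    proof eventually_elim
      case (elim s)
      have "y + s *\<^sub>R v \<in> S" using y v by (intro add_in scale_in)
      from le[OF this _ refl vs] elim
      have "\<bar>D ?k (y + s *\<^sub>R v) vs - D ?k y vs - D (Suc ?k) y ((s *\<^sub>R v) # vs)\<bar> \<le> e' * (\<bar>s\<bar> * p v) * prod_list (map p vs)"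
        using v by (simp add: scale)
      also have "D (Suc ?k) y ((s *\<^sub>R v) # vs) = s * D (Suc ?k) y (v # vs)"
        using multilinear_form_scaleR[of S "[]" vs "D (Suc ?k) y" v s] frechet_derivatives_on_multilinear[OF D y] v vs by simp
      finally have "\<bar>D ?k (y + s *\<^sub>R v) vs - D ?k y vs - s * D (Suc ?k) y (v # vs)\<bar> / \<bar>s\<bar> \<le> e' * ?P"
        using elim by (simp add: field_simps)
      also have "\<bar>D ?k (y + s *\<^sub>R v) vs - D ?k y vs - s * D (Suc ?k) y (v # vs)\<bar> / \<bar>s\<bar> =
          \<bar>(D ?k (y + s *\<^sub>R v) vs - D ?k y vs) / s - D (Suc ?k) y (v # vs)\<bar>"
        using elim by (simp add: abs_divide[symmetric] diff_divide_distrib)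
      finally show ?case using e'(2) by (simp add: dist_real_def)
    qed
  qed
  then show "((\<lambda>s. D ?k (x + t *\<^sub>R v + s *\<^sub>R v) vs) has_real_derivative D (Suc ?k) (x + t *\<^sub>R v) (v # vs)) (at 0)"
    unfolding y_def DERIV_def by simp
qed

lemma dder_eq_frechet:
  assumes D: "frechet_derivatives_on S p h D" and x: "x \<in> S" and vs: "set vs \<subseteq> S"
  shows "dder h vs x = D (length vs) x vs"
  using x vs
proof (induction vs arbitrary: x)
  case Nil then show ?case using frechet_derivatives_on_0[OF D] by simp
next
  case (Cons v vs)
  have "dder h vs (x + t *\<^sub>R v) = D (length vs) (x + t *\<^sub>R v) vs" for t
    using Cons by (intro Cons.IH add_in scale_in) auto
  then show ?case
    using DERIV_imp_deriv[OF frechet_derivatives_on_line[OF D Cons.prems(1), of v vs 0]] Cons.prems by simp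
qed

text \<open>The global bound of order \<open>k + 2\<close> controls the remainder of order \<open>k\<close>.\<close>

lemma frechet_derivatives_onI:
  assumes 0: "\<And>x. x \<in> S \<Longrightarrow> D 0 x [] = h x"
    and mult: "\<And>k x. x \<in> S \<Longrightarrow> multilinear_form_on S k (D k x)"
    and line: "\<And>x v vs t. x \<in> S \<Longrightarrow> v \<in> S \<Longrightarrow> set vs \<subseteq> S \<Longrightarrow>
      ((\<lambda>t. D (length vs) (x + t *\<^sub>R v) vs) has_real_derivative D (Suc (length vs)) (x + t *\<^sub>R v) (v # vs)) (at t)"
    and bound: "\<And>k. 1 \<le> k \<Longrightarrow> \<exists>C. \<forall>x\<in>S. \<forall>vs. length vs = k \<longrightarrow> set vs \<subseteq> S \<longrightarrow>
      \<bar>D k x vs\<bar> \<le> C * prod_list (map p vs)"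
  shows "frechet_derivatives_on S p h D"
  unfolding frechet_derivatives_on_def
proof (intro conjI ballI allI impI)
  show "D 0 x [] = h x" if "x \<in> S" for x using 0 that .
  show "multilinear_form_on S k (D k x)" if "x \<in> S" for k x using mult that .
  show "bounded_form_on S p k (D k x)" if x: "x \<in> S" for k x
  \<comment> \<open>No global bound is available for \<open>h\<close> itself, but a form of order 0
    is just the number \<open>D 0 x []\<close>.\<close>
  proof (cases "k = 0")
    case True then show ?thesis unfolding bounded_form_on_def by (auto intro!: exI[of _ "\<bar>D 0 x []\<bar>"])
  next
    case False then show ?thesis using bound[of k] x unfolding bounded_form_on_def by fastforce
  qed
next
  fix k x and e :: real assume x: "x \<in> S" and e: "e > 0"
  obtain C where C: "\<And>x vs. x \<in> S \<Longrightarrow> length vs = k + 2 \<Longrightarrow> set vs \<subseteq> S \<Longrightarrow> \<bar>D (k + 2) x vs\<bar> \<le> C * prod_list (map p vs)"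
    using bound[of "k + 2"] by auto
  have rem: "opnorm_on S p k (\<lambda>vs. D k y vs - D k x vs - D (Suc k) x ((y - x) # vs)) \<le> \<bar>C\<bar> * (p (y - x))\<^sup>2"
    if y: "y \<in> S" for y
  proof (rule opnorm_le)
    fix vs assume vs: "length vs = k" "set vs \<subseteq> S"
    define v where "v = y - x"
    have v: "v \<in> S" unfolding v_def using y x diff_in by blast
    \<comment> \<open>Taylor's formula on the segment from \<open>x\<close> to \<open>y\<close>,
      evaluated at parameter 1.\<close>
    have "\<bar>D k (x + 1 *\<^sub>R v) vs - D k (x + 0 *\<^sub>R v) vs - 1 * D (Suc k) (x + 0 *\<^sub>R v) (v # vs)\<bar> \<le>
        (\<bar>C\<bar> * (p v)\<^sup>2 * prod_list (map p vs)) * 1\<^sup>2"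
    proof (rule second_order_remainder)
      fix t :: real
      show "((\<lambda>t. D k (x + t *\<^sub>R v) vs) has_real_derivative D (Suc k) (x + t *\<^sub>R v) (v # vs)) (at t)"
        using line[OF x v vs(2)] vs(1) by simp
      show "((\<lambda>t. D (Suc k) (x + t *\<^sub>R v) (v # vs)) has_real_derivative D (k + 2) (x + t *\<^sub>R v) (v # v # vs)) (at t)"
        using line[OF x v, of "v # vs"] vs v by simp
      have "\<bar>D (k + 2) (x + t *\<^sub>R v) (v # v # vs)\<bar> \<le> C * (p v * (p v * prod_list (map p vs)))"
        using C[of "x + t *\<^sub>R v" "v # v # vs"] x v vs by (simp add: add_in scale_in)
      also have "\<dots> \<le> \<bar>C\<bar> * (p v * (p v * prod_list (map p vs)))"
        using nonneg[OF v] prod_list_p_nonneg[OF vs(2)] by (intro mult_right_mono) auto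
      finally show "\<bar>D (k + 2) (x + t *\<^sub>R v) (v # v # vs)\<bar> \<le> \<bar>C\<bar> * (p v)\<^sup>2 * prod_list (map p vs)"
        by (simp add: power2_eq_square mult_ac)
    qed
    then show "\<bar>D k y vs - D k x vs - D (Suc k) x ((y - x) # vs)\<bar> \<le> \<bar>C\<bar> * (p (y - x))\<^sup>2 * prod_list (map p vs)"
      unfolding v_def by simp
  qed simp
  show "\<exists>d>0. \<forall>y\<in>S. p (y - x) < d \<longrightarrow>
      opnorm_on S p k (\<lambda>vs. D k y vs - D k x vs - D (Suc k) x ((y - x) # vs)) \<le> e * p (y - x)"
  proof (intro exI[of _ "e / (\<bar>C\<bar> + 1)"] conjI ballI impI)
    show "0 < e / (\<bar>C\<bar> + 1)" using e by simp
    fix y assume y: "y \<in> S" and "p (y - x) < e / (\<bar>C\<bar> + 1)"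
    then have "(\<bar>C\<bar> + 1) * p (y - x) < e" by (simp add: field_simps)
    moreover have p: "0 \<le> p (y - x)" using y x by (intro nonneg diff_in)
    ultimately have "\<bar>C\<bar> * p (y - x) \<le> e" by (simp add: algebra_simps)
    from mult_right_mono[OF this p]
    have "\<bar>C\<bar> * (p (y - x))\<^sup>2 \<le> e * p (y - x)" by (simp add: power2_eq_square mult_ac)
    with rem[OF y]
    show "opnorm_on S p k (\<lambda>vs. D k y vs - D k x vs - D (Suc k) x ((y - x) # vs)) \<le> e * p (y - x)" by simp
  qed
qed

end

section \<open>Partitions of lists\<close>

text \<open>The product rule in list form: differentiating a product indexed by a list produces one
  summand for each position.\<close>

primrec modify_each :: "('a \<Rightarrow> 'a) \<Rightarrow> 'a list \<Rightarrow> 'a list list" where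
  "modify_each f [] = []"
| "modify_each f (x # xs) = (f x # xs) # map ((#) x) (modify_each f xs)"

text \<open>The set partitions of the positions of a list. The head forms a block of its own or is put into
  one of the blocks of a partition of the tail; this mirrors the differentiation of Faa di Bruno's
  formula.\<close>

primrec partitions :: "'a list \<Rightarrow> 'a list list list" where
  "partitions [] = [[]]"
| "partitions (v # vs) = concat (map (\<lambda>P. ([v] # P) # modify_each ((#) v) P) (partitions vs))"

lemma sum_list_partitions_Cons:
  fixes F :: "'a list list \<Rightarrow> real"
  shows "sum_list (map F (partitions (v # vs))) =
    sum_list (map (\<lambda>P. F ([v] # P) + sum_list (map F (modify_each ((#) v) P))) (partitions vs))"
proof -
  have "sum_list (map F (concat (map (\<lambda>P. ([v] # P) # modify_each ((#) v) P) Ps))) =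
    sum_list (map (\<lambda>P. F ([v] # P) + sum_list (map F (modify_each ((#) v) P))) Ps)" for Ps
    by (induction Ps) auto
  then show ?thesis by simp
qed

lemma modify_eachE:
  assumes "Q \<in> set (modify_each f xs)"
  obtains us x ws where "xs = us @ x # ws" "Q = us @ f x # ws"
  using assms
proof (induction xs arbitrary: Q thesis)
  case (Cons y ys)
  consider "Q = f y # ys" | Q' where "Q' \<in> set (modify_each f ys)" "Q = y # Q'" using Cons.prems(2) by auto
  then show ?case
  proof cases
    case 1 then show ?thesis using Cons.prems(1)[of "[]"] by simp
  next
    case 2
    from Cons.IH[OF _ 2(1)] obtain us x ws where "ys = us @ x # ws" "Q' = us @ f x # ws" by blast
    then show ?thesis using Cons.prems(1)[of "y # us"] 2 by simp
  qed
qed simp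

lemma length_modify_each: "Q \<in> set (modify_each f xs) \<Longrightarrow> length Q = length xs"
  by (auto elim: modify_eachE)

lemma partitions_ConsE:
  assumes "Q \<in> set (partitions (v # vs))"
  obtains P where "P \<in> set (partitions vs)" "Q = [v] # P"
  | us b ws where "us @ b # ws \<in> set (partitions vs)" "Q = us @ (v # b) # ws"
  using assms by (auto elim!: modify_eachE)

lemma partitions_blocks:
  assumes "P \<in> set (partitions vs)"
  shows "[] \<notin> set P" "\<forall>b\<in>set P. set b \<subseteq> set vs" "sum_list (map length P) = length vs"
proof -
  have "[] \<notin> set P \<and> (\<forall>b\<in>set P. set b \<subseteq> set vs) \<and> sum_list (map length P) = length vs"
    using assms
  proof (induction vs arbitrary: P)
    case (Cons v vs)
    from Cons.prems show ?case
    proof (cases rule: partitions_ConsE)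
      case 1 then show ?thesis using Cons.IH by auto
    next
      case (2 us b ws)
      show ?thesis using Cons.IH[OF 2(1)] unfolding 2(2) by auto
    qed
  qed simp
  then show "[] \<notin> set P" "\<forall>b\<in>set P. set b \<subseteq> set vs" "sum_list (map length P) = length vs" by blast+
qed

lemma partitions_block_length:
  assumes "P \<in> set (partitions vs)" "b \<in> set P"
  shows "1 \<le> length b" "length b \<le> length vs"
proof -
  show "1 \<le> length b" using partitions_blocks(1)[OF assms(1)] assms(2) by (cases b) auto
  show "length b \<le> length vs"
    using partitions_blocks(3)[OF assms(1)] assms(2) member_le_sum_list[of "length b" "map length P"] by simp
qed

lemma length_partition_le:
  assumes "P \<in> set (partitions vs)"
  shows "length P \<le> length vs"
proof -
  have "length Q \<le> sum_list (map length Q)" if "[] \<notin> set Q" for Q :: "'a list list"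
    using that
  proof (induction Q)
    case (Cons b Q) then show ?case by (cases b) auto
  qed simp
  from this[of P] show ?thesis using partitions_blocks[OF assms] by simp
qed

lemma partition_nonempty: "P \<in> set (partitions vs) \<Longrightarrow> vs \<noteq> [] \<Longrightarrow> P \<noteq> []"
  using partitions_blocks(3)[of P vs] by auto

text \<open>Every position of the list belongs to exactly one block, so the product is only
  regrouped. This carries the lengths of the directions through Faa di Bruno's formula.\<close>

lemma prod_list_partition:
  fixes p :: "'a \<Rightarrow> real"
  assumes "P \<in> set (partitions vs)"
  shows "prod_list (map (\<lambda>b. prod_list (map p b)) P) = prod_list (map p vs)"
  using assms
proof (induction vs arbitrary: P)
  case (Cons v vs)
  from Cons.prems show ?case
  proof (cases rule: partitions_ConsE)
    case 1 then show ?thesis using Cons.IH by simp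
  next
    case (2 us b ws)
    then show ?thesis using Cons.IH[OF 2(1)] by (simp add: mult_ac)
  qed
qed simp

text \<open>Induction on the list. Let a partition of an l-element list have j blocks. Making the
  new head a block of its own multiplies the weight by \<open>\<kappa> * (j + 1)\<close>; putting it
  into a block with n elements multiplies it by n + 1, which sums to l + j over all blocks. As
  \<open>j \<le> l\<close>, the total factor is at most
  \<open>(\<kappa> + 2) * (l + 1)\<close>.\<close>

lemma sum_partitions_factorials_le:
  assumes "0 \<le> (\<kappa>::real)"
  shows "sum_list (map (\<lambda>P. \<kappa> ^ length P * fact (length P) * prod_list (map (\<lambda>b. fact (length b)) P)) (partitions vs))
    \<le> (\<kappa> + 2) ^ length vs * fact (length vs)" (is "sum_list (map ?w (partitions vs)) \<le> _")
proof (induction vs)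
  case (Cons v vs)
  let ?l = "length vs"
  define fa where "fa P = prod_list (map (\<lambda>b. fact (length b) :: real) P)" for P :: "'a list list"
  have fa_Cons: "fa (b # Q) = fact (length b) * fa Q" for b Q unfolding fa_def by simp
  have fa: "sum_list (map fa (modify_each ((#) v) P)) = fa P * (real (sum_list (map length P)) + real (length P))" for P
  proof (induction P)
    case (Cons b P)
    have "sum_list (map fa (map ((#) b) (modify_each ((#) v) P))) = fact (length b) * sum_list (map fa (modify_each ((#) v) P))"
      by (simp add: fa_Cons sum_list_const_mult o_def)
    then show ?case using Cons by (simp add: fa_Cons algebra_simps)
  qed simp
  have step: "?w ([v] # P) + sum_list (map ?w (modify_each ((#) v) P)) \<le> ((\<kappa> + 2) * real (Suc ?l)) * ?w P"
    if P: "P \<in> set (partitions vs)" for P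
  proof -
    have "sum_list (map ?w (modify_each ((#) v) P)) =
        sum_list (map (\<lambda>Q. \<kappa> ^ length P * fact (length P) * fa Q) (modify_each ((#) v) P))"
      by (intro arg_cong[of _ _ sum_list] map_cong refl) (simp add: length_modify_each fa_def)
    also have "\<dots> = ?w P * (real ?l + real (length P))"
      by (simp add: sum_list_const_mult fa partitions_blocks(3)[OF P]) (simp add: fa_def)
    finally have 1: "sum_list (map ?w (modify_each ((#) v) P)) = ?w P * (real ?l + real (length P))" .
    have 2: "?w ([v] # P) = ?w P * (\<kappa> * real (Suc (length P)))" by (simp add: mult_ac)
    have w: "0 \<le> ?w P" using assms by (intro mult_nonneg_nonneg prod_list_nonneg) auto
    have "?w ([v] # P) + sum_list (map ?w (modify_each ((#) v) P)) =
        ?w P * (\<kappa> * real (Suc (length P)) + (real ?l + real (length P)))"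
      unfolding 1 2 by (rule distrib_left[symmetric])
    also have "\<dots> \<le> ?w P * ((\<kappa> + 2) * real (Suc ?l))"
    proof (rule mult_left_mono[OF _ w])
      have "\<kappa> * real (Suc (length P)) + (real ?l + real (length P)) \<le> \<kappa> * real (Suc ?l) + 2 * real (Suc ?l)"
        using length_partition_le[OF P] assms by (intro add_mono mult_left_mono) auto
      also have "\<dots> = (\<kappa> + 2) * real (Suc ?l)" by (simp add: algebra_simps)
      finally show "\<kappa> * real (Suc (length P)) + (real ?l + real (length P)) \<le> (\<kappa> + 2) * real (Suc ?l)" .
    qed
    also have "\<dots> = ((\<kappa> + 2) * real (Suc ?l)) * ?w P" by (rule mult.commute)
    finally show ?thesis .
  qed
  have "sum_list (map ?w (partitions (v # vs))) \<le> sum_list (map (\<lambda>P. ((\<kappa> + 2) * real (Suc ?l)) * ?w P) (partitions vs))"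
    unfolding sum_list_partitions_Cons by (intro sum_list_mono step)
  also have "\<dots> = ((\<kappa> + 2) * real (Suc ?l)) * sum_list (map ?w (partitions vs))" by (rule sum_list_const_mult)
  also have "\<dots> \<le> ((\<kappa> + 2) * real (Suc ?l)) * ((\<kappa> + 2) ^ ?l * fact ?l)"
    using assms by (intro mult_left_mono Cons.IH) auto
  also have "\<dots> = (\<kappa> + 2) ^ length (v # vs) * fact (length (v # vs))" by (simp add: mult_ac)
  finally show ?case .
qed simp

section \<open>Log-convex weight sequences\<close>

text \<open>Log-convexity says that the ratios \<open>R k = M (k + 1) / M k\<close> increase.
  Raising \<open>a\<close> by 1 multiplies the left side by \<open>R (a + 1)\<close> and the right
  side by \<open>R (a + b + 1)\<close>, which is at least as large.\<close>

lemma log_convex_mult_le: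
  assumes M: "weight_sequence M" "log_convex_sequence M"
  shows "M (Suc a) * M (Suc b) \<le> M 1 * M (Suc (a + b))"
proof -
  have pos: "0 < M k" for k using M(1) unfolding weight_sequence_def by blast
  define R where "R k = M (Suc k) / M k" for k
  have "R k \<le> R (Suc k)" for k
    using M(2)[unfolded log_convex_sequence_def, rule_format, of "Suc k"] pos
    by (simp add: R_def field_simps power2_eq_square)
  then have R: "R i \<le> R j" if "i \<le> j" for i j using that by (rule lift_Suc_mono_le)
  have RM: "M (Suc k) = R k * M k" for k using pos[of k] unfolding R_def by simp
  show ?thesis
  proof (induction a)
    case (Suc a)
    have R0: "0 \<le> R k" for k unfolding R_def using pos by (simp add: less_imp_le)
    have "M (Suc (Suc a)) * M (Suc b) = R (Suc a) * (M (Suc a) * M (Suc b))" by (simp add: RM)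
    also have "\<dots> \<le> R (Suc a) * (M 1 * M (Suc (a + b)))" using Suc R0 by (intro mult_left_mono)
    also have "\<dots> \<le> R (Suc (a + b)) * (M 1 * M (Suc (a + b)))"
      using pos by (intro mult_right_mono R) (auto simp: less_imp_le)
    also have "\<dots> = M 1 * M (Suc (Suc a + b))" by (simp add: RM)
    finally show ?case .
  qed simp
qed

text \<open>The blocks are merged into the first factor one at a time:
  \<open>M n * M (length b)\<close> is at most \<open>M 1 * M (n + length b - 1)\<close>. Each
  merger costs one factor \<open>M 1\<close> and one unit of the index; starting with
  \<open>n\<close> equal to the number of blocks, the index ends exactly at the sum of the block
  lengths.\<close>

lemma log_convex_partition_le:
  assumes M: "weight_sequence M" "log_convex_sequence M" and P: "[] \<notin> set P" "P \<noteq> []"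
  shows "M (length P) * prod_list (map (\<lambda>b. M (length b)) P) \<le> M 1 ^ length P * M (sum_list (map length P))"
proof -
  have pos: "0 < M k" for k using M(1) unfolding weight_sequence_def by blast
  have "M n * prod_list (map (\<lambda>b. M (length b)) Q) \<le> M 1 ^ length Q * M (n + sum_list (map length Q) - length Q)"
    if "[] \<notin> set Q" "1 \<le> n" for n Q
    using that
  proof (induction Q arbitrary: n)
    case (Cons b Q)
    have b: "1 \<le> length b" using Cons.prems by (cases b) auto
    define m where "m = n + length b - 1"
    have m: "1 \<le> m" unfolding m_def using b Cons.prems by simp
    have "M n * M (length b) \<le> M 1 * M m"
      using log_convex_mult_le[OF M, of "n - 1" "length b - 1"] b Cons.prems unfolding m_def
      by (simp add: Suc_diff_le[symmetric])
    moreover have "0 \<le> prod_list (map (\<lambda>b. M (length b)) Q)"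
      by (rule prod_list_nonneg) (use pos in \<open>auto intro: less_imp_le\<close>)
    ultimately have "(M n * M (length b)) * prod_list (map (\<lambda>b. M (length b)) Q)
        \<le> (M 1 * M m) * prod_list (map (\<lambda>b. M (length b)) Q)" by (rule mult_right_mono)
    then have "M n * prod_list (map (\<lambda>b. M (length b)) (b # Q)) \<le> (M 1 * M m) * prod_list (map (\<lambda>b. M (length b)) Q)"
      by (simp add: mult.assoc)
    also have "\<dots> = M 1 * (M m * prod_list (map (\<lambda>b. M (length b)) Q))" by simp
    also have "\<dots> \<le> M 1 * (M 1 ^ length Q * M (m + sum_list (map length Q) - length Q))"
      using Cons.prems(1) m less_imp_le[OF pos[of 1]] by (intro mult_left_mono Cons.IH) simp_all
    also have "m + sum_list (map length Q) - length Q = n + sum_list (map length (b # Q)) - length (b # Q)"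
      unfolding m_def using b by simp
    finally show ?case by simp
  qed simp
  from this[OF P(1), of "length P"] P(2) show ?thesis by (simp add: Suc_le_eq)
qed

section \<open>Derivatives along curves\<close>

context seminorm_on begin

text \<open>The derivative at parameter 0, taken in the seminorm \<open>p\<close> and not in any
  topology of the ambient type.\<close>

definition curve_derivative :: "(real \<Rightarrow> 'a) \<Rightarrow> 'a \<Rightarrow> bool" where
  "curve_derivative c c' \<longleftrightarrow> (\<forall>t. c t \<in> S) \<and> c' \<in> S \<and> ((\<lambda>t. p ((c t - c 0) /\<^sub>R t - c')) \<longlongrightarrow> 0) (at 0)"

lemma reverse_triangle:
  assumes "x \<in> S" "y \<in> S"
  shows "\<bar>p x - p y\<bar> \<le> p (x - y)"
proof -
  have "p x \<le> p (x - y) + p y" "p y \<le> p (y - x) + p x"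
    using triangle[OF diff_in[OF assms] assms(2)] triangle[OF diff_in[OF assms(2,1)] assms(1)] by simp_all
  moreover have "p (y - x) = p (x - y)" using scale[OF diff_in[OF assms], of "- 1"] by simp
  ultimately show ?thesis by simp
qed

lemma tendsto_p:
  assumes "\<And>t. q t \<in> S" "x \<in> S" "((\<lambda>t. p (q t - x)) \<longlongrightarrow> 0) F"
  shows "((\<lambda>t. p (q t)) \<longlongrightarrow> p x) F"
proof -
  have "((\<lambda>t. p (q t) - p x) \<longlongrightarrow> 0) F"
    by (rule Lim_null_comparison[OF always_eventually assms(3)]) (use reverse_triangle assms in auto)
  then show ?thesis by (rule LIM_zero_cancel)
qed

lemma curve_derivative_tendsto:
  assumes c: "curve_derivative c c'"
  shows "((\<lambda>t. p (c t - c 0)) \<longlongrightarrow> 0) (at 0)" "((\<lambda>t. p (c t)) \<longlongrightarrow> p (c 0)) (at 0)"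
proof -
  let ?q = "\<lambda>t. (c t - c 0) /\<^sub>R t"
  have S: "\<And>t. c t \<in> S" "c' \<in> S" "((\<lambda>t. p (?q t - c')) \<longlongrightarrow> 0) (at 0)"
    using c unfolding curve_derivative_def by auto
  have q: "?q t \<in> S" for t using S by (intro scale_in diff_in)
  have "((\<lambda>t. \<bar>t\<bar> * p (?q t)) \<longlongrightarrow> \<bar>0\<bar> * p c') (at 0)"
    by (intro tendsto_intros tendsto_p q S)
  then have "((\<lambda>t. \<bar>t\<bar> * p (?q t)) \<longlongrightarrow> 0) (at 0)" by simp
  moreover have "\<bar>t\<bar> * p (?q t) = p (c t - c 0)" for t
    using scale[of "?q t" t] q[of t] p_0 by (cases "t = 0") auto
  ultimately show 1: "((\<lambda>t. p (c t - c 0)) \<longlongrightarrow> 0) (at 0)" by simp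
  show "((\<lambda>t. p (c t)) \<longlongrightarrow> p (c 0)) (at 0)" by (rule tendsto_p[OF S(1,1) 1])
qed

lemma prod_list_curves_tendsto:
  assumes "\<And>b. b \<in> set P \<Longrightarrow> curve_derivative (w b) (w' b)"
  shows "((\<lambda>t. prod_list (map p (map (\<lambda>b. w b t) P))) \<longlongrightarrow> prod_list (map p (map (\<lambda>b. w b 0) P))) (at 0)"
  using assms by (induction P) (auto intro!: tendsto_intros curve_derivative_tendsto(2))

lemma curves_in:
  assumes "\<And>b. b \<in> set P \<Longrightarrow> curve_derivative (w b) (w' b)"
  shows "set (map (\<lambda>b. w b t) P) \<subseteq> S"
  using assms unfolding curve_derivative_def by auto

text \<open>By linearity the slot is split as \<open>q t = (q t - q') + q'\<close>. The first part
  contributes at most a constant times \<open>p (q t - q')\<close> times factors that converge, so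
  it tends to 0. Thus a difference quotient can be replaced by its limit in one slot while others
  still move.\<close>

lemma multilinear_slot_tendsto:
  assumes T: "multilinear_form_on S k T" "bounded_form_on S p k T"
    and k: "length us + 1 + length P = k" and us: "set us \<subseteq> S"
    and w: "\<And>b. b \<in> set P \<Longrightarrow> curve_derivative (w b) (w' b)"
    and q: "\<And>t. q t \<in> S" "q' \<in> S" "((\<lambda>t. p (q t - q')) \<longlongrightarrow> 0) (at 0)"
    and l: "((\<lambda>t. T (us @ q' # map (\<lambda>b. w b t) P)) \<longlongrightarrow> l) (at 0)"
  shows "((\<lambda>t. T (us @ q t # map (\<lambda>b. w b t) P)) \<longlongrightarrow> l) (at 0)"
proof -
  let ?R = "\<lambda>t. map (\<lambda>b. w b t) P"
  obtain C where C: "\<And>vs. length vs = k \<Longrightarrow> set vs \<subseteq> S \<Longrightarrow> \<bar>T vs\<bar> \<le> C * prod_list (map p vs)"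
    using T(2) unfolding bounded_form_on_def by blast
  have R: "set (?R t) \<subseteq> S" for t using curves_in[OF w] .
  have "((\<lambda>t. T (us @ (q t - q') # ?R t)) \<longlongrightarrow> 0) (at 0)"
  proof (rule Lim_null_comparison)
    show "\<forall>\<^sub>F t in at 0. norm (T (us @ (q t - q') # ?R t)) \<le>
        C * (prod_list (map p us) * (p (q t - q') * prod_list (map p (?R t))))"
    proof (rule always_eventually, rule allI)
      fix t
      show "norm (T (us @ (q t - q') # ?R t)) \<le> C * (prod_list (map p us) * (p (q t - q') * prod_list (map p (?R t))))"
        using C[of "us @ (q t - q') # ?R t"] k us R[of t] q by (simp add: diff_in)
    qed
    have "((\<lambda>t. C * (prod_list (map p us) * (p (q t - q') * prod_list (map p (?R t))))) \<longlongrightarrow>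
        C * (prod_list (map p us) * (0 * prod_list (map p (?R 0))))) (at 0)"
      by (intro tendsto_intros q prod_list_curves_tendsto[OF w])
    then show "((\<lambda>t. C * (prod_list (map p us) * (p (q t - q') * prod_list (map p (?R t))))) \<longlongrightarrow> 0) (at 0)" by simp
  qed
  from tendsto_add[OF this l]
  have "((\<lambda>t. T (us @ (q t - q') # ?R t) + T (us @ q' # ?R t)) \<longlongrightarrow> l) (at 0)" by simp
  moreover have "T (us @ q t # ?R t) = T (us @ (q t - q') # ?R t) + T (us @ q' # ?R t)" for t
    using multilinear_form_add[of S us "?R t" T "q t - q'" q'] T(1) k us R[of t] q by (simp add: diff_in)
  ultimately show ?thesis by simp
qed

text \<open>Product rule by telescoping: the first moving slot is frozen at parameter 0 and joins
  \<open>us\<close>, and the induction hypothesis treats the rest. The curves are indexed by labels,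
  and \<open>f\<close> sends the label of a curve to that of its derivative, which makes
  \<open>modify_each f\<close> produce the summands.\<close>

lemma multilinear_curves_DERIV:
  assumes T: "multilinear_form_on S k T" "bounded_form_on S p k T"
    and k: "length us + length P = k" and us: "set us \<subseteq> S"
    and w: "\<And>b. b \<in> set P \<Longrightarrow> curve_derivative (w b) (w (f b) 0)"
  shows "((\<lambda>t. T (us @ map (\<lambda>b. w b t) P)) has_real_derivative
    sum_list (map (\<lambda>Q. T (us @ map (\<lambda>b. w b 0) Q)) (modify_each f P))) (at 0)"
  using k us w
proof (induction P arbitrary: us)
  case (Cons a P)
  let ?R = "\<lambda>t. map (\<lambda>b. w b t) P"
  have w: "\<And>b. b \<in> set P \<Longrightarrow> curve_derivative (w b) (w (f b) 0)" using Cons.prems by simp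
  have wa: "curve_derivative (w a) (w (f a) 0)" using Cons.prems by simp
  then have aS: "w a t \<in> S" "w (f a) 0 \<in> S" for t unfolding curve_derivative_def by auto
  have R: "set (?R t) \<subseteq> S" for t using curves_in[OF w] .
  let ?q = "\<lambda>t. (w a t - w a 0) /\<^sub>R t"
  have IH: "((\<lambda>t. T ((us @ [z]) @ ?R t)) has_real_derivative
      sum_list (map (\<lambda>Q. T ((us @ [z]) @ map (\<lambda>b. w b 0) Q)) (modify_each f P))) (at 0)" if "z \<in> S" for z
    using Cons.prems that by (intro Cons.IH) auto
  have "((\<lambda>t. T (us @ ?q t # ?R t)) \<longlongrightarrow> T (us @ w (f a) 0 # ?R 0)) (at 0)"
  proof (rule multilinear_slot_tendsto[OF T _ _ w])
    show "((\<lambda>t. T (us @ w (f a) 0 # ?R t)) \<longlongrightarrow> T (us @ w (f a) 0 # ?R 0)) (at 0)"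
      using DERIV_isCont[OF IH[OF aS(2)]] by (simp add: isCont_def)
  qed (use Cons.prems aS wa in \<open>auto simp: curve_derivative_def intro!: scale_in diff_in\<close>)
  then have "((\<lambda>t. (T (us @ w a t # ?R t) - T (us @ w a 0 # ?R t)) / t) \<longlongrightarrow> T (us @ w (f a) 0 # ?R 0)) (at 0)"
  proof (rule Lim_transform_eventually)
    have "\<forall>\<^sub>F t::real in at 0. t \<noteq> 0" by (simp add: eventually_at_filter)
    then show "\<forall>\<^sub>F t in at 0. T (us @ ?q t # ?R t) = (T (us @ w a t # ?R t) - T (us @ w a 0 # ?R t)) / t"
    proof eventually_elim
      case (elim t)
      have "t *\<^sub>R ?q t + w a 0 = w a t" using elim by simp
      moreover have "T (us @ (t *\<^sub>R ?q t + w a 0) # ?R t) = t * T (us @ ?q t # ?R t) + T (us @ w a 0 # ?R t)"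
        using multilinear_form_add[of S us "?R t" T "t *\<^sub>R ?q t" "w a 0"]
          multilinear_form_scaleR[of S us "?R t" T "?q t" t] T(1) Cons.prems(1,2) R[of t] aS
        by (simp add: scale_in diff_in)
      ultimately show ?case using elim by (simp add: field_simps)
    qed
  qed
  then have "((\<lambda>t. T (us @ w a t # ?R t) - T (us @ w a 0 # ?R t)) has_real_derivative T (us @ w (f a) 0 # ?R 0)) (at 0)"
    by (simp add: DERIV_def)
  from DERIV_add[OF this IH[OF aS(1)[of 0]]] show ?case by (simp add: o_def)
qed simp

text \<open>One differentiation step of Faa di Bruno's formula. Moving the base point yields the
  term of the next order, which corresponds to a new block; moving the arguments at the fixed base
  point is the product rule and enlarges one existing block.\<close>

lemma frechet_curves_DERIV:
  assumes D: "frechet_derivatives_on S p h D"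
    and y: "curve_derivative y y'"
    and w: "\<And>b. b \<in> set P \<Longrightarrow> curve_derivative (w b) (w (f b) 0)"
  shows "((\<lambda>t. D (length P) (y t) (map (\<lambda>b. w b t) P)) has_real_derivative
    D (Suc (length P)) (y 0) (y' # map (\<lambda>b. w b 0) P) +
    sum_list (map (\<lambda>Q. D (length P) (y 0) (map (\<lambda>b. w b 0) Q)) (modify_each f P))) (at 0)"
proof -
  let ?k = "length P" and ?R = "\<lambda>t. map (\<lambda>b. w b t) P" and ?q = "\<lambda>t. (y t - y 0) /\<^sub>R t"
  have yS: "y t \<in> S" "y' \<in> S" for t using y unfolding curve_derivative_def by auto
  have q: "?q t \<in> S" "((\<lambda>t. p (?q t - y')) \<longlongrightarrow> 0) (at 0)" for t
    using yS y by (auto intro!: scale_in diff_in simp: curve_derivative_def)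
  have R: "set (?R t) \<subseteq> S" for t using curves_in[OF w] .
  note ml = frechet_derivatives_on_multilinear[OF D yS(1)] frechet_derivatives_on_bounded[OF D yS(1)]
  have 1: "((\<lambda>t. D ?k (y 0) (?R t)) has_real_derivative
      sum_list (map (\<lambda>Q. D ?k (y 0) (map (\<lambda>b. w b 0) Q)) (modify_each f P))) (at 0)"
    using multilinear_curves_DERIV[OF ml, of "[]" P ?k w f 0] w by simp
  have 2: "((\<lambda>t. D (Suc ?k) (y 0) (?q t # ?R t)) \<longlongrightarrow> D (Suc ?k) (y 0) (y' # ?R 0)) (at 0)"
  proof (rule multilinear_slot_tendsto[OF ml, of "[]", simplified])
    show "((\<lambda>t. D (Suc ?k) (y 0) (y' # ?R t)) \<longlongrightarrow> D (Suc ?k) (y 0) (y' # ?R 0)) (at 0)"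
      using DERIV_isCont[OF multilinear_curves_DERIV[OF ml, of "[y']" P "Suc ?k" w f 0]] w yS
      by (simp add: isCont_def)
  qed (use q yS w in auto)
  let ?r = "\<lambda>t. (D ?k (y t) (?R t) - D ?k (y 0) (?R t)) / t - D (Suc ?k) (y 0) (?q t # ?R t)"
  have 3: "(?r \<longlongrightarrow> 0) (at 0)"
  proof (rule tendstoI)
    fix e :: real assume e: "0 < e"
    let ?m = "\<lambda>t. p (?q t) * prod_list (map p (?R t))"
    \<comment> \<open>\<open>K\<close> is the limit of \<open>?m\<close>; eventually
      \<open>?m t\<close> is below \<open>K + 1\<close>, so the remainder is requested with
      tolerance \<open>e / (K + 1)\<close>.\<close>
    define K where "K = p y' * prod_list (map p (?R 0))"
    have K: "0 \<le> K" unfolding K_def using nonneg[OF yS(2)] prod_list_p_nonneg[OF R] by (rule mult_nonneg_nonneg)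
    obtain d where d: "d > 0" and le: "\<And>z vs. z \<in> S \<Longrightarrow> p (z - y 0) < d \<Longrightarrow> length vs = ?k \<Longrightarrow> set vs \<subseteq> S \<Longrightarrow>
        \<bar>D ?k z vs - D ?k (y 0) vs - D (Suc ?k) (y 0) ((z - y 0) # vs)\<bar> \<le> e / (K + 1) * p (z - y 0) * prod_list (map p vs)"
      using frechet_derivatives_on_remainder[OF D yS(1)[of 0], of "e / (K + 1)" ?k] e K by auto
    have "(?m \<longlongrightarrow> K) (at 0)" unfolding K_def
      by (intro tendsto_intros prod_list_curves_tendsto[OF w] tendsto_p q yS)
    then have "\<forall>\<^sub>F t in at 0. ?m t < K + 1" by (rule order_tendstoD) simp
    moreover have "\<forall>\<^sub>F t in at 0. p (y t - y 0) < d"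
      using curve_derivative_tendsto(1)[OF y] d by (rule order_tendstoD)
    moreover have "\<forall>\<^sub>F t::real in at 0. t \<noteq> 0" by (simp add: eventually_at_filter)
    ultimately show "\<forall>\<^sub>F t in at 0. dist (?r t) 0 < e"
    proof (eventually_elim)
      case (elim t)
      have yt: "y t - y 0 = t *\<^sub>R ?q t" using elim by simp
      have scaled: "\<bar>t\<bar> * \<bar>a / t - b\<bar> = \<bar>a - t * b\<bar>" if "t \<noteq> 0" for a b
        using that by (simp add: abs_mult[symmetric] right_diff_distrib)
      have py: "p (y t - y 0) = \<bar>t\<bar> * p (?q t)" using scale[OF q(1), of t t] unfolding yt[symmetric] .
      have "D (Suc ?k) (y 0) (z # ?R t) = t * D (Suc ?k) (y 0) (z' # ?R t)" if "z = t *\<^sub>R z'" "z' \<in> S" for z z'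
        using multilinear_form_scaleR[of S "[]" "?R t" "D (Suc ?k) (y 0)" z' t] ml(1)[of "Suc ?k"] R[of t] that by simp
      from this[OF yt q(1)] have "\<bar>t\<bar> * \<bar>?r t\<bar> = \<bar>D ?k (y t) (?R t) - D ?k (y 0) (?R t) - D (Suc ?k) (y 0) ((y t - y 0) # ?R t)\<bar>"
        using scaled[OF \<open>t \<noteq> 0\<close>] by simp
      also have "\<dots> \<le> e / (K + 1) * p (y t - y 0) * prod_list (map p (?R t))"
        using le[OF yS(1) _ _ R] elim by simp
      also have "\<dots> = \<bar>t\<bar> * (e / (K + 1) * ?m t)" unfolding py by simp
      finally have "\<bar>?r t\<bar> \<le> e / (K + 1) * ?m t"
        by (rule mult_left_le_imp_le) (use \<open>t \<noteq> 0\<close> in simp)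
      also have "\<dots> < e / (K + 1) * (K + 1)" using elim e K by (intro mult_strict_left_mono) auto
      also have "\<dots> = e" using K by simp
      finally show ?case by simp
    qed
  qed
  from tendsto_add[OF 3 2]
  have "((\<lambda>t. D ?k (y t) (?R t) - D ?k (y 0) (?R t)) has_real_derivative D (Suc ?k) (y 0) (y' # ?R 0)) (at 0)"
    by (simp add: DERIV_def)
  from DERIV_add[OF this 1] show ?thesis by simp
qed

end

section \<open>Weakly smooth maps into convenient vector spaces\<close>

text \<open>The common part of all six classes. It suffices for setting up the derivatives of the
  composition; the weights enter only in the final estimates.\<close>

abbreviation bounded_derivatives_on :: "'a::real_vector set \<Rightarrow> ('a \<Rightarrow> real) \<Rightarrow> ('a \<Rightarrow> real) \<Rightarrow> bool" where
  "bounded_derivatives_on S p h \<equiv> (\<exists>D. frechet_derivatives_on S p h D \<and>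
     (\<forall>k\<ge>1. bdd_above {opnorm_on S p k (D k x) | x. x \<in> S}))"

locale weakly_smooth = seminorm_on S p for S :: "'e::real_vector set" and p +
  fixes g :: "'e \<Rightarrow> 'f::convenient_space"
  assumes g_frechet: "dual \<phi> \<Longrightarrow> bounded_derivatives_on S p (\<phi> \<circ> g)"
begin

lemma dder_line:
  assumes \<phi>: "dual \<phi>" and x: "x \<in> S" "v \<in> S" "set vs \<subseteq> S"
  shows "((\<lambda>t. dder (\<phi> \<circ> g) vs (x + t *\<^sub>R v)) has_real_derivative dder (\<phi> \<circ> g) (v # vs) (x + t *\<^sub>R v)) (at t)"
proof -
  obtain D where D: "frechet_derivatives_on S p (\<phi> \<circ> g) D" using g_frechet[OF \<phi>] by blast
  have xt: "x + t *\<^sub>R v \<in> S" for t using x by (intro add_in scale_in)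
  show ?thesis
    using frechet_derivatives_on_line[OF D x, of t] dder_eq_frechet[OF D xt x(3)]
      dder_eq_frechet[OF D xt, of "v # vs" t] x
    by (simp del: dder.simps)
qed

lemma dder_linear:
  assumes \<phi>: "dual \<phi>" and x: "x \<in> S" "u \<in> S" "v \<in> S" "set vs \<subseteq> S"
  shows "dder (\<phi> \<circ> g) ((a *\<^sub>R u + b *\<^sub>R v) # vs) x = a * dder (\<phi> \<circ> g) (u # vs) x + b * dder (\<phi> \<circ> g) (v # vs) x"
proof -
  obtain D where D: "frechet_derivatives_on S p (\<phi> \<circ> g) D" using g_frechet[OF \<phi>] by blast
  have "set (w # vs) \<subseteq> S" if "w \<in> S" for w using that x by simp
  note * = dder_eq_frechet[OF D x(1) this]
  have "a *\<^sub>R u + b *\<^sub>R v \<in> S" using x by (intro add_in scale_in)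
  then show ?thesis unfolding *[OF x(2)] *[OF x(3)] *[OF \<open>a *\<^sub>R u + b *\<^sub>R v \<in> S\<close>]
    using frechet_derivatives_on_multilinear[OF D x(1), of "Suc (length vs)",
        unfolded multilinear_form_on_def, rule_format, of "[]" vs u v a b] x by simp
qed

lemma dder_bounded:
  assumes \<phi>: "dual \<phi>" and k: "1 \<le> k"
  shows "\<exists>C\<ge>0. \<forall>x\<in>S. \<forall>vs. set vs \<subseteq> S \<longrightarrow> length vs = k \<longrightarrow> \<bar>dder (\<phi> \<circ> g) vs x\<bar> \<le> C * prod_list (map p vs)"
proof -
  obtain D where D: "frechet_derivatives_on S p (\<phi> \<circ> g) D"
    and "bdd_above {opnorm_on S p k (D k x) | x. x \<in> S}" using g_frechet[OF \<phi>] k by blast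
  then obtain C where C: "\<And>x. x \<in> S \<Longrightarrow> opnorm_on S p k (D k x) \<le> C" unfolding bdd_above_def by blast
  have "\<bar>dder (\<phi> \<circ> g) vs x\<bar> \<le> \<bar>C\<bar> * prod_list (map p vs)" if x: "x \<in> S" and vs: "set vs \<subseteq> S" "length vs = k" for x vs
  proof -
    have "\<bar>dder (\<phi> \<circ> g) vs x\<bar> \<le> opnorm_on S p k (D k x) * prod_list (map p vs)"
      using opnorm_bound[OF frechet_derivatives_on_multilinear[OF D x] frechet_derivatives_on_bounded[OF D x] vs(2,1)]
        dder_eq_frechet[OF D x vs(1)] vs(2) by simp
    also have "\<dots> \<le> \<bar>C\<bar> * prod_list (map p vs)"
      using C[OF x] prod_list_p_nonneg[OF vs(1)] by (intro mult_right_mono) auto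
    finally show ?thesis .
  qed
  then show ?thesis by (intro exI[of _ "\<bar>C\<bar>"]) auto
qed

text \<open>The difference quotients of a derivative form a Mackey--Cauchy sequence, since by Taylor's theorem
  they converge with rate \<open>1 / n\<close> against every continuous functional.\<close>

lemma vector_derivative_exists:
  assumes "x \<in> S" "set vs \<subseteq> S"
  shows "\<exists>z. \<forall>\<phi>. dual \<phi> \<longrightarrow> \<phi> z = dder (\<phi> \<circ> g) vs x"
  using assms
proof (induction vs arbitrary: x)
  case Nil then show ?case by (intro exI[of _ "g x"]) simp
next
  case (Cons v vs)
  have vs: "set vs \<subseteq> S" and v: "v \<in> S" using Cons.prems by auto
  have "\<forall>y. \<exists>z. y \<in> S \<longrightarrow> (\<forall>\<phi>. dual \<phi> \<longrightarrow> \<phi> z = dder (\<phi> \<circ> g) vs y)" using Cons.IH vs by blast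
  then obtain Z where Z: "\<And>y \<phi>. y \<in> S \<Longrightarrow> dual \<phi> \<Longrightarrow> \<phi> (Z y) = dder (\<phi> \<circ> g) vs y" by metis
  have "\<exists>C\<ge>0. \<forall>y\<in>S. \<bar>dder (\<phi> \<circ> g) (v # v # vs) y\<bar> \<le> C" if \<phi>: "dual \<phi>" for \<phi>
  proof -
    obtain C where C: "C \<ge> 0" "\<And>y ws. y \<in> S \<Longrightarrow> set ws \<subseteq> S \<Longrightarrow> length ws = length vs + 2 \<Longrightarrow>
        \<bar>dder (\<phi> \<circ> g) ws y\<bar> \<le> C * prod_list (map p ws)"
      using dder_bounded[OF \<phi>, of "length vs + 2"] by auto
    have "0 \<le> C * prod_list (map p (v # v # vs))"
      using C(1) prod_list_p_nonneg[of "v # v # vs"] vs v by (intro mult_nonneg_nonneg) auto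
    moreover have "\<bar>dder (\<phi> \<circ> g) (v # v # vs) y\<bar> \<le> C * prod_list (map p (v # v # vs))" if "y \<in> S" for y
      using C(2)[OF that, of "v # v # vs"] vs v by simp
    ultimately show ?thesis by blast
  qed
  \<comment> \<open>One bound for each functional, for two further derivatives in direction
    \<open>v\<close>. The function \<open>c\<close> defines the polar in which the difference
    quotients will be Cauchy.\<close>
  then obtain c where c: "\<And>\<phi>. dual \<phi> \<Longrightarrow> 0 \<le> c \<phi>"
    and cb: "\<And>\<phi> y. dual \<phi> \<Longrightarrow> y \<in> S \<Longrightarrow> \<bar>dder (\<phi> \<circ> g) (v # v # vs) y\<bar> \<le> c \<phi>" by metis
  let ?d = "\<lambda>\<phi>. dder (\<phi> \<circ> g) (v # vs) x"
  have xt: "x + t *\<^sub>R v \<in> S" for t using Cons.prems v by (intro add_in scale_in)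
  define q where "q n = real (Suc n) *\<^sub>R (Z (x + inverse (real (Suc n)) *\<^sub>R v) - Z x)" for n
  have q: "\<bar>\<phi> (q n) - ?d \<phi>\<bar> \<le> c \<phi> * inverse (real (Suc n))" if \<phi>: "dual \<phi>" for \<phi> n
  proof -
    let ?t = "inverse (real (Suc n))"
    have "\<bar>dder (\<phi> \<circ> g) vs (x + ?t *\<^sub>R v) - dder (\<phi> \<circ> g) vs (x + 0 *\<^sub>R v) - ?t * dder (\<phi> \<circ> g) (v # vs) (x + 0 *\<^sub>R v)\<bar> \<le> c \<phi> * ?t\<^sup>2"
    proof (rule second_order_remainder)
      show "((\<lambda>t. dder (\<phi> \<circ> g) vs (x + t *\<^sub>R v)) has_real_derivative dder (\<phi> \<circ> g) (v # vs) (x + t *\<^sub>R v)) (at t)" for t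
        using Cons.prems by (intro dder_line[OF \<phi>]) auto
      show "((\<lambda>t. dder (\<phi> \<circ> g) (v # vs) (x + t *\<^sub>R v)) has_real_derivative dder (\<phi> \<circ> g) (v # v # vs) (x + t *\<^sub>R v)) (at t)" for t
        using Cons.prems by (intro dder_line[OF \<phi>]) auto
    qed (rule cb[OF \<phi> xt])
    then have "\<bar>\<phi> (Z (x + ?t *\<^sub>R v)) - \<phi> (Z x) - ?t * ?d \<phi>\<bar> \<le> c \<phi> * ?t\<^sup>2"
      using Z[OF xt \<phi>] Z[OF Cons.prems(1) \<phi>] by (simp del: dder.simps)
    moreover have "s * a \<le> b * inverse s" if "a \<le> b * (inverse s)\<^sup>2" "0 < s" for a b s :: real
      using that by (simp add: field_simps power2_eq_square)
    ultimately have "real (Suc n) * \<bar>\<phi> (Z (x + ?t *\<^sub>R v)) - \<phi> (Z x) - ?t * ?d \<phi>\<bar> \<le> c \<phi> * ?t"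
      by (simp del: dder.simps of_nat_Suc)
    moreover have "\<phi> (q n) - ?d \<phi> = real (Suc n) * (\<phi> (Z (x + ?t *\<^sub>R v)) - \<phi> (Z x) - ?t * ?d \<phi>)"
      unfolding q_def by (simp add: dual_scaleR[OF \<phi>] dual_diff[OF \<phi>] right_diff_distrib del: dder.simps of_nat_Suc)
    ultimately show ?thesis by (simp add: abs_mult del: dder.simps of_nat_Suc)
  qed
  have "Mackey_Cauchy q"
    unfolding Mackey_Cauchy_def
  proof (intro exI[of _ "polar c"] conjI allI impI)
    show "absolutely_convex (polar c)" using absolutely_convex_polar c .
    show "vn_bounded (polar c)" by (rule vn_bounded_polar)
    fix e :: real assume e: "0 < e"
    obtain N where N: "inverse (real (Suc N)) < e / 2" using reals_Archimedean[of "e / 2"] e by auto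
    have "q m - q n \<in> (*\<^sub>R) e ` polar c" if "N \<le> m" "N \<le> n" for m n
    proof (rule polar_dilationI[OF e])
      fix \<phi> :: "'f \<Rightarrow> real" assume \<phi>: "dual \<phi>"
      have small: "inverse (real (Suc k)) \<le> e / 2" if "N \<le> k" for k
      proof -
        have "inverse (real (Suc k)) \<le> inverse (real (Suc N))" using that by (intro le_imp_inverse_le) auto
        then show ?thesis using N by linarith
      qed
      have "\<bar>\<phi> (q m - q n)\<bar> \<le> \<bar>\<phi> (q m) - ?d \<phi>\<bar> + \<bar>\<phi> (q n) - ?d \<phi>\<bar>"
        unfolding dual_diff[OF \<phi>] by linarith
      also have "\<dots> \<le> c \<phi> * (e / 2) + c \<phi> * (e / 2)"
        using q[OF \<phi>] mult_left_mono[OF small[OF that(1)] c[OF \<phi>]] mult_left_mono[OF small[OF that(2)] c[OF \<phi>]]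
        by (meson add_mono order_trans)
      finally show "\<bar>\<phi> (q m - q n)\<bar> \<le> e * c \<phi>" by (simp add: field_simps)
    qed
    then show "\<exists>N. \<forall>m\<ge>N. \<forall>n\<ge>N. q m - q n \<in> (*\<^sub>R) e ` polar c" by blast
  qed
  then obtain l where l: "q \<longlonglongrightarrow> l" using Mackey_complete by blast
  have "\<phi> l = ?d \<phi>" if \<phi>: "dual \<phi>" for \<phi>
  proof (rule LIMSEQ_unique)
    show "(\<lambda>n. \<phi> (q n)) \<longlonglongrightarrow> \<phi> l" by (rule dual_tendsto[OF \<phi> l])
    have "(\<lambda>n. \<phi> (q n) - ?d \<phi>) \<longlonglongrightarrow> 0"
    proof (rule Lim_null_comparison)
      show "\<forall>\<^sub>F n in sequentially. norm (\<phi> (q n) - ?d \<phi>) \<le> c \<phi> * inverse (real (Suc n))"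
        using q[OF \<phi>] by (intro always_eventually) (simp del: dder.simps of_nat_Suc)
      show "(\<lambda>n. c \<phi> * inverse (real (Suc n))) \<longlonglongrightarrow> 0"
        using tendsto_mult_left[OF LIMSEQ_inverse_real_of_nat, of "c \<phi>"] by simp
    qed
    then show "(\<lambda>n. \<phi> (q n)) \<longlonglongrightarrow> ?d \<phi>" by (rule LIM_zero_cancel)
  qed
  then show ?case by blast
qed

text \<open>By \<open>dual_separates\<close> there is only one such vector, so the choice is
  harmless wherever \<open>vector_derivative_exists\<close> applies.\<close>

definition vder :: "'e list \<Rightarrow> 'e \<Rightarrow> 'f" where
  "vder vs x = (SOME z. \<forall>\<phi>. dual \<phi> \<longrightarrow> \<phi> z = dder (\<phi> \<circ> g) vs x)"

lemma dual_vder: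
  assumes "x \<in> S" "set vs \<subseteq> S" "dual \<phi>"
  shows "\<phi> (vder vs x) = dder (\<phi> \<circ> g) vs x"
  using someI_ex[OF vector_derivative_exists[OF assms(1,2)]] assms(3) unfolding vder_def by blast

lemma dual_eqI: "(\<And>\<phi>. dual \<phi> \<Longrightarrow> \<phi> y = \<phi> z) \<Longrightarrow> y = (z :: 'f)"
  using dual_separates[of "y - z"] by (simp add: dual_diff)

lemma vder_Nil: "x \<in> S \<Longrightarrow> vder [] x = g x"
  by (rule dual_eqI) (simp add: dual_vder)

lemma vder_linear:
  assumes "x \<in> S" "u \<in> S" "v \<in> S" "set vs \<subseteq> S"
  shows "vder ((a *\<^sub>R u + b *\<^sub>R v) # vs) x = a *\<^sub>R vder (u # vs) x + b *\<^sub>R vder (v # vs) x"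
proof (rule dual_eqI)
  fix \<phi> :: "'f \<Rightarrow> real" assume \<phi>: "dual \<phi>"
  have "a *\<^sub>R u + b *\<^sub>R v \<in> S" using assms by (intro add_in scale_in)
  then show "\<phi> (vder ((a *\<^sub>R u + b *\<^sub>R v) # vs) x) = \<phi> (a *\<^sub>R vder (u # vs) x + b *\<^sub>R vder (v # vs) x)"
    using assms dder_linear[OF \<phi> assms, of a b]
    by (simp add: dual_vder[OF _ _ \<phi>] dual_add[OF \<phi>] dual_scaleR[OF \<phi>] del: dder.simps)
qed

text \<open>If \<open>controls c w N\<close>, then the values and the derivatives of \<open>g\<close> up to order \<open>N\<close> live in the normed
  space belonging to the bounded set \<^term>\<open>polar c\<close>, with the weights \<open>w\<close> bounding its norm.\<close>

definition controls :: "(('f \<Rightarrow> real) \<Rightarrow> real) \<Rightarrow> (nat \<Rightarrow> real) \<Rightarrow> nat \<Rightarrow> bool" where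
  "controls c w N \<longleftrightarrow> (\<forall>n. 0 \<le> w n) \<and> (\<forall>\<phi>. dual \<phi> \<longrightarrow> 0 \<le> c \<phi> \<and> \<bar>\<phi> (g 0)\<bar> \<le> c \<phi> \<and>
     (\<forall>x\<in>S. \<forall>vs. set vs \<subseteq> S \<longrightarrow> 1 \<le> length vs \<longrightarrow> length vs \<le> N \<longrightarrow>
       \<bar>dder (\<phi> \<circ> g) vs x\<bar> \<le> w (length vs) * c \<phi> * prod_list (map p vs)))"

text \<open>Up to a finite order the constants of a functional can be added up into the single
  number \<open>c \<phi>\<close>, and the weights can be 1. A sum over all orders need not be
  finite, hence the general weights in \<open>controls\<close>.\<close>

lemma controls_exists: "\<exists>c. controls c (\<lambda>_. 1) N"
proof -
  have "\<forall>\<phi> k. \<exists>C. dual \<phi> \<longrightarrow> 1 \<le> k \<longrightarrow> 0 \<le> C \<and>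
      (\<forall>x\<in>S. \<forall>vs. set vs \<subseteq> S \<longrightarrow> length vs = k \<longrightarrow> \<bar>dder (\<phi> \<circ> g) vs x\<bar> \<le> C * prod_list (map p vs))"
    using dder_bounded by blast
  then obtain C where C: "\<And>\<phi> k. dual \<phi> \<Longrightarrow> 1 \<le> k \<Longrightarrow> 0 \<le> C \<phi> k"
    "\<And>\<phi> k x vs. dual \<phi> \<Longrightarrow> 1 \<le> k \<Longrightarrow> x \<in> S \<Longrightarrow> set vs \<subseteq> S \<Longrightarrow> length vs = k \<Longrightarrow>
      \<bar>dder (\<phi> \<circ> g) vs x\<bar> \<le> C \<phi> k * prod_list (map p vs)" by metis
  define c where "c \<phi> = \<bar>\<phi> (g 0)\<bar> + (\<Sum>k\<in>{1..N}. C \<phi> k)" for \<phi>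
  have "\<bar>dder (\<phi> \<circ> g) vs x\<bar> \<le> c \<phi> * prod_list (map p vs)"
    if \<phi>: "dual \<phi>" and x: "x \<in> S" "set vs \<subseteq> S" "1 \<le> length vs" "length vs \<le> N" for \<phi> x vs
  proof -
    have "C \<phi> (length vs) \<le> (\<Sum>k\<in>{1..N}. C \<phi> k)"
      using x C(1)[OF \<phi>] by (intro member_le_sum) auto
    then have "C \<phi> (length vs) \<le> c \<phi>" unfolding c_def by simp
    then show ?thesis using C(2)[OF \<phi> x(3,1,2) refl] mult_right_mono[OF _ prod_list_p_nonneg[OF x(2)]] order_trans by blast
  qed
  moreover have "0 \<le> c \<phi>" "\<bar>\<phi> (g 0)\<bar> \<le> c \<phi>" if "dual \<phi>" for \<phi>
    using C(1)[OF that] unfolding c_def by (auto intro!: add_nonneg_nonneg sum_nonneg)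
  ultimately show ?thesis unfolding controls_def by (intro exI[of _ c]) simp
qed

context
  fixes c w N assumes controls: "controls c w N" and N: "1 \<le> N"
begin

lemma controlled: "dual \<phi> \<Longrightarrow> 0 \<le> c \<phi>" "dual \<phi> \<Longrightarrow> \<bar>\<phi> (g 0)\<bar> \<le> c \<phi>" "0 \<le> w n"
  "dual \<phi> \<Longrightarrow> x \<in> S \<Longrightarrow> set vs \<subseteq> S \<Longrightarrow> 1 \<le> length vs \<Longrightarrow> length vs \<le> N \<Longrightarrow>
    \<bar>dder (\<phi> \<circ> g) vs x\<bar> \<le> w (length vs) * c \<phi> * prod_list (map p vs)"
  using controls unfolding controls_def by blast+

lemma seminorm_on_polar: "seminorm_on (span (polar c)) (Minkowski_functional (polar c))"
  using controlled(1) by (intro seminorm_on_Minkowski_functional absolutely_convex_polar)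

lemma vder_controlled:
  assumes "x \<in> S" "set vs \<subseteq> S" "1 \<le> length vs" "length vs \<le> N"
  shows "vder vs x \<in> span (polar c)" "Minkowski_functional (polar c) (vder vs x) \<le> w (length vs) * prod_list (map p vs)"
proof -
  have 1: "0 \<le> w (length vs) * prod_list (map p vs)"
    using controlled(3) prod_list_p_nonneg[OF assms(2)] by simp
  have 2: "\<bar>\<phi> (vder vs x)\<bar> \<le> w (length vs) * prod_list (map p vs) * c \<phi>" if "dual \<phi>" for \<phi>
    using controlled(4)[OF that assms] by (simp add: dual_vder[OF assms(1,2) that] mult_ac)
  show "vder vs x \<in> span (polar c)" "Minkowski_functional (polar c) (vder vs x) \<le> w (length vs) * prod_list (map p vs)"
    by (rule polar_gauge_le[OF controlled(1) 1 2]; assumption)+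
qed

text \<open>The first derivative of \<open>g\<close> is bounded, so \<open>g\<close> grows at most
  linearly from \<open>g 0\<close>. This is why \<open>controls\<close> includes a bound for
  \<open>g 0\<close> and why \<open>N\<close> is at least 1.\<close>

lemma g_in_span_polar:
  assumes x: "x \<in> S"
  shows "g x \<in> span (polar c)"
proof (rule polar_gauge_le(1)[OF controlled(1)])
  show "0 \<le> 1 + w 1 * p x" using controlled(3) nonneg[OF x] by simp
  fix \<phi> :: "'f \<Rightarrow> real" assume \<phi>: "dual \<phi>"
  have S0: "0 \<in> S" by (rule subspace_0[OF subspace])
  have "norm (\<phi> (g (0 + 1 *\<^sub>R x)) - \<phi> (g (0 + 0 *\<^sub>R x))) \<le> (w 1 * c \<phi> * p x) * norm (1 - 0 :: real)"
  proof (rule field_differentiable_bound[of UNIV "\<lambda>t. \<phi> (g (0 + t *\<^sub>R x))" "\<lambda>t. dder (\<phi> \<circ> g) [x] (0 + t *\<^sub>R x)"])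
    show "((\<lambda>t. \<phi> (g (0 + t *\<^sub>R x))) has_field_derivative dder (\<phi> \<circ> g) [x] (0 + t *\<^sub>R x)) (at t within UNIV)" for t
      using dder_line[OF \<phi> S0 x, of "[]" t] by simp
    show "norm (dder (\<phi> \<circ> g) [x] (0 + t *\<^sub>R x)) \<le> w 1 * c \<phi> * p x" for t
      using controlled(4)[OF \<phi>, of "0 + t *\<^sub>R x" "[x]"] x N by (simp add: scale_in del: dder.simps)
  qed auto
  then have "\<bar>\<phi> (g x) - \<phi> (g 0)\<bar> \<le> w 1 * c \<phi> * p x" by simp
  with controlled(2)[OF \<phi>] show "\<bar>\<phi> (g x)\<bar> \<le> (1 + w 1 * p x) * c \<phi>" by (simp add: algebra_simps)
qed

text \<open>The two extra orders pay for Taylor's formula: the derivative of order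
  \<open>length vs + 2\<close> bounds the error of the difference quotient by
  \<open>\<bar>t\<bar> * r * c \<phi>\<close> simultaneously for all functionals, which is a bound
  in the gauge of \<open>polar c\<close>.\<close>

lemma vder_curve_derivative:
  assumes x: "x \<in> S" "v \<in> S" "set vs \<subseteq> S" and l: "length vs + 2 \<le> N"
  shows "seminorm_on.curve_derivative (span (polar c)) (Minkowski_functional (polar c))
    (\<lambda>t. vder vs (x + t *\<^sub>R v)) (vder (v # vs) x)"
proof -
  let ?q = "Minkowski_functional (polar c)"
  interpret Q: seminorm_on "span (polar c)" ?q by (rule seminorm_on_polar)
  define r where "r = w (length vs + 2) * prod_list (map p (v # v # vs))"
  have r: "0 \<le> r" unfolding r_def using controlled(3) prod_list_p_nonneg[of "v # v # vs"] x by simp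
  have xt: "x + t *\<^sub>R v \<in> S" for t using x by (intro add_in scale_in)
  have le: "?q ((vder vs (x + t *\<^sub>R v) - vder vs (x + 0 *\<^sub>R v)) /\<^sub>R t - vder (v # vs) x) \<le> \<bar>t\<bar> * r" if t: "t \<noteq> 0" for t
  proof (rule polar_gauge_le(2)[OF controlled(1)])
    show "0 \<le> \<bar>t\<bar> * r" using r by simp
    fix \<phi> :: "'f \<Rightarrow> real" assume \<phi>: "dual \<phi>"
    let ?d = "dder (\<phi> \<circ> g)"
    have "\<bar>?d vs (x + t *\<^sub>R v) - ?d vs (x + 0 *\<^sub>R v) - t * ?d (v # vs) (x + 0 *\<^sub>R v)\<bar> \<le> (r * c \<phi>) * t\<^sup>2"
    proof (rule second_order_remainder)
      show "((\<lambda>t. ?d vs (x + t *\<^sub>R v)) has_real_derivative ?d (v # vs) (x + t *\<^sub>R v)) (at t)" for t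
        using x by (intro dder_line[OF \<phi>]) auto
      show "((\<lambda>t. ?d (v # vs) (x + t *\<^sub>R v)) has_real_derivative ?d (v # v # vs) (x + t *\<^sub>R v)) (at t)" for t
        using x by (intro dder_line[OF \<phi>]) auto
      show "\<bar>?d (v # v # vs) (x + t *\<^sub>R v)\<bar> \<le> r * c \<phi>" for t
        using controlled(4)[OF \<phi> xt, of "v # v # vs" t] x l by (simp add: r_def mult_ac del: dder.simps)
    qed
    moreover have "?d vs (x + s *\<^sub>R v) = \<phi> (vder vs (x + s *\<^sub>R v))" for s using dual_vder[OF xt x(3) \<phi>] by simp
    moreover have "?d vs x = \<phi> (vder vs x)" using dual_vder[OF x(1,3) \<phi>] by simp
    moreover have "?d (v # vs) x = \<phi> (vder (v # vs) x)" using dual_vder[OF x(1) _ \<phi>, of "v # vs"] x by simp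
    ultimately have *: "\<bar>\<phi> (vder vs (x + t *\<^sub>R v)) - \<phi> (vder vs x) - t * \<phi> (vder (v # vs) x)\<bar> \<le> r * c \<phi> * t\<^sup>2"
      by (simp del: dder.simps)
    have "\<phi> ((vder vs (x + t *\<^sub>R v) - vder vs (x + 0 *\<^sub>R v)) /\<^sub>R t - vder (v # vs) x) =
        (\<phi> (vder vs (x + t *\<^sub>R v)) - \<phi> (vder vs x) - t * \<phi> (vder (v # vs) x)) / t"
      using t by (simp add: dual_diff[OF \<phi>] dual_scaleR[OF \<phi>]) (simp add: field_simps)
    then show "\<bar>\<phi> ((vder vs (x + t *\<^sub>R v) - vder vs (x + 0 *\<^sub>R v)) /\<^sub>R t - vder (v # vs) x)\<bar> \<le> \<bar>t\<bar> * r * c \<phi>"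
      using * t by (simp add: abs_divide pos_divide_le_eq power2_eq_square mult_ac flip: abs_mult)
  qed
  have S1: "vder vs y \<in> span (polar c)" if "y \<in> S" for y
    using vder_controlled(1)[OF that x(3)] g_in_span_polar[OF that] vder_Nil[OF that] l by (cases vs) auto
  have S2: "vder (v # vs) x \<in> span (polar c)" using vder_controlled(1)[OF x(1), of "v # vs"] x l by simp
  have "((\<lambda>t. ?q ((vder vs (x + t *\<^sub>R v) - vder vs (x + 0 *\<^sub>R v)) /\<^sub>R t - vder (v # vs) x)) \<longlongrightarrow> 0) (at 0)"
  proof (rule Lim_null_comparison)
    have "\<forall>\<^sub>F t::real in at 0. t \<noteq> 0" by (simp add: eventually_at_filter)
    then show "\<forall>\<^sub>F t in at 0. norm (?q ((vder vs (x + t *\<^sub>R v) - vder vs (x + 0 *\<^sub>R v)) /\<^sub>R t - vder (v # vs) x)) \<le> \<bar>t\<bar> * r"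
    proof eventually_elim
      case (elim t)
      have "0 \<le> ?q ((vder vs (x + t *\<^sub>R v) - vder vs (x + 0 *\<^sub>R v)) /\<^sub>R t - vder (v # vs) x)"
        by (intro Q.nonneg Q.diff_in Q.scale_in S1 S2 xt)
      then show ?case using le[OF elim] by simp
    qed
    have "((\<lambda>t. \<bar>t\<bar> * r) \<longlongrightarrow> \<bar>0\<bar> * r) (at 0)" by (intro tendsto_intros)
    then show "((\<lambda>t. \<bar>t\<bar> * r) \<longlongrightarrow> 0) (at 0)" by simp
  qed
  then show ?thesis unfolding Q.curve_derivative_def using S1[OF xt] S2 by blast
qed

end

end

section \<open>Derivatives of compositions\<close>

text \<open>Since all factorials are at least 1, the case \<open>\<kappa> = 1\<close> of the
  weighted count also bounds the mere number of partitions.\<close>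

lemma sum_partitions_le:
  fixes F :: "'a list list \<Rightarrow> real"
  assumes "\<And>P. P \<in> set (partitions vs) \<Longrightarrow> F P \<le> A" "0 \<le> A"
  shows "sum_list (map F (partitions vs)) \<le> A * (3 ^ length vs * fact (length vs))"
proof -
  have 1: "1 \<le> prod_list (map (\<lambda>b. fact (length b) :: real) P)" for P :: "'a list list"
  proof (induction P)
    case (Cons b P) then show ?case using mult_mono[of 1 "fact (length b) :: real" 1] fact_ge_1[of "length b"] by simp
  qed simp
  have "1 \<le> fact (length P) * prod_list (map (\<lambda>b. fact (length b) :: real) P)" for P :: "'a list list"
    using mult_mono[of 1 "fact (length P) :: real" 1, OF _ 1[of P]] fact_ge_1[of "length P"] by simp
  from mult_left_mono[OF this assms(2)]
  have "sum_list (map F (partitions vs)) \<le>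
      sum_list (map (\<lambda>P. A * (1 ^ length P * fact (length P) * prod_list (map (\<lambda>b. fact (length b)) P))) (partitions vs))"
    using assms(1) by (intro sum_list_mono) (force intro: order_trans)
  also have "\<dots> \<le> A * ((1 + 2) ^ length vs * fact (length vs))"
    unfolding sum_list_const_mult by (intro mult_left_mono sum_partitions_factorials_le assms(2)) simp
  finally show ?thesis by simp
qed

lemma DERIV_sum_list:
  assumes "\<And>P. P \<in> set Ps \<Longrightarrow> ((\<lambda>t. F P t) has_real_derivative F' P) (at x)"
  shows "((\<lambda>t. sum_list (map (\<lambda>P. F P t) Ps)) has_real_derivative sum_list (map F' Ps)) (at x)"
  using assms by (induction Ps) (auto intro!: DERIV_add)

text \<open>Exactly one slot of each summand contains the new direction, and \<open>G\<close> is
  linear in it. The list \<open>us\<close> holds the slots already passed.\<close>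

lemma multilinear_modify_each_linear:
  assumes T: "multilinear_form_on S k T" and k: "length us + length P = k" and us: "set us \<subseteq> S"
    and G: "\<And>b. b \<in> set P \<Longrightarrow> G b \<in> S \<and> G (u # b) \<in> S \<and> G (v # b) \<in> S \<and>
      G (z # b) = \<alpha> *\<^sub>R G (u # b) + \<beta> *\<^sub>R G (v # b)"
  shows "sum_list (map (\<lambda>Q. T (us @ map G Q)) (modify_each ((#) z) P)) =
    \<alpha> * sum_list (map (\<lambda>Q. T (us @ map G Q)) (modify_each ((#) u) P)) +
    \<beta> * sum_list (map (\<lambda>Q. T (us @ map G Q)) (modify_each ((#) v) P))"
  using k us G
proof (induction P arbitrary: us)
  case (Cons b P)
  have "set (map G P) \<subseteq> S" using Cons.prems by auto
  then have 1: "T (us @ G (z # b) # map G P) = \<alpha> * T (us @ G (u # b) # map G P) + \<beta> * T (us @ G (v # b) # map G P)"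
    using T[unfolded multilinear_form_on_def, rule_format, of us "map G P" "G (u # b)" "G (v # b)" \<alpha> \<beta>] Cons.prems by auto
  have "sum_list (map (\<lambda>Q. T ((us @ [G b]) @ map G Q)) (modify_each ((#) z) P)) =
    \<alpha> * sum_list (map (\<lambda>Q. T ((us @ [G b]) @ map G Q)) (modify_each ((#) u) P)) +
    \<beta> * sum_list (map (\<lambda>Q. T ((us @ [G b]) @ map G Q)) (modify_each ((#) v) P))"
    using Cons.prems by (intro Cons.IH) auto
  with 1 show ?case by (simp add: o_def distrib_left)
qed simp

text \<open>Here \<open>h\<close> stands for a functional applied after \<open>f\<close>. The
  hypothesis ranges over all bounded \<open>B\<close> because the one that is used is built later
  from the derivatives of \<open>g\<close>.\<close>

locale weakly_smooth_composition = weakly_smooth S p g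
  for S :: "'e::real_vector set" and p and g :: "'e \<Rightarrow> 'f::convenient_space" +
  fixes h :: "'f \<Rightarrow> real"
  assumes h_frechet: "closed B \<Longrightarrow> absolutely_convex B \<Longrightarrow> vn_bounded B \<Longrightarrow>
    bounded_derivatives_on (span B) (Minkowski_functional B) h"
begin

text \<open>Faa di Bruno's formula, taken as the definition of the derivatives of \<open>h \<circ> g\<close>.\<close>

definition comp_der :: "'e \<Rightarrow> 'e list \<Rightarrow> real" where
  "comp_der x vs = sum_list (map (\<lambda>P. dder h (map (\<lambda>b. vder b x) P) (g x)) (partitions vs))"

lemma h_frechet_polar:
  assumes "controls c w N"
  shows "bounded_derivatives_on (span (polar c)) (Minkowski_functional (polar c)) h"
  using assms unfolding controls_def by (intro h_frechet closed_polar vn_bounded_polar absolutely_convex_polar) blast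

lemma block_in:
  assumes "P \<in> set (partitions vs)" "set vs \<subseteq> S" "b \<in> set P"
  shows "set b \<subseteq> S"
  using partitions_blocks(2)[OF assms(1)] assms(2,3) by blast

text \<open>\<open>frechet_curves_DERIV\<close> differentiates each summand and
  \<open>sum_list_partitions_Cons\<close> reassembles the results. The polar is chosen for this
  order only; since neither \<open>dder\<close> nor \<open>vder\<close> refers to it, the formula is
  the same for every choice.\<close>

lemma comp_der_line:
  assumes x: "x \<in> S" "v \<in> S" "set vs \<subseteq> S"
  shows "((\<lambda>t. comp_der (x + t *\<^sub>R v) vs) has_real_derivative comp_der (x + t *\<^sub>R v) (v # vs)) (at t)"
proof (rule DERIV_line_shift)
  define y where "y = x + t *\<^sub>R v"
  have y: "y \<in> S" unfolding y_def using x by (intro add_in scale_in)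
  have ys: "y + s *\<^sub>R v \<in> S" for s using x y by (intro add_in scale_in)
  obtain c where c: "controls c (\<lambda>_. 1) (length vs + 2)" using controls_exists by blast
  have N: "1 \<le> length vs + 2" by simp
  let ?q = "Minkowski_functional (polar c)"
  interpret Q: seminorm_on "span (polar c)" ?q by (rule seminorm_on_polar[OF c N])
  obtain D where D: "frechet_derivatives_on (span (polar c)) ?q h D" using h_frechet_polar[OF c] by blast
  note gin = g_in_span_polar[OF c N]
  have vin: "vder b z \<in> span (polar c)" if "z \<in> S" "set b \<subseteq> S" "1 \<le> length b" "length b \<le> length vs + 1" for b z
    using vder_controlled(1)[OF c N that(1,2,3)] that(4) by simp
  have "((\<lambda>s. dder h (map (\<lambda>b. vder b (y + s *\<^sub>R v)) P) (g (y + s *\<^sub>R v))) has_real_derivative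
      dder h (map (\<lambda>b. vder b y) ([v] # P)) (g y) +
      sum_list (map (\<lambda>Q. dder h (map (\<lambda>b. vder b y) Q) (g y)) (modify_each ((#) v) P))) (at 0)"
    if P: "P \<in> set (partitions vs)" for P
  proof -
    have b: "set b \<subseteq> S" "1 \<le> length b" "length b \<le> length vs" if "b \<in> set P" for b
      using block_in[OF P x(3) that] partitions_block_length[OF P that] by auto
    have "Q.curve_derivative (\<lambda>s. vder [] (y + s *\<^sub>R v)) (vder [v] y)"
      by (rule vder_curve_derivative[OF c N y x(2)]) simp_all
    then have gc: "Q.curve_derivative (\<lambda>s. g (y + s *\<^sub>R v)) (vder [v] y)"
      unfolding vder_Nil[OF ys] .
    have bc: "Q.curve_derivative (\<lambda>s. vder b (y + s *\<^sub>R v)) (vder (v # b) (y + 0 *\<^sub>R v))" if "b \<in> set P" for b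
      using vder_curve_derivative[OF c N y x(2) b(1)[OF that]] b(3)[OF that] by simp
    from Q.frechet_curves_DERIV[OF D gc, of P "\<lambda>b s. vder b (y + s *\<^sub>R v)" "(#) v", OF bc]
    have "((\<lambda>s. D (length P) (g (y + s *\<^sub>R v)) (map (\<lambda>b. vder b (y + s *\<^sub>R v)) P)) has_real_derivative
      D (Suc (length P)) (g y) (vder [v] y # map (\<lambda>b. vder b y) P) +
      sum_list (map (\<lambda>Q. D (length P) (g y) (map (\<lambda>b. vder b y) Q)) (modify_each ((#) v) P))) (at 0)" by simp
    moreover have "D (length P) (g (y + s *\<^sub>R v)) (map (\<lambda>b. vder b (y + s *\<^sub>R v)) P) =
        dder h (map (\<lambda>b. vder b (y + s *\<^sub>R v)) P) (g (y + s *\<^sub>R v))" for s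
      using Q.dder_eq_frechet[OF D gin[OF ys[of s]], of "map (\<lambda>b. vder b (y + s *\<^sub>R v)) P"] vin[OF ys] b by force
    moreover have "D (Suc (length P)) (g y) (vder [v] y # map (\<lambda>b. vder b y) P) =
        dder h (map (\<lambda>b. vder b y) ([v] # P)) (g y)"
      using Q.dder_eq_frechet[OF D gin[OF y], of "map (\<lambda>b. vder b y) ([v] # P)"] vin[OF y] b vin[OF y, of "[v]"] x(2)
      by (force simp del: dder.simps)
    moreover have "D (length P) (g y) (map (\<lambda>b. vder b y) Q) = dder h (map (\<lambda>b. vder b y) Q) (g y)"
      if Q: "Q \<in> set (modify_each ((#) v) P)" for Q
    proof -
      have "vder b y \<in> span (polar c)" if "b \<in> set Q" for b
        using Q
      proof (rule modify_eachE)
        fix us b' ws assume "P = us @ b' # ws" "Q = us @ (v # b') # ws"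
        then show ?thesis using that b[of b] b[of b'] x(2) by (auto intro!: vin[OF y])
      qed
      then have "set (map (\<lambda>b. vder b y) Q) \<subseteq> span (polar c)" by auto
      from Q.dder_eq_frechet[OF D gin[OF y] this] length_modify_each[OF Q] show ?thesis by simp
    qed
    ultimately show ?thesis by (simp del: dder.simps cong: map_cong)
  qed
  from DERIV_sum_list[OF this]
  show "((\<lambda>s. comp_der (x + t *\<^sub>R v + s *\<^sub>R v) vs) has_real_derivative comp_der (x + t *\<^sub>R v) (v # vs)) (at 0)"
    unfolding comp_der_def sum_list_partitions_Cons y_def .
qed

lemma comp_der_linear_hd:
  assumes x: "x \<in> S" "u \<in> S" "v \<in> S" "set vs \<subseteq> S"
  shows "comp_der x ((\<alpha> *\<^sub>R u + \<beta> *\<^sub>R v) # vs) = \<alpha> * comp_der x (u # vs) + \<beta> * comp_der x (v # vs)"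
proof -
  define z where "z = \<alpha> *\<^sub>R u + \<beta> *\<^sub>R v"
  have z: "z \<in> S" unfolding z_def using x by (intro add_in scale_in)
  obtain c where c: "controls c (\<lambda>_. 1) (length vs + 1)" using controls_exists by blast
  have N: "1 \<le> length vs + 1" by simp
  let ?q = "Minkowski_functional (polar c)"
  interpret Q: seminorm_on "span (polar c)" ?q by (rule seminorm_on_polar[OF c N])
  obtain D where D: "frechet_derivatives_on (span (polar c)) ?q h D" using h_frechet_polar[OF c] by blast
  note gx = g_in_span_polar[OF c N x(1)]
  have vin: "vder b x \<in> span (polar c)" if "set b \<subseteq> S" "1 \<le> length b" "length b \<le> length vs + 1" for b
    using vder_controlled(1)[OF c N x(1) that] .
  let ?G = "\<lambda>b. vder b x"
  define t where "t u P = dder h (map ?G ([u] # P)) (g x) +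
    sum_list (map (\<lambda>Q. dder h (map ?G Q) (g x)) (modify_each ((#) u) P))" for u P
  have "t z P = \<alpha> * t u P + \<beta> * t v P" if P: "P \<in> set (partitions vs)" for P
  proof -
    have b: "set b \<subseteq> S" "1 \<le> length b" "length b \<le> length vs" if "b \<in> set P" for b
      using block_in[OF P x(4) that] partitions_block_length[OF P that] by auto
    have "vder b x \<in> span (polar c)" if "b \<in> set P" for b using b[OF that] by (intro vin) auto
    then have G: "set (map ?G P) \<subseteq> span (polar c)" by auto
    note ml = frechet_derivatives_on_def[of "span (polar c)" ?q h D, THEN iffD1, OF D, THEN conjunct2, THEN conjunct1, rule_format, OF gx, THEN conjunct1]
    have t: "t u P = D (Suc (length P)) (g x) (?G [u] # map ?G P) +
      sum_list (map (\<lambda>Q. D (length P) (g x) ([] @ map ?G Q)) (modify_each ((#) u) P))" if u: "u \<in> S" for u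
    proof -
      have "dder h (map ?G ([u] # P)) (g x) = D (Suc (length P)) (g x) (?G [u] # map ?G P)"
        using Q.dder_eq_frechet[OF D gx, of "map ?G ([u] # P)"] vin[of "[u]"] u G by (simp del: dder.simps)
      moreover have "dder h (map ?G Q) (g x) = D (length P) (g x) ([] @ map ?G Q)"
        if Q: "Q \<in> set (modify_each ((#) u) P)" for Q
      proof -
        have "vder b x \<in> span (polar c)" if "b \<in> set Q" for b
          using Q
        proof (rule modify_eachE)
          fix us b' ws assume "P = us @ b' # ws" "Q = us @ (u # b') # ws"
          then show ?thesis using that b[of b] b[of b'] u by (auto intro!: vin)
        qed
        then have "set (map ?G Q) \<subseteq> span (polar c)" by auto
        from Q.dder_eq_frechet[OF D gx this] length_modify_each[OF Q] show ?thesis by simp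
      qed
      ultimately show ?thesis unfolding t_def by (simp del: dder.simps cong: map_cong)
    qed
    have "D (Suc (length P)) (g x) (?G [z] # map ?G P) =
        \<alpha> * D (Suc (length P)) (g x) (?G [u] # map ?G P) + \<beta> * D (Suc (length P)) (g x) (?G [v] # map ?G P)"
      using ml[of "Suc (length P)", unfolded multilinear_form_on_def, rule_format, of "[]" "map ?G P" "?G [u]" "?G [v]" \<alpha> \<beta>]
        vder_linear[OF x(1,2,3), of "[]" \<alpha> \<beta>] vin[of "[u]"] vin[of "[v]"] x G by (simp add: z_def)
    moreover have "sum_list (map (\<lambda>Q. D (length P) (g x) ([] @ map ?G Q)) (modify_each ((#) z) P)) =
      \<alpha> * sum_list (map (\<lambda>Q. D (length P) (g x) ([] @ map ?G Q)) (modify_each ((#) u) P)) +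
      \<beta> * sum_list (map (\<lambda>Q. D (length P) (g x) ([] @ map ?G Q)) (modify_each ((#) v) P))"
    proof (rule multilinear_modify_each_linear[OF ml])
      fix b assume "b \<in> set P"
      note b = b[OF this]
      show "?G b \<in> span (polar c) \<and> ?G (u # b) \<in> span (polar c) \<and> ?G (v # b) \<in> span (polar c) \<and>
          ?G (z # b) = \<alpha> *\<^sub>R ?G (u # b) + \<beta> *\<^sub>R ?G (v # b)"
        using b x vder_linear[OF x(1,2,3) b(1)] by (intro conjI vin) (simp_all add: z_def)
    qed simp_all
    ultimately show ?thesis unfolding t[OF x(2)] t[OF x(3)] t[OF z] by (simp add: distrib_left)
  qed
  then have "sum_list (map (t z) (partitions vs)) = sum_list (map (\<lambda>P. \<alpha> * t u P + \<beta> * t v P) (partitions vs))"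
    by (simp cong: map_cong)
  then show ?thesis unfolding comp_der_def sum_list_partitions_Cons z_def[symmetric] t_def[symmetric]
    by (simp add: sum_list_addf sum_list_const_mult)
qed

text \<open>A later slot becomes the head slot once the directions before it are removed, and these
  are restored by differentiating: \<open>comp_der x (w # us @ y # vs)\<close> is the derivative at
  0 of \<open>comp_der (x + t *\<^sub>R w) (us @ y # vs)\<close>. Linear identities survive
  differentiation, so symmetry of the derivatives is never invoked.\<close>

lemma comp_der_multilinear:
  assumes "x \<in> S"
  shows "multilinear_form_on S k (comp_der x)"
proof -
  have "comp_der x (us @ (\<alpha> *\<^sub>R u + \<beta> *\<^sub>R v) # vs) = \<alpha> * comp_der x (us @ u # vs) + \<beta> * comp_der x (us @ v # vs)"
    if "x \<in> S" "set us \<subseteq> S" "set vs \<subseteq> S" "u \<in> S" "v \<in> S" for x us vs u v \<alpha> \<beta>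
    using that
  proof (induction us arbitrary: x)
    case Nil then show ?case using comp_der_linear_hd by simp
  next
    case (Cons w us)
    have w: "w \<in> S" using Cons.prems by simp
    have "\<alpha> *\<^sub>R u + \<beta> *\<^sub>R v \<in> S" using Cons.prems by (intro add_in scale_in)
    then have d: "((\<lambda>t. comp_der (x + t *\<^sub>R w) (us @ y # vs)) has_real_derivative comp_der x (w # us @ y # vs)) (at 0)"
      if "y \<in> {u, v, \<alpha> *\<^sub>R u + \<beta> *\<^sub>R v}" for y
      using comp_der_line[OF Cons.prems(1) w, of "us @ y # vs" 0] Cons.prems that by auto
    have "comp_der (x + t *\<^sub>R w) (us @ (\<alpha> *\<^sub>R u + \<beta> *\<^sub>R v) # vs) =
        \<alpha> * comp_der (x + t *\<^sub>R w) (us @ u # vs) + \<beta> * comp_der (x + t *\<^sub>R w) (us @ v # vs)" for t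
      using Cons.prems w by (intro Cons.IH add_in scale_in) auto
    with d[of "\<alpha> *\<^sub>R u + \<beta> *\<^sub>R v"]
    have "((\<lambda>t. \<alpha> * comp_der (x + t *\<^sub>R w) (us @ u # vs) + \<beta> * comp_der (x + t *\<^sub>R w) (us @ v # vs)) has_real_derivative
      comp_der x (w # us @ (\<alpha> *\<^sub>R u + \<beta> *\<^sub>R v) # vs)) (at 0)" by simp
    moreover have "((\<lambda>t. \<alpha> * comp_der (x + t *\<^sub>R w) (us @ u # vs) + \<beta> * comp_der (x + t *\<^sub>R w) (us @ v # vs)) has_real_derivative
      \<alpha> * comp_der x (w # us @ u # vs) + \<beta> * comp_der x (w # us @ v # vs)) (at 0)"
      by (intro DERIV_add DERIV_cmult d) auto
    ultimately show ?case by (simp add: DERIV_unique)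
  qed
  then show ?thesis using assms unfolding multilinear_form_on_def by blast
qed

text \<open>The common estimate behind all three cases. The head block carries the decay factor with
  weights \<open>wK\<close>, the remaining blocks the weights \<open>w\<close>, and \<open>u\<close>
  bounds the derivatives of \<open>h\<close> at \<open>g x\<close>.\<close>

lemma comp_der_estimate:
  assumes c: "controls c w N" and N: "1 \<le> N" and x: "x \<in> S"
    and wK: "\<And>\<phi> vs. dual \<phi> \<Longrightarrow> set vs \<subseteq> S \<Longrightarrow> 1 \<le> length vs \<Longrightarrow> length vs \<le> N \<Longrightarrow>
      (1 + p x) ^ K * \<bar>dder (\<phi> \<circ> g) vs x\<bar> \<le> wK (length vs) * c \<phi> * prod_list (map p vs)"
    and wK0: "\<And>n. 0 \<le> wK n"
    and u: "\<And>ws. 1 \<le> length ws \<Longrightarrow> length ws \<le> N \<Longrightarrow> set ws \<subseteq> span (polar c) \<Longrightarrow>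
      \<bar>dder h ws (g x)\<bar> \<le> u (length ws) * prod_list (map (Minkowski_functional (polar c)) ws)"
    and u0: "\<And>n. 0 \<le> u n"
    and vs: "set vs \<subseteq> S" "1 \<le> length vs" "length vs \<le> N"
  shows "(1 + p x) ^ K * \<bar>comp_der x vs\<bar> \<le>
    sum_list (map (\<lambda>P. u (length P) * (wK (length (hd P)) * prod_list (map (\<lambda>b. w (length b)) (tl P)))) (partitions vs)) *
    prod_list (map p vs)"
proof -
  let ?q = "Minkowski_functional (polar c)"
  interpret Q: seminorm_on "span (polar c)" ?q by (rule seminorm_on_polar[OF c N])
  have px: "0 < (1 + p x) ^ K" using nonneg[OF x] by (simp add: add_pos_nonneg)
  have "(1 + p x) ^ K * \<bar>dder h (map (\<lambda>b. vder b x) P) (g x)\<bar> \<le>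
      u (length P) * (wK (length (hd P)) * prod_list (map (\<lambda>b. w (length b)) (tl P))) * prod_list (map p vs)"
    if P: "P \<in> set (partitions vs)" for P
  proof -
    \<comment> \<open>Order at least 1 provides a block to which the decay can be charged.\<close>
    have "vs \<noteq> []" using vs by auto
    then obtain b P' where P': "P = b # P'" using partition_nonempty[OF P] by (cases P) auto
    have b: "set b \<subseteq> S" "1 \<le> length b" "length b \<le> N" if "b \<in> set P" for b
      using block_in[OF P vs(1) that] partitions_block_length[OF P that] vs by auto
    have vin: "vder b x \<in> span (polar c)" if "b \<in> set P" for b
      using vder_controlled(1)[OF c N x b[OF that]] .
    have q0: "0 \<le> ?q (vder b x)" if "b \<in> set P" for b using Q.nonneg[OF vin[OF that]] .
    have "\<bar>dder h (map (\<lambda>b. vder b x) P) (g x)\<bar> \<le> u (length P) * prod_list (map ?q (map (\<lambda>b. vder b x) P))"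
      using u[of "map (\<lambda>b. vder b x) P"] vin length_partition_le[OF P] vs by (force simp: P' simp del: dder.simps)
    also have "prod_list (map ?q (map (\<lambda>b. vder b x) P)) = ?q (vder b x) * prod_list (map (\<lambda>b. ?q (vder b x)) P')"
      unfolding P' by (simp add: o_def)
    finally have 1: "(1 + p x) ^ K * \<bar>dder h (map (\<lambda>b. vder b x) P) (g x)\<bar> \<le>
        u (length P) * (((1 + p x) ^ K * ?q (vder b x)) * prod_list (map (\<lambda>b. ?q (vder b x)) P'))"
      using px by (simp add: mult_ac del: dder.simps)
    have 2: "(1 + p x) ^ K * ?q (vder b x) \<le> wK (length b) * prod_list (map p b)"
    proof -
      have bP: "b \<in> set P" unfolding P' by simp
      \<comment> \<open>For fixed \<open>x\<close> the decay factor is a scalar, so it can be moved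
        into the radius before the functionals are combined into the gauge.\<close>
      have "?q (vder b x) \<le> wK (length b) * prod_list (map p b) / (1 + p x) ^ K"
      proof (rule polar_gauge_le(2)[OF controlled(1)[OF c N]])
        show "0 \<le> wK (length b) * prod_list (map p b) / (1 + p x) ^ K"
          using px wK0 prod_list_p_nonneg[OF b(1)[OF bP]] by simp
        fix \<phi> :: "'f \<Rightarrow> real" assume \<phi>: "dual \<phi>"
        show "\<bar>\<phi> (vder b x)\<bar> \<le> wK (length b) * prod_list (map p b) / (1 + p x) ^ K * c \<phi>"
          using wK[OF \<phi> b[OF bP]] px by (simp add: dual_vder[OF x b(1)[OF bP] \<phi>] field_simps)
      qed
      then show ?thesis using px by (simp add: field_simps)
    qed
    have 3: "prod_list (map (\<lambda>b. ?q (vder b x)) R) \<le> prod_list (map (\<lambda>b. w (length b)) R) * prod_list (map (\<lambda>b. prod_list (map p b)) R)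
        \<and> 0 \<le> prod_list (map (\<lambda>b. ?q (vder b x)) R)" if "set R \<subseteq> set P" for R
      using that
    proof (induction R)
      case (Cons a R)
      have a: "a \<in> set P" using Cons.prems by simp
      have IH: "prod_list (map (\<lambda>b. ?q (vder b x)) R) \<le> prod_list (map (\<lambda>b. w (length b)) R) * prod_list (map (\<lambda>b. prod_list (map p b)) R)"
        "0 \<le> prod_list (map (\<lambda>b. ?q (vder b x)) R)" using Cons by auto
      have "?q (vder a x) * prod_list (map (\<lambda>b. ?q (vder b x)) R) \<le> (w (length a) * prod_list (map p a)) *
          (prod_list (map (\<lambda>b. w (length b)) R) * prod_list (map (\<lambda>b. prod_list (map p b)) R))"
        using vder_controlled(2)[OF c N x b[OF a]] IH prod_list_p_nonneg[OF b(1)[OF a]] controlled(3)[OF c N]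
        by (intro mult_mono) auto
      then show ?case using IH q0[OF a] by (simp add: mult_ac)
    qed simp
    have "((1 + p x) ^ K * ?q (vder b x)) * prod_list (map (\<lambda>b. ?q (vder b x)) P') \<le>
        (wK (length b) * prod_list (map p b)) * (prod_list (map (\<lambda>b. w (length b)) P') * prod_list (map (\<lambda>b. prod_list (map p b)) P'))"
      by (rule mult_mono[OF 2]) (use 3[of P'] wK0 prod_list_p_nonneg[OF b(1)[of b]] in \<open>auto simp: P'\<close>)
    also have "\<dots> = (wK (length b) * prod_list (map (\<lambda>b. w (length b)) P')) * prod_list (map p vs)"
      using prod_list_partition[OF P, of p] by (simp add: P' mult_ac)
    finally have "u (length P) * (((1 + p x) ^ K * ?q (vder b x)) * prod_list (map (\<lambda>b. ?q (vder b x)) P')) \<le>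
      u (length P) * ((wK (length b) * prod_list (map (\<lambda>b. w (length b)) P')) * prod_list (map p vs))"
      by (intro mult_left_mono u0)
    with 1 show ?thesis by (simp add: P' mult.assoc del: dder.simps)
  qed
  note summand = this
  have "\<bar>comp_der x vs\<bar> \<le> sum_list (map (\<lambda>P. \<bar>dder h (map (\<lambda>b. vder b x) P) (g x)\<bar>) (partitions vs))"
    using sum_list_abs[of "map (\<lambda>P. dder h (map (\<lambda>b. vder b x) P) (g x)) (partitions vs)"]
    by (simp add: comp_der_def o_def del: dder.simps)
  then have "(1 + p x) ^ K * \<bar>comp_der x vs\<bar> \<le>
      sum_list (map (\<lambda>P. (1 + p x) ^ K * \<bar>dder h (map (\<lambda>b. vder b x) P) (g x)\<bar>) (partitions vs))"
    using px by (simp add: sum_list_const_mult)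
  also have "\<dots> \<le> sum_list (map (\<lambda>P. u (length P) * (wK (length (hd P)) * prod_list (map (\<lambda>b. w (length b)) (tl P))) *
      prod_list (map p vs)) (partitions vs))"
    by (intro sum_list_mono summand)
  finally show ?thesis by (simp add: sum_list_mult_const)
qed

lemma dder_h_bounded:
  assumes c: "controls c w N" and N: "1 \<le> N"
  shows "\<exists>u. (\<forall>n. 0 \<le> u n) \<and> (\<forall>y\<in>span (polar c). \<forall>ws. 1 \<le> length ws \<longrightarrow> set ws \<subseteq> span (polar c) \<longrightarrow>
      \<bar>dder h ws y\<bar> \<le> u (length ws) * prod_list (map (Minkowski_functional (polar c)) ws))"
proof -
  let ?q = "Minkowski_functional (polar c)" and ?S = "span (polar c)"
  interpret Q: seminorm_on ?S ?q by (rule seminorm_on_polar[OF c N])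
  obtain D where D: "frechet_derivatives_on ?S ?q h D"
    and "\<And>k. 1 \<le> k \<Longrightarrow> bdd_above {opnorm_on ?S ?q k (D k y) | y. y \<in> ?S}" using h_frechet_polar[OF c] by blast
  then have "\<forall>k. \<exists>C. 1 \<le> k \<longrightarrow> (\<forall>y\<in>?S. opnorm_on ?S ?q k (D k y) \<le> C)" unfolding bdd_above_def by blast
  then obtain C where C: "\<And>k y. 1 \<le> k \<Longrightarrow> y \<in> ?S \<Longrightarrow> opnorm_on ?S ?q k (D k y) \<le> C k" by metis
  have "\<bar>dder h ws y\<bar> \<le> \<bar>C (length ws)\<bar> * prod_list (map ?q ws)"
    if y: "y \<in> ?S" and ws: "1 \<le> length ws" "set ws \<subseteq> ?S" for y ws
  proof -
    have "\<bar>dder h ws y\<bar> \<le> opnorm_on ?S ?q (length ws) (D (length ws) y) * prod_list (map ?q ws)"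
      using Q.opnorm_bound[OF Q.frechet_derivatives_on_multilinear[OF D y] Q.frechet_derivatives_on_bounded[OF D y] refl ws(2)]
        Q.dder_eq_frechet[OF D y ws(2)] by simp
    also have "\<dots> \<le> \<bar>C (length ws)\<bar> * prod_list (map ?q ws)"
      using C[OF ws(1) y] Q.prod_list_p_nonneg[OF ws(2)] by (intro mult_right_mono) auto
    finally show ?thesis .
  qed
  then show ?thesis by (intro exI[of _ "\<lambda>n. \<bar>C n\<bar>"]) auto
qed

lemma comp_der_bounded:
  assumes k: "1 \<le> k"
  shows "\<exists>C. \<forall>x\<in>S. \<forall>vs. length vs = k \<longrightarrow> set vs \<subseteq> S \<longrightarrow> \<bar>comp_der x vs\<bar> \<le> C * prod_list (map p vs)"
proof -
  obtain c where c: "controls c (\<lambda>_. 1) k" using controls_exists by blast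
  obtain u where u0: "\<And>n. 0 \<le> u n"
    and u: "\<And>y ws. y \<in> span (polar c) \<Longrightarrow> 1 \<le> length ws \<Longrightarrow> set ws \<subseteq> span (polar c) \<Longrightarrow>
      \<bar>dder h ws y\<bar> \<le> u (length ws) * prod_list (map (Minkowski_functional (polar c)) ws)"
    using dder_h_bounded[OF c k] by blast
  define C where "C = (\<Sum>j\<le>k. u j) * (3 ^ k * fact k)"
  have "\<bar>comp_der x vs\<bar> \<le> C * prod_list (map p vs)" if x: "x \<in> S" and vs: "length vs = k" "set vs \<subseteq> S" for x vs
  proof -
    have "(1 + p x) ^ 0 * \<bar>comp_der x vs\<bar> \<le> sum_list (map (\<lambda>P. u (length P) * (1 * prod_list (map (\<lambda>b. 1) (tl P)))) (partitions vs)) * prod_list (map p vs)"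
    proof (rule comp_der_estimate[OF c k x, of 0 "\<lambda>_. 1" u])
      show "(1 + p x) ^ 0 * \<bar>dder (\<phi> \<circ> g) ws x\<bar> \<le> 1 * c \<phi> * prod_list (map p ws)"
        if "dual \<phi>" "set ws \<subseteq> S" "1 \<le> length ws" "length ws \<le> k" for \<phi> ws
        using controlled(4)[OF c k that(1) x that(2-)] by simp
    qed (use u0 u[OF g_in_span_polar[OF c k x]] vs k in auto)
    moreover have "prod_list (map (\<lambda>b. 1) R) = (1::real)" for R :: "'e list list" by (induction R) auto
    moreover have "sum_list (map (\<lambda>P. u (length P)) (partitions vs)) \<le> C"
      unfolding C_def vs(1)[symmetric] using u0 length_partition_le
      by (intro sum_partitions_le member_le_sum sum_nonneg) auto
    ultimately show ?thesis using mult_right_mono[OF _ prod_list_p_nonneg[OF vs(2)]] by (simp add: order_trans)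
  qed
  then show ?thesis by blast
qed

lemma comp_der_frechet: "frechet_derivatives_on S p (h \<circ> g) (\<lambda>_. comp_der)"
proof (rule frechet_derivatives_onI)
  show "comp_der x [] = (h \<circ> g) x" if "x \<in> S" for x by (simp add: comp_der_def)
qed (use comp_der_multilinear comp_der_line comp_der_bounded in blast)+

end

section \<open>Sequences characterising geometric growth\<close>

text \<open>Submultiplicativity makes \<open>inverse (r n)\<close> supermultiplicative, as products
  over blocks require. The last condition turns any geometric rate into a constant:
  \<open>t ^ n \<le> C * inverse (r n)\<close>.\<close>

definition rapidly_decreasing :: "(nat \<Rightarrow> real) \<Rightarrow> bool" where
  "rapidly_decreasing r \<longleftrightarrow> (\<forall>n. 0 < r n) \<and> (\<forall>m n. r (m + n) \<le> r m * r n) \<and> (\<forall>t>0. \<exists>C. \<forall>n. r n * t ^ n \<le> C)"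

text \<open>Serves as a first test sequence, which yields some bound for each exponent before the
  decisive sequence is constructed.\<close>

lemma rapidly_decreasing_inverse_fact: "rapidly_decreasing (\<lambda>n. inverse (fact n))"
  unfolding rapidly_decreasing_def
proof (intro conjI allI impI)
  fix m n :: nat
  have "fact m * fact n \<le> (fact (m + n) :: nat)"
    using fact_fact_dvd_fact[of m n] by (intro dvd_imp_le) auto
  then have "real (fact m * fact n) \<le> real (fact (m + n))" by (simp only: of_nat_le_iff)
  then have "fact m * fact n \<le> (fact (m + n) :: real)" by simp
  then show "inverse (fact (m + n)) \<le> inverse (fact m) * inverse (fact n :: real)"
    unfolding inverse_mult_distrib[symmetric] by (intro le_imp_inverse_le) auto
next
  fix t :: real assume "0 < t"
  have "summable (\<lambda>n. inverse (fact n) * t ^ n)" by (rule summable_exp)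
  then have "Bseq (\<lambda>n. inverse (fact n) * t ^ n)" by (rule summable_imp_Bseq)
  then obtain K where "\<And>n. norm (inverse (fact n) * t ^ n) \<le> K" unfolding Bseq_def by blast
  then show "\<exists>C. \<forall>n. inverse (fact n) * t ^ n \<le> C" by (intro exI[of _ K]) (auto intro: order_trans[OF abs_ge_self])
qed simp

text \<open>This replaces a uniform radius for the whole family of functionals, which need not exist: for every
  fixed sequence \<open>r\<close>, weighting with \<open>r\<close> turns the Roumieu condition on the individual functionals into
  weak boundedness.\<close>

lemma geometric_growth_if_rapidly_decreasing:
  fixes a :: "'i \<Rightarrow> real" and n :: "'i \<Rightarrow> nat"
  assumes *: "\<And>r. rapidly_decreasing r \<Longrightarrow> \<exists>C \<tau>. 0 < \<tau> \<and> (\<forall>i\<in>I. a i * r (n i) \<le> C * \<tau> ^ n i)"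
  shows "\<exists>C. \<exists>\<sigma>>0. \<forall>i\<in>I. a i \<le> C * \<sigma> ^ n i"
proof (rule ccontr)
  assume neg: "\<not> ?thesis"
  obtain C \<tau> where \<tau>: "0 < \<tau>" and le: "\<And>i. i \<in> I \<Longrightarrow> a i * inverse (fact (n i)) \<le> C * \<tau> ^ n i"
    using *[OF rapidly_decreasing_inverse_fact] by blast
  \<comment> \<open>Testing with inverse factorials bounds \<open>a\<close> on all indices with
    \<open>n i \<le> m\<close>. A violation of the bound by \<open>K ^ n i\<close> must therefore
    occur beyond every \<open>m\<close>.\<close>
  have large: "\<exists>i\<in>I. m < n i \<and> K ^ n i < a i" if K: "1 \<le> K" for m and K :: real
  proof (rule ccontr)
    assume no: "\<not> ?thesis"
    define B where "B = \<bar>C\<bar> * ((\<tau> + 1) ^ m * fact m) + 1"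
    have B: "1 \<le> B" using \<tau> unfolding B_def by simp
    have "a i \<le> B * K ^ n i" if i: "i \<in> I" for i
    proof (cases "m < n i")
      case True
      then have "a i \<le> 1 * K ^ n i" using no i by force
      also have "\<dots> \<le> B * K ^ n i" using B K by (intro mult_right_mono) auto
      finally show ?thesis .
    next
      case False
      have "a i \<le> C * \<tau> ^ n i * fact (n i)" using le[OF i] by (simp add: field_simps)
      also have "\<dots> \<le> \<bar>C\<bar> * ((\<tau> + 1) ^ n i * fact (n i))"
        using \<tau> by (simp add: mult.assoc) (intro mult_mono power_mono mult_right_mono; simp)
      also have "\<dots> \<le> \<bar>C\<bar> * ((\<tau> + 1) ^ m * fact m)"
        using \<tau> False by (intro mult_left_mono mult_mono power_increasing fact_mono) auto
      also have "\<dots> \<le> B * 1" unfolding B_def by simp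
      also have "\<dots> \<le> B * K ^ n i" using B K by (intro mult_left_mono one_le_power) auto
      finally show ?thesis .
    qed
    moreover have "0 < K" using K by simp
    ultimately show False using neg by blast
  qed
  \<comment> \<open>The cube leaves room: one power of the base will be lost to \<open>r\<close>,
    and the rest still outgrows every geometric sequence.\<close>
  have "\<forall>m. \<exists>i. i \<in> I \<and> m < n i \<and> (real (Suc m) ^ 3) ^ n i < a i"
    using large[of "real (Suc _) ^ 3"] by (simp add: Bex_def one_le_power)
  then obtain i where i: "\<And>m. i m \<in> I" "\<And>m. m < n (i m)" "\<And>m. (real (Suc m) ^ 3) ^ n (i m) < a (i m)" by metis
  \<comment> \<open>\<open>l\<close> grows to infinity as slowly as the violating exponents permit,
    and \<open>r k\<close> will be the k-th power of \<open>1 / (l k + 1)\<close>. Monotonicity of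
    \<open>l\<close> makes \<open>r\<close> submultiplicative, its growth makes \<open>r\<close>
    rapidly decreasing, and \<open>l (n (i m)) \<le> m\<close> keeps \<open>r\<close> large at the
    violating indices.\<close>
  define l where "l k = (LEAST m. k \<le> n (i m))" for k
  have l: "k \<le> n (i (l k))" for k
    unfolding l_def by (rule LeastI_ex) (use i(2)[of k] in \<open>auto intro: less_imp_le\<close>)
  have l_le: "l k \<le> m" if "k \<le> n (i m)" for k m unfolding l_def using that by (rule Least_le)
  have l_mono: "l j \<le> l k" if "j \<le> k" for j k using l_le[of j "l k"] l[of k] that by simp
  define r where "r k = (inverse (real (Suc (l k)))) ^ k" for k
  have "rapidly_decreasing r"
    unfolding rapidly_decreasing_def
  proof (intro conjI allI impI)
    show "0 < r k" for k unfolding r_def by simp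
    fix j k
    have "(inverse (real (Suc (l (j + k))))) ^ j \<le> (inverse (real (Suc (l j)))) ^ j"
      "(inverse (real (Suc (l (j + k))))) ^ k \<le> (inverse (real (Suc (l k)))) ^ k"
      using l_mono[of j "j + k"] l_mono[of k "j + k"] by (auto intro!: power_mono le_imp_inverse_le)
    then show "r (j + k) \<le> r j * r k" unfolding r_def power_add by (intro mult_mono) auto
  next
    fix t :: real assume t: "0 < t"
    obtain m where m: "t \<le> real m" using real_arch_simple by blast
    \<comment> \<open>For \<open>k\<close> beyond \<open>k0\<close>, none of the exponents
      \<open>n (i j)\<close> with \<open>j < m\<close> reaches \<open>k\<close>, hence
      \<open>l k \<ge> m\<close> and \<open>t\<close> is absorbed.\<close>
    define k0 where "k0 = (\<Sum>j<m. n (i j))"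
    have "r k * t ^ k \<le> (1 + t) ^ k0" for k
    proof (cases "k \<le> k0")
      case True
      have "r k * t ^ k \<le> 1 * (1 + t) ^ k" using t unfolding r_def
        by (intro mult_mono power_mono power_le_one) (auto simp: inverse_le_1_iff)
      also have "\<dots> \<le> 1 * (1 + t) ^ k0" using True t by (intro mult_left_mono power_increasing) auto
      finally show ?thesis by simp
    next
      case False
      have "m \<le> l k"
      proof (rule ccontr)
        assume "\<not> m \<le> l k"
        then have "n (i (l k)) \<le> k0" unfolding k0_def by (intro member_le_sum) auto
        then show False using l[of k] False by simp
      qed
      then have "t \<le> real (Suc (l k))" using m by linarith
      then have "inverse (real (Suc (l k))) * t \<le> 1" by (simp add: field_simps)
      then have "(inverse (real (Suc (l k))) * t) ^ k \<le> 1" using t by (intro power_le_one) auto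
      also have "\<dots> \<le> (1 + t) ^ k0" using t by (intro one_le_power) auto
      finally show ?thesis unfolding r_def by (simp add: power_mult_distrib)
    qed
    then show "\<exists>C. \<forall>k. r k * t ^ k \<le> C" by blast
  qed
  from *[OF this] obtain C' \<tau>' where \<tau>': "0 < \<tau>'" and le': "\<And>j. j \<in> I \<Longrightarrow> a j * r (n j) \<le> C' * \<tau>' ^ n j" by blast
  \<comment> \<open>The constant \<open>C'\<close> is put under the power, which is possible since
    \<open>n (i m)\<close> is at least 1.\<close>
  obtain m where m: "\<tau>' * (1 + \<bar>C'\<bar>) \<le> real m" using real_arch_simple by blast
  let ?s = "real (Suc m)" and ?k = "n (i m)"
  have "(\<tau>' * (1 + \<bar>C'\<bar>)) ^ ?k \<le> ?s ^ ?k" using m \<tau>' by (intro power_mono) auto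
  also have "\<dots> \<le> (?s ^ 3) ^ ?k * inverse ?s ^ ?k"
  proof -
    have "?s \<le> ?s ^ 3 * inverse ?s" by (simp add: power3_eq_cube)
    then show ?thesis unfolding power_mult_distrib[symmetric] by (intro power_mono) auto
  qed
  also have "\<dots> < a (i m) * inverse ?s ^ ?k" using i(3)[of m] by (intro mult_strict_right_mono) auto
  also have "\<dots> \<le> a (i m) * r ?k"
  proof (rule mult_left_mono)
    show "inverse ?s ^ ?k \<le> r ?k" unfolding r_def using l_le[of ?k m]
      by (intro power_mono le_imp_inverse_le) auto
    show "0 \<le> a (i m)" using i(3)[of m] by (meson less_imp_le of_nat_0_le_iff order_le_less_trans zero_le_power)
  qed
  also have "\<dots> \<le> C' * \<tau>' ^ ?k" by (rule le'[OF i(1)])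
  also have "\<dots> \<le> (1 + \<bar>C'\<bar>) ^ ?k * \<tau>' ^ ?k"
  proof (rule mult_right_mono)
    have "C' \<le> (1 + \<bar>C'\<bar>) ^ 1" by simp
    also have "\<dots> \<le> (1 + \<bar>C'\<bar>) ^ ?k" using i(2)[of m] by (intro power_increasing) auto
    finally show "C' \<le> (1 + \<bar>C'\<bar>) ^ ?k" .
  qed (use \<tau>' in simp)
  finally show False by (simp add: power_mult_distrib mult.commute)
qed

section \<open>Weighted estimates for compositions\<close>

context seminorm_on begin

lemma weighted_opnorm_le:
  assumes x: "x \<in> S" and C: "0 \<le> C"
    and le: "\<And>vs. length vs = l \<Longrightarrow> set vs \<subseteq> S \<Longrightarrow> (1 + p x) ^ k * \<bar>T vs\<bar> \<le> C * prod_list (map p vs)"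
  shows "(1 + p x) ^ k * opnorm_on S p l T \<le> C"
proof -
  have px: "0 < (1 + p x) ^ k" using nonneg[OF x] by (simp add: add_pos_nonneg)
  have "opnorm_on S p l T \<le> C / (1 + p x) ^ k"
    by (rule opnorm_le) (use le px C in \<open>auto simp: field_simps\<close>)
  then show ?thesis using px by (simp add: field_simps)
qed

lemma weighted_dder_le:
  assumes D: "frechet_derivatives_on S p h D" and x: "x \<in> S" and vs: "set vs \<subseteq> S"
    and le: "(1 + p x) ^ k * opnorm_on S p (length vs) (D (length vs) x) \<le> C"
  shows "(1 + p x) ^ k * \<bar>dder h vs x\<bar> \<le> C * prod_list (map p vs)"
proof -
  have px: "0 \<le> (1 + p x) ^ k" using nonneg[OF x] by simp
  have "\<bar>dder h vs x\<bar> \<le> opnorm_on S p (length vs) (D (length vs) x) * prod_list (map p vs)"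
    using opnorm_bound[OF frechet_derivatives_on_multilinear[OF D x] frechet_derivatives_on_bounded[OF D x] refl vs]
      dder_eq_frechet[OF D x vs] by simp
  from mult_left_mono[OF this px]
  have "(1 + p x) ^ k * \<bar>dder h vs x\<bar> \<le> ((1 + p x) ^ k * opnorm_on S p (length vs) (D (length vs) x)) * prod_list (map p vs)"
    by (simp add: mult.assoc)
  also have "\<dots> \<le> C * prod_list (map p vs)" using le prod_list_p_nonneg[OF vs] by (rule mult_right_mono)
  finally show ?thesis .
qed

end

context weakly_smooth_composition begin

text \<open>For fixed \<open>k\<close> and \<open>l\<close> only the finitely many orders up to
  \<open>l\<close> occur, so their decay constants are simply added to \<open>c0\<close> and all
  weights can be 1.\<close>

lemma comp_der_rapidly_decreasing:
  assumes rd: "\<And>\<phi> k l. dual \<phi> \<Longrightarrow> 1 \<le> l \<Longrightarrow> \<exists>C. \<forall>x\<in>S. \<forall>vs. length vs = l \<longrightarrow> set vs \<subseteq> S \<longrightarrow>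
      (1 + p x) ^ k * \<bar>dder (\<phi> \<circ> g) vs x\<bar> \<le> C * prod_list (map p vs)"
    and l: "1 \<le> l"
  shows "\<exists>C\<ge>0. \<forall>x\<in>S. \<forall>vs. length vs = l \<longrightarrow> set vs \<subseteq> S \<longrightarrow>
      (1 + p x) ^ k * \<bar>comp_der x vs\<bar> \<le> C * prod_list (map p vs)"
proof -
  obtain C where C: "\<And>\<phi> j x vs. dual \<phi> \<Longrightarrow> 1 \<le> j \<Longrightarrow> x \<in> S \<Longrightarrow> length vs = j \<Longrightarrow> set vs \<subseteq> S \<Longrightarrow>
      (1 + p x) ^ k * \<bar>dder (\<phi> \<circ> g) vs x\<bar> \<le> C \<phi> j * prod_list (map p vs)"
    using rd[of _ _ k] by metis
  obtain c0 where c0: "controls c0 (\<lambda>_. 1) l" using controls_exists by blast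
  define c where "c \<phi> = c0 \<phi> + (\<Sum>j\<in>{1..l}. \<bar>C \<phi> j\<bar>)" for \<phi>
  have le: "c0 \<phi> \<le> c \<phi>" "1 \<le> j \<Longrightarrow> j \<le> l \<Longrightarrow> dual \<phi> \<Longrightarrow> C \<phi> j \<le> c \<phi>" for \<phi> j
  proof -
    show "c0 \<phi> \<le> c \<phi>" unfolding c_def by (simp add: sum_nonneg)
    assume j: "1 \<le> j" "j \<le> l" "dual \<phi>"
    then have "\<bar>C \<phi> j\<bar> \<le> (\<Sum>j\<in>{1..l}. \<bar>C \<phi> j\<bar>)" by (intro member_le_sum) auto
    then show "C \<phi> j \<le> c \<phi>" using controlled(1)[OF c0 l j(3)] unfolding c_def by simp
  qed
  have c: "controls c (\<lambda>_. 1) l"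
    unfolding controls_def
  proof (intro conjI allI impI ballI)
    fix \<phi> :: "'f \<Rightarrow> real" assume \<phi>: "dual \<phi>"
    show "0 \<le> c \<phi>" "\<bar>\<phi> (g 0)\<bar> \<le> c \<phi>" using le(1)[of \<phi>] controlled(1,2)[OF c0 l \<phi>] by auto
    fix x vs assume x: "x \<in> S" "set vs \<subseteq> S" "1 \<le> length vs" "length vs \<le> l"
    show "\<bar>dder (\<phi> \<circ> g) vs x\<bar> \<le> 1 * c \<phi> * prod_list (map p vs)"
      using controlled(4)[OF c0 l \<phi> x] mult_right_mono[OF le(1)[of \<phi>] prod_list_p_nonneg[OF x(2)]] by simp
  qed simp
  obtain u where u0: "\<And>n. 0 \<le> u n"
    and u: "\<And>y ws. y \<in> span (polar c) \<Longrightarrow> 1 \<le> length ws \<Longrightarrow> set ws \<subseteq> span (polar c) \<Longrightarrow>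
      \<bar>dder h ws y\<bar> \<le> u (length ws) * prod_list (map (Minkowski_functional (polar c)) ws)"
    using dder_h_bounded[OF c l] by blast
  define A where "A = (\<Sum>j\<le>l. u j) * (3 ^ l * fact l)"
  have "0 \<le> A" unfolding A_def using u0 by (simp add: sum_nonneg)
  moreover have "(1 + p x) ^ k * \<bar>comp_der x vs\<bar> \<le> A * prod_list (map p vs)" if x: "x \<in> S" and vs: "length vs = l" "set vs \<subseteq> S" for x vs
  proof -
    have "(1 + p x) ^ k * \<bar>comp_der x vs\<bar> \<le> sum_list (map (\<lambda>P. u (length P) * (1 * prod_list (map (\<lambda>b. 1) (tl P)))) (partitions vs)) * prod_list (map p vs)"
    proof (rule comp_der_estimate[OF c l x, of k "\<lambda>_. 1" u])
      fix \<phi> :: "'f \<Rightarrow> real" and ws assume *: "dual \<phi>" "set ws \<subseteq> S" "1 \<le> length ws" "length ws \<le> l"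
      show "(1 + p x) ^ k * \<bar>dder (\<phi> \<circ> g) ws x\<bar> \<le> 1 * c \<phi> * prod_list (map p ws)"
        using C[OF *(1,3) x refl *(2)] mult_right_mono[OF le(2)[OF *(3,4,1)] prod_list_p_nonneg[OF *(2)]] by simp
    qed (use u0 u[OF g_in_span_polar[OF c l x]] vs l in auto)
    moreover have "prod_list (map (\<lambda>b. 1) R) = (1::real)" for R :: "'e list list" by (induction R) auto
    moreover have "sum_list (map (\<lambda>P. u (length P)) (partitions vs)) \<le> A"
      unfolding A_def vs(1)[symmetric] using u0 length_partition_le
      by (intro sum_partitions_le member_le_sum sum_nonneg) auto
    ultimately show ?thesis using mult_right_mono[OF _ prod_list_p_nonneg[OF vs(2)]] by (simp add: order_trans)
  qed
  ultimately show ?thesis by blast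
qed

text \<open>The set \<open>B\<close> depends on \<open>g\<close> and the weights only and precedes
  \<open>A\<close> and \<open>\<rho>\<close>, because the constants of \<open>h\<close> may depend
  on it. Three collapses give the estimate: supermultiplicativity for \<open>\<omega>\<close>,
  log-convexity for \<open>M\<close>, and the factorial sum with
  \<open>\<kappa> = \<rho> * M 1\<close> for what remains.\<close>

lemma comp_der_weighted:
  fixes M L \<omega> :: "nat \<Rightarrow> real"
  assumes M: "weight_sequence M" "log_convex_sequence M" and L: "weight_sequence L"
    and \<omega>: "\<And>n. 0 < \<omega> n" "\<And>m n. \<omega> m * \<omega> n \<le> \<omega> (m + n)"
    and dg: "\<And>\<phi>. dual \<phi> \<Longrightarrow> \<exists>C. \<forall>x\<in>S. \<forall>k vs. 1 \<le> length vs \<longrightarrow> set vs \<subseteq> S \<longrightarrow>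
      (1 + p x) ^ k * \<bar>dder (\<phi> \<circ> g) vs x\<bar> \<le>
      C * (\<omega> (k + length vs) * fact k * fact (length vs) * L k * M (length vs)) * prod_list (map p vs)"
  shows "\<exists>B. closed B \<and> absolutely_convex B \<and> vn_bounded B \<and> (\<forall>A\<ge>0. \<forall>\<rho>\<ge>0.
    (\<forall>y\<in>span B. \<forall>ws. 1 \<le> length ws \<longrightarrow> set ws \<subseteq> span B \<longrightarrow>
      \<bar>dder h ws y\<bar> \<le> A * (\<rho> ^ length ws * fact (length ws) * M (length ws)) * prod_list (map (Minkowski_functional B) ws)) \<longrightarrow>
    (\<forall>x\<in>S. \<forall>k vs. 1 \<le> length vs \<longrightarrow> set vs \<subseteq> S \<longrightarrow>
      (1 + p x) ^ k * \<bar>comp_der x vs\<bar> \<le>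
      A * (\<omega> (k + length vs) * fact k * fact (length vs) * L k * M (length vs)) * (\<rho> * M 1 + 2) ^ length vs * prod_list (map p vs)))"
proof -
  have pos: "0 < M n" "0 < L n" "L 0 = 1" for n using M(1) L unfolding weight_sequence_def by auto
  define W where "W k n = \<omega> (k + n) * fact k * fact n * L k * M n" for k n
  have W0: "0 \<le> W k n" for k n unfolding W_def using pos \<omega>(1) by (simp add: less_imp_le)
  obtain C where C: "\<And>\<phi> x k vs. dual \<phi> \<Longrightarrow> x \<in> S \<Longrightarrow> 1 \<le> length vs \<Longrightarrow> set vs \<subseteq> S \<Longrightarrow>
      (1 + p x) ^ k * \<bar>dder (\<phi> \<circ> g) vs x\<bar> \<le> C \<phi> * W k (length vs) * prod_list (map p vs)"
    using dg unfolding W_def by metis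
  define c where "c \<phi> = \<bar>\<phi> (g 0)\<bar> + \<bar>C \<phi>\<bar>" for \<phi>
  have c': "(1 + p x) ^ k * \<bar>dder (\<phi> \<circ> g) vs x\<bar> \<le> W k (length vs) * c \<phi> * prod_list (map p vs)"
    if *: "dual \<phi>" "x \<in> S" "1 \<le> length vs" "set vs \<subseteq> S" for \<phi> x k vs
  proof -
    have "C \<phi> * (W k (length vs) * prod_list (map p vs)) \<le> c \<phi> * (W k (length vs) * prod_list (map p vs))"
      using W0 prod_list_p_nonneg[OF *(4)] unfolding c_def by (intro mult_right_mono) auto
    then show ?thesis using C[OF *, of k] by (simp add: mult_ac)
  qed
  \<comment> \<open>Exponent 0 gives the weights of the blocks that carry no decay; since
    \<open>L 0 = 1\<close>, they do not involve \<open>L\<close>.\<close>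
  have c: "controls c (W 0) N" for N
    unfolding controls_def using W0 c'[of _ _ _ 0] by (auto simp: c_def simp del: dder.simps)
  let ?B = "polar c"
  have main: "(1 + p x) ^ k * \<bar>comp_der x vs\<bar> \<le> A * W k (length vs) * (\<rho> * M 1 + 2) ^ length vs * prod_list (map p vs)"
    if A: "0 \<le> A" "0 \<le> \<rho>" and h: "\<forall>y\<in>span ?B. \<forall>ws. 1 \<le> length ws \<longrightarrow> set ws \<subseteq> span ?B \<longrightarrow>
      \<bar>dder h ws y\<bar> \<le> A * (\<rho> ^ length ws * fact (length ws) * M (length ws)) * prod_list (map (Minkowski_functional ?B) ws)"
      and x: "x \<in> S" and vs: "1 \<le> length vs" "set vs \<subseteq> S" for A \<rho> x k vs
  proof -
    let ?l = "length vs"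
    let ?F = "\<lambda>P. A * (\<rho> ^ length P * fact (length P) * M (length P)) * (W k (length (hd P)) * prod_list (map (\<lambda>b. W 0 (length b)) (tl P)))"
    let ?w = "\<lambda>P. (\<rho> * M 1) ^ length P * fact (length P) * prod_list (map (\<lambda>b. fact (length b)) P)"
    \<comment> \<open>The part of the bound that no longer depends on the partition once the
      products of \<open>\<omega>\<close> and of \<open>M\<close> have collapsed; the factorial of
      \<open>?l\<close> is missing and comes from the sum over partitions.\<close>
    define E where "E = A * (\<omega> (k + ?l) * fact k * L k * M ?l)"
    have E: "0 \<le> E" unfolding E_def using A pos \<omega>(1) by (simp add: less_imp_le)
    have "(1 + p x) ^ k * \<bar>comp_der x vs\<bar> \<le> sum_list (map ?F (partitions vs)) * prod_list (map p vs)"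
    proof (rule comp_der_estimate[OF c vs(1) x, of k "W k" "\<lambda>n. A * (\<rho> ^ n * fact n * M n)"])
      show "0 \<le> A * (\<rho> ^ n * fact n * M n)" for n using A pos(1)[of n] by simp
    qed (use c' x W0 h g_in_span_polar[OF c[of 1] _ x] vs in auto)
    also have "\<dots> \<le> sum_list (map (\<lambda>P. E * ?w P) (partitions vs)) * prod_list (map p vs)"
    proof (intro mult_right_mono sum_list_mono prod_list_p_nonneg vs)
      fix P assume P: "P \<in> set (partitions vs)"
      have "vs \<noteq> []" using vs by auto
      then obtain b R where bR: "P = b # R" using partition_nonempty[OF P] by (cases P) auto
      have \<omega>s: "\<omega> n * prod_list (map (\<lambda>b. \<omega> (length b)) Q) \<le> \<omega> (n + sum_list (map length Q))" for n and Q :: "'e list list"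
      proof (induction Q arbitrary: n)
        case (Cons a Q)
        have "0 \<le> prod_list (map (\<lambda>b. \<omega> (length b)) Q)" by (rule prod_list_nonneg) (use \<omega>(1) in \<open>auto intro: less_imp_le\<close>)
        from mult_right_mono[OF \<omega>(2)[of n "length a"] this] Cons[of "n + length a"] show ?case by (simp add: mult.assoc add.assoc)
      qed simp
      have W_prod: "prod_list (map (\<lambda>b. W 0 (length b)) Q) = prod_list (map (\<lambda>b. \<omega> (length b)) Q) *
          prod_list (map (\<lambda>b. fact (length b)) Q) * prod_list (map (\<lambda>b. M (length b)) Q)" for Q :: "'e list list"
        by (induction Q) (auto simp: W_def pos mult_ac)
      have f0: "0 \<le> prod_list (map (\<lambda>b. fact (length b) :: real) P)" by (rule prod_list_nonneg) auto
      have m0: "0 \<le> prod_list (map (\<lambda>b. M (length b)) P)" by (rule prod_list_nonneg) (use pos in \<open>auto intro: less_imp_le\<close>)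
      have "?F P = (A * fact k * L k * \<rho> ^ length P * fact (length P) * prod_list (map (\<lambda>b. fact (length b)) P)) *
          ((\<omega> (k + length b) * prod_list (map (\<lambda>b. \<omega> (length b)) R)) * (M (length P) * prod_list (map (\<lambda>b. M (length b)) P)))"
        by (simp add: bR W_prod) (simp add: W_def mult_ac)
      also have "\<dots> \<le> (A * fact k * L k * \<rho> ^ length P * fact (length P) * prod_list (map (\<lambda>b. fact (length b)) P)) *
          (\<omega> (k + ?l) * (M 1 ^ length P * M ?l))"
      proof (rule mult_left_mono[OF mult_mono])
        show "\<omega> (k + length b) * prod_list (map (\<lambda>b. \<omega> (length b)) R) \<le> \<omega> (k + ?l)"
          using \<omega>s[of "k + length b" R] partitions_blocks(3)[OF P] by (simp add: bR add.assoc)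
        show "M (length P) * prod_list (map (\<lambda>b. M (length b)) P) \<le> M 1 ^ length P * M ?l"
          using log_convex_partition_le[OF M partitions_blocks(1)[OF P]] partitions_blocks(3)[OF P] by (simp add: bR)
      qed (use A pos \<omega>(1) f0 m0 in \<open>auto simp: less_imp_le\<close>)
      also have "\<dots> = E * ?w P" by (simp add: E_def power_mult_distrib mult_ac)
      finally show "?F P \<le> E * ?w P" .
    qed
    also have "\<dots> \<le> (E * ((\<rho> * M 1 + 2) ^ ?l * fact ?l)) * prod_list (map p vs)"
      unfolding sum_list_const_mult using A(2) pos(1)[of 1]
      by (intro mult_right_mono mult_left_mono E sum_partitions_factorials_le prod_list_p_nonneg vs) simp
    finally show ?thesis by (simp add: E_def W_def mult_ac)
  qed
  have "absolutely_convex ?B" by (rule absolutely_convex_polar) (simp add: c_def)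
  then show ?thesis
    using main closed_polar vn_bounded_polar unfolding W_def by (intro exI[of _ ?B]) blast
qed

end

section \<open>Composition of the mapping classes\<close>

lemma smooth_curve_dual:
  assumes \<phi>: "dual \<phi>" and "smooth_curve c"
  shows "smooth_curve (\<phi> \<circ> c)"
proof -
  obtain D where D: "D 0 = c" "\<And>k t. ((\<lambda>s. (D k (t + s) - D k t) /\<^sub>R s) \<longlongrightarrow> D (Suc k) t) (at 0)"
    using assms(2) unfolding smooth_curve_def by blast
  show ?thesis
    unfolding smooth_curve_def
  proof (intro exI[of _ "\<lambda>k. \<phi> \<circ> D k"] conjI allI)
    show "\<phi> \<circ> D 0 = \<phi> \<circ> c" using D(1) by simp
    show "((\<lambda>s. ((\<phi> \<circ> D k) (t + s) - (\<phi> \<circ> D k) t) /\<^sub>R s) \<longlongrightarrow> (\<phi> \<circ> D (Suc k)) t) (at 0)" for k t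
      using dual_tendsto[OF \<phi> D(2)[of k t]] by (simp add: dual_diff[OF \<phi>] dual_scaleR[OF \<phi>])
  qed
qed

text \<open>Boundedness of \<open>B\<close> means that every neighbourhood of 0 contains a dilate of
  \<open>B\<close>, so convergence in the gauge is stronger than convergence in the ambient
  space.\<close>

lemma tendsto_if_Minkowski_functional_tendsto:
  fixes B :: "'a::locally_convex_space set"
  assumes B: "absolutely_convex B" "vn_bounded B"
    and q: "\<And>s. q s \<in> span B" "l \<in> span B" "((\<lambda>s. Minkowski_functional B (q s - l)) \<longlongrightarrow> 0) F"
  shows "(q \<longlongrightarrow> l) F"
proof (rule topological_tendstoI)
  fix U assume U: "open U" "l \<in> U"
  have "open ((\<lambda>z. l + z) -` U)" by (rule open_vimage[OF U(1)]) (intro continuous_intros)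
  moreover have "0 \<in> (\<lambda>z. l + z) -` U" using U by simp
  ultimately obtain W where W: "open W" "absolutely_convex W" "W \<subseteq> (\<lambda>z. l + z) -` U"
    using absolutely_convex_neighbourhood by blast
  obtain r where r: "0 < r" "B \<subseteq> (*\<^sub>R) r ` W"
    using B(2) W(1) absolutely_convex_0[OF W(2)] unfolding vn_bounded_def by blast
  have "\<forall>\<^sub>F s in F. Minkowski_functional B (q s - l) < inverse r"
    using order_tendstoD(2)[OF q(3)] r(1) by simp
  then show "\<forall>\<^sub>F s in F. q s \<in> U"
  proof eventually_elim
    case (elim s)
    then have "q s - l \<in> (*\<^sub>R) (inverse r) ` B"
      using q by (intro Minkowski_functional_less[OF B(1)] span_diff)
    then obtain b where "b \<in> B" "q s - l = inverse r *\<^sub>R b" by blast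
    then have "q s - l \<in> W" using r by auto
    then have "l + (q s - l) \<in> U" using W(3) by blast
    then show ?case by simp
  qed
qed

text \<open>Lets smoothness along curves be verified in the ambient spaces, where \<open>f\<close>
  and \<open>g\<close> map smooth curves to smooth curves.\<close>

lemma smooth_curve_if_smooth_curve_on:
  fixes B :: "'a::locally_convex_space set"
  assumes B: "absolutely_convex B" "vn_bounded B" and "smooth_curve_on (span B) (Minkowski_functional B) c"
  shows "smooth_curve c"
proof -
  obtain D where D: "D 0 = c" "\<And>k t. D k t \<in> span B"
    "\<And>k t. ((\<lambda>s. Minkowski_functional B ((D k (t + s) - D k t) /\<^sub>R s - D (Suc k) t)) \<longlongrightarrow> 0) (at 0)"
    using assms(3) unfolding smooth_curve_on_def by blast
  have "((\<lambda>s. (D k (t + s) - D k t) /\<^sub>R s) \<longlongrightarrow> D (Suc k) t) (at 0)" for k t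
    by (rule tendsto_if_Minkowski_functional_tendsto[OF B _ D(2,3)]) (intro span_scale span_diff D(2))
  then show ?thesis using D(1) unfolding smooth_curve_def by blast
qed

lemma convenient_maps_iff_dual:
  "f \<in> convenient_maps \<A> \<longleftrightarrow> f \<in> smooth_maps \<and> (\<forall>\<phi> B. dual \<phi> \<longrightarrow> closed B \<longrightarrow> absolutely_convex B \<longrightarrow> vn_bounded B \<longrightarrow>
    \<phi> \<circ> f \<in> \<A> (span B) (Minkowski_functional B))"
  unfolding convenient_maps_def dual_def by blast

text \<open>Reduces a composition theorem to the weighted estimate for one functional and one
  bounded set: smoothness along curves and the setting of \<open>weakly_smooth_composition\<close>
  are the same in all three cases.\<close>

lemma convenient_maps_compI:
  fixes f :: "'f::convenient_space \<Rightarrow> 'g::convenient_space" and g :: "'e::convenient_space \<Rightarrow> 'f"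
  assumes f: "f \<in> convenient_maps \<A>" and g: "g \<in> convenient_maps \<B>"
    and \<A>: "\<And>S p h. h \<in> \<A> S p \<Longrightarrow> bounded_derivatives_on S p h"
    and \<B>: "\<And>S p h. h \<in> \<B> S p \<Longrightarrow> bounded_derivatives_on S p h"
    and comp: "\<And>\<phi> B. dual \<phi> \<Longrightarrow> closed B \<Longrightarrow> absolutely_convex B \<Longrightarrow> vn_bounded B \<Longrightarrow>
      weakly_smooth_composition (span B) (Minkowski_functional B) g (\<phi> \<circ> f) \<Longrightarrow>
      \<phi> \<circ> f \<circ> g \<in> smooth_functions_on (span B) (Minkowski_functional B) \<Longrightarrow>
      \<phi> \<circ> f \<circ> g \<in> \<C> (span B) (Minkowski_functional B)"
  shows "f \<circ> g \<in> convenient_maps \<C>"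
  unfolding convenient_maps_iff_dual
proof (intro conjI allI impI)
  have fg: "smooth_curve (f \<circ> c)" if "smooth_curve c" for c
    using f that unfolding convenient_maps_iff_dual smooth_maps_def by blast
  have g': "smooth_curve (g \<circ> c)" if "smooth_curve c" for c
    using g that unfolding convenient_maps_iff_dual smooth_maps_def by blast
  show "f \<circ> g \<in> smooth_maps" unfolding smooth_maps_def using fg g' by (simp add: comp_assoc)
  fix \<phi> :: "'g \<Rightarrow> real" and B :: "'e set"
  assume \<phi>: "dual \<phi>" and B: "closed B" "absolutely_convex B" "vn_bounded B"
  have "\<phi> \<circ> f \<circ> g \<in> \<C> (span B) (Minkowski_functional B)"
  proof (rule comp[OF \<phi> B])
    interpret seminorm_on "span B" "Minkowski_functional B" by (rule seminorm_on_Minkowski_functional[OF B(2)])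
    show "weakly_smooth_composition (span B) (Minkowski_functional B) g (\<phi> \<circ> f)"
    proof unfold_locales
      show "bounded_derivatives_on (span B) (Minkowski_functional B) (\<psi> \<circ> g)" if "dual \<psi>" for \<psi>
        using g that B unfolding convenient_maps_iff_dual by (intro \<B>) blast
      show "bounded_derivatives_on (span B') (Minkowski_functional B') (\<phi> \<circ> f)"
        if "closed B'" "absolutely_convex B'" "vn_bounded B'" for B'
        using f that \<phi> unfolding convenient_maps_iff_dual by (intro \<A>) blast
    qed
    show "\<phi> \<circ> f \<circ> g \<in> smooth_functions_on (span B) (Minkowski_functional B)"
      unfolding smooth_functions_on_def
      using smooth_curve_dual[OF \<phi> fg[OF g'[OF smooth_curve_if_smooth_curve_on[OF B(2,3)]]]]
      by (simp add: comp_assoc)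
  qed
  then show "\<phi> \<circ> (f \<circ> g) \<in> \<C> (span B) (Minkowski_functional B)" by (simp add: comp_assoc)
qed

lemma convenient_maps_dual:
  "f \<in> convenient_maps \<A> \<Longrightarrow> dual \<phi> \<Longrightarrow> closed B \<Longrightarrow> absolutely_convex B \<Longrightarrow> vn_bounded B \<Longrightarrow>
    \<phi> \<circ> f \<in> \<A> (span B) (Minkowski_functional B)"
  unfolding convenient_maps_iff_dual by blast

section \<open>Explicit bounds from the boundedness of weighted quotients\<close>

lemma bdd_above_ratioD:
  fixes F W :: "'i \<Rightarrow> real"
  assumes "bdd_above {F i / W i | i. i \<in> I}" "\<And>i. 0 < W i"
  shows "\<exists>C\<ge>0. \<forall>i\<in>I. F i \<le> C * W i"
proof -
  obtain C where "\<And>i. i \<in> I \<Longrightarrow> F i / W i \<le> C" using assms(1) unfolding bdd_above_def by blast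
  then have "F i \<le> \<bar>C\<bar> * W i" if "i \<in> I" for i
    using that assms(2)[of i] by (smt (verit, best) divide_le_eq mult_right_mono)
  then show ?thesis by (intro exI[of _ "\<bar>C\<bar>"]) auto
qed

lemma B_weighted_bound:
  fixes M :: "nat \<Rightarrow> real"
  assumes M: "weight_sequence M" and \<rho>: "0 < \<rho>"
    and b: "bdd_above {opnorm_on S p k (D k x) / (\<rho> ^ k * fact k * M k) | k x. k \<ge> 1 \<and> x \<in> S}"
  shows "\<exists>C\<ge>0. \<forall>k x. 1 \<le> k \<longrightarrow> x \<in> S \<longrightarrow> opnorm_on S p k (D k x) \<le> C * (\<rho> ^ k * fact k * M k)"
proof -
  have "\<exists>C\<ge>0. \<forall>i\<in>{i. 1 \<le> fst i \<and> snd i \<in> S}. opnorm_on S p (fst i) (D (fst i) (snd i)) \<le> C * (\<rho> ^ fst i * fact (fst i) * M (fst i))"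
  proof (rule bdd_above_ratioD)
    show "0 < \<rho> ^ fst i * fact (fst i) * M (fst i)" for i :: "nat \<times> 'a"
      using M \<rho> unfolding weight_sequence_def by simp
    have "{opnorm_on S p (fst i) (D (fst i) (snd i)) / (\<rho> ^ fst i * fact (fst i) * M (fst i)) | i. i \<in> {i. 1 \<le> fst i \<and> snd i \<in> S}}
      = {opnorm_on S p k (D k x) / (\<rho> ^ k * fact k * M k) | k x. k \<ge> 1 \<and> x \<in> S}" by auto
    then show "bdd_above {opnorm_on S p (fst i) (D (fst i) (snd i)) / (\<rho> ^ fst i * fact (fst i) * M (fst i)) | i. i \<in> {i. 1 \<le> fst i \<and> snd i \<in> S}}"
      using b by simp
  qed
  then show ?thesis by auto
qed

lemma S_weighted_bound:
  fixes M L :: "nat \<Rightarrow> real"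
  assumes M: "weight_sequence M" "weight_sequence L" and \<sigma>: "0 < \<sigma>"
    and b: "bdd_above {(1 + p x) ^ k * opnorm_on S p l (D l x) /
         (\<sigma> ^ (k + l) * fact k * fact l * L k * M l) | k l x. l \<ge> 1 \<and> x \<in> S}"
  shows "\<exists>C\<ge>0. \<forall>k l x. 1 \<le> l \<longrightarrow> x \<in> S \<longrightarrow>
    (1 + p x) ^ k * opnorm_on S p l (D l x) \<le> C * (\<sigma> ^ (k + l) * fact k * fact l * L k * M l)"
proof -
  let ?F = "\<lambda>(k, l, x). (1 + p x) ^ k * opnorm_on S p l (D l x)"
  let ?W = "\<lambda>(k, l, x). \<sigma> ^ (k + l) * fact k * fact l * L k * M l"
  let ?I = "{(k :: nat, l, x). 1 \<le> l \<and> x \<in> S}"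
  have "\<exists>C\<ge>0. \<forall>i\<in>?I. ?F i \<le> C * ?W i"
  proof (rule bdd_above_ratioD)
    show "0 < ?W i" for i :: "nat \<times> nat \<times> 'a"
      using M \<sigma> unfolding weight_sequence_def by (simp split: prod.split)
    have "{?F i / ?W i | i. i \<in> ?I} = {(1 + p x) ^ k * opnorm_on S p l (D l x) /
         (\<sigma> ^ (k + l) * fact k * fact l * L k * M l) | k l x. l \<ge> 1 \<and> x \<in> S}" by auto
    then show "bdd_above {?F i / ?W i | i. i \<in> ?I}" using b by simp
  qed
  then show ?thesis by fastforce
qed

lemma B_weighted_bounded_derivatives:
  fixes M :: "nat \<Rightarrow> real"
  assumes "weight_sequence M" "0 < \<rho>" "frechet_derivatives_on S p h D"
    "bdd_above {opnorm_on S p k (D k x) / (\<rho> ^ k * fact k * M k) | k x. k \<ge> 1 \<and> x \<in> S}"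
  shows "bounded_derivatives_on S p h"
proof (intro exI[of _ D] conjI allI impI assms(3))
  fix k :: nat assume "1 \<le> k"
  then show "bdd_above {opnorm_on S p k (D k x) | x. x \<in> S}"
    using B_weighted_bound[OF assms(1,2,4)] unfolding bdd_above_def by blast
qed

lemma S_weighted_bounded_derivatives:
  fixes M L :: "nat \<Rightarrow> real"
  assumes "weight_sequence M" "weight_sequence L" "0 < \<sigma>" "frechet_derivatives_on S p h D"
    "bdd_above {(1 + p x) ^ k * opnorm_on S p l (D l x) /
         (\<sigma> ^ (k + l) * fact k * fact l * L k * M l) | k l x. l \<ge> 1 \<and> x \<in> S}"
  shows "bounded_derivatives_on S p h"
proof (intro exI[of _ D] conjI allI impI assms(4))
  fix l :: nat assume l: "1 \<le> l"
  obtain C where C: "\<And>k x. x \<in> S \<Longrightarrow> (1 + p x) ^ k * opnorm_on S p l (D l x) \<le> C * (\<sigma> ^ (k + l) * fact k * fact l * L k * M l)"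
    using S_weighted_bound[OF assms(1,2,3,5)] l by blast
  show "bdd_above {opnorm_on S p l (D l x) | x. x \<in> S}"
    by (rule bdd_aboveI[of _ "C * (\<sigma> ^ (0 + l) * fact 0 * fact l * L 0 * M l)"]) (use C[of _ 0] in auto)
qed

section \<open>The three composition theorems\<close>

lemma comp_S_ge1:
  fixes f :: "'f::convenient_space \<Rightarrow> 'g::convenient_space" and g :: "'e::convenient_space \<Rightarrow> 'f"
  assumes f: "f \<in> convenient_maps B_ge1" and g: "g \<in> convenient_maps S_ge1"
  shows "f \<circ> g \<in> convenient_maps S_ge1"
proof (rule convenient_maps_compI[OF f g])
  show "bounded_derivatives_on S p h" if "h \<in> B_ge1 S p" for S :: "'f set" and p h using that unfolding B_ge1_def by blast
  show "bounded_derivatives_on S p h" if "h \<in> S_ge1 S p" for S :: "'e set" and p h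
  proof -
    from that obtain D where "frechet_derivatives_on S p h D"
      and D: "\<And>k l. 1 \<le> l \<Longrightarrow> bdd_above {(1 + p x) ^ k * opnorm_on S p l (D l x) | x. x \<in> S}" unfolding S_ge1_def by blast
    then show ?thesis using D[of _ 0] by auto
  qed
  fix \<phi> :: "'g \<Rightarrow> real" and B :: "'e set" assume \<phi>: "dual \<phi>" and B: "closed B" "absolutely_convex B" "vn_bounded B"
  let ?S = "span B" and ?p = "Minkowski_functional B"
  assume "weakly_smooth_composition ?S ?p g (\<phi> \<circ> f)"
  then interpret weakly_smooth_composition ?S ?p g "\<phi> \<circ> f" .
  assume sm: "\<phi> \<circ> f \<circ> g \<in> smooth_functions_on ?S ?p"
  have rd: "\<exists>C. \<forall>x\<in>?S. \<forall>vs. length vs = l \<longrightarrow> set vs \<subseteq> ?S \<longrightarrow>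
      (1 + ?p x) ^ k * \<bar>dder (\<psi> \<circ> g) vs x\<bar> \<le> C * prod_list (map ?p vs)" if \<psi>: "dual \<psi>" and l: "1 \<le> l" for \<psi> k l
  proof -
    obtain D where D: "frechet_derivatives_on ?S ?p (\<psi> \<circ> g) D"
      and "bdd_above {(1 + ?p x) ^ k * opnorm_on ?S ?p l (D l x) | x. x \<in> ?S}"
      using convenient_maps_dual[OF g \<psi> B] l unfolding S_ge1_def by blast
    then obtain C where "\<And>x. x \<in> ?S \<Longrightarrow> (1 + ?p x) ^ k * opnorm_on ?S ?p l (D l x) \<le> C" unfolding bdd_above_def by blast
    then show ?thesis using weighted_dder_le[OF D] by blast
  qed
  show "\<phi> \<circ> f \<circ> g \<in> S_ge1 ?S ?p"
    unfolding S_ge1_def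
  proof (intro CollectI conjI sm exI[of _ "\<lambda>_. comp_der"] comp_der_frechet allI impI)
    fix k l :: nat assume l: "1 \<le> l"
    obtain C where C: "0 \<le> C" "\<And>x vs. x \<in> ?S \<Longrightarrow> length vs = l \<Longrightarrow> set vs \<subseteq> ?S \<Longrightarrow>
        (1 + ?p x) ^ k * \<bar>comp_der x vs\<bar> \<le> C * prod_list (map ?p vs)"
      using comp_der_rapidly_decreasing[OF rd l, of k] by blast
    show "bdd_above {(1 + ?p x) ^ k * opnorm_on ?S ?p l (comp_der x) | x. x \<in> ?S}"
      by (rule bdd_aboveI[of _ C]) (use weighted_opnorm_le[OF _ C(1)] C(2) in blast)
  qed
qed

text \<open>Both rates can be prescribed: \<open>\<rho> = 1 / M 1\<close> makes the loss per
  derivative equal to 3, and giving \<open>g\<close> the rate \<open>\<sigma> / 3\<close>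
  compensates for it.\<close>

lemma comp_S_Beurling_ge1:
  fixes M L :: "nat \<Rightarrow> real"
    and f :: "'f::convenient_space \<Rightarrow> 'g::convenient_space" and g :: "'e::convenient_space \<Rightarrow> 'f"
  assumes M: "weight_sequence M" "log_convex_sequence M" and L: "weight_sequence L"
    and f: "f \<in> convenient_maps (B_Beurling_ge1 M)" and g: "g \<in> convenient_maps (S_Beurling_ge1 L M)"
  shows "f \<circ> g \<in> convenient_maps (S_Beurling_ge1 L M)"
proof (rule convenient_maps_compI[OF f g])
  show "bounded_derivatives_on S p h" if "h \<in> B_Beurling_ge1 M S p" for S :: "'f set" and p h
  proof -
    from that obtain D where D: "frechet_derivatives_on S p h D"
      and "\<forall>\<rho>>0. bdd_above {opnorm_on S p k (D k x) / (\<rho> ^ k * fact k * M k) | k x. k \<ge> 1 \<and> x \<in> S}"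
      unfolding B_Beurling_ge1_def by blast
    from this(2)[rule_format, OF zero_less_one] show ?thesis
      by (rule B_weighted_bounded_derivatives[OF M(1) zero_less_one D])
  qed
  show "bounded_derivatives_on S p h" if "h \<in> S_Beurling_ge1 L M S p" for S :: "'e set" and p h
  proof -
    from that obtain D where D: "frechet_derivatives_on S p h D"
      and "\<forall>\<sigma>>0. bdd_above {(1 + p x) ^ k * opnorm_on S p l (D l x) /
        (\<sigma> ^ (k + l) * fact k * fact l * L k * M l) | k l x. l \<ge> 1 \<and> x \<in> S}"
      unfolding S_Beurling_ge1_def by blast
    from this(2)[rule_format, OF zero_less_one] show ?thesis
      by (rule S_weighted_bounded_derivatives[OF M(1) L zero_less_one D])
  qed
  fix \<phi> :: "'g \<Rightarrow> real" and B :: "'e set" assume \<phi>: "dual \<phi>" and B: "closed B" "absolutely_convex B" "vn_bounded B"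
  let ?S = "span B" and ?p = "Minkowski_functional B"
  assume "weakly_smooth_composition ?S ?p g (\<phi> \<circ> f)"
  then interpret weakly_smooth_composition ?S ?p g "\<phi> \<circ> f" .
  assume sm: "\<phi> \<circ> f \<circ> g \<in> smooth_functions_on ?S ?p"
  have pos: "0 < M n" "0 < L n" "1 \<le> M 1" for n using M(1) L unfolding weight_sequence_def by auto
  show "\<phi> \<circ> f \<circ> g \<in> S_Beurling_ge1 L M ?S ?p"
    unfolding S_Beurling_ge1_def
  proof (intro CollectI conjI sm exI[of _ "\<lambda>_. comp_der"] comp_der_frechet allI impI)
    fix \<sigma> :: real assume \<sigma>: "0 < \<sigma>"
    define \<tau> where "\<tau> = \<sigma> / 3"
    have \<tau>: "0 < \<tau>" using \<sigma> unfolding \<tau>_def by simp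
    have "\<exists>C. \<forall>x\<in>?S. \<forall>k vs. 1 \<le> length vs \<longrightarrow> set vs \<subseteq> ?S \<longrightarrow>
      (1 + ?p x) ^ k * \<bar>dder (\<psi> \<circ> g) vs x\<bar> \<le>
      C * (\<tau> ^ (k + length vs) * fact k * fact (length vs) * L k * M (length vs)) * prod_list (map ?p vs)" if \<psi>: "dual \<psi>" for \<psi>
    proof -
      obtain D where D: "frechet_derivatives_on ?S ?p (\<psi> \<circ> g) D"
        and b: "bdd_above {(1 + ?p x) ^ k * opnorm_on ?S ?p l (D l x) /
         (\<tau> ^ (k + l) * fact k * fact l * L k * M l) | k l x. l \<ge> 1 \<and> x \<in> ?S}"
        using convenient_maps_dual[OF g \<psi> B] \<tau> unfolding S_Beurling_ge1_def by blast
      show ?thesis using S_weighted_bound[OF M(1) L \<tau> b] weighted_dder_le[OF D] by blast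
    qed
    from comp_der_weighted[OF M L, of "\<lambda>n. \<tau> ^ n", OF _ _ this] \<tau>
    obtain B' where B': "closed B'" "absolutely_convex B'" "vn_bounded B'"
      and est: "\<And>A \<rho> x k vs. 0 \<le> A \<Longrightarrow> 0 \<le> \<rho> \<Longrightarrow> \<forall>y\<in>span B'. \<forall>ws. 1 \<le> length ws \<longrightarrow> set ws \<subseteq> span B' \<longrightarrow>
        \<bar>dder (\<phi> \<circ> f) ws y\<bar> \<le> A * (\<rho> ^ length ws * fact (length ws) * M (length ws)) * prod_list (map (Minkowski_functional B') ws) \<Longrightarrow>
        x \<in> ?S \<Longrightarrow> 1 \<le> length vs \<Longrightarrow> set vs \<subseteq> ?S \<Longrightarrow> (1 + ?p x) ^ k * \<bar>comp_der x vs\<bar> \<le>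
        A * (\<tau> ^ (k + length vs) * fact k * fact (length vs) * L k * M (length vs)) * (\<rho> * M 1 + 2) ^ length vs * prod_list (map ?p vs)"
      by (auto simp: power_add)
    define \<rho> where "\<rho> = 1 / M 1"
    have \<rho>: "0 < \<rho>" "\<rho> * M 1 = 1" using pos unfolding \<rho>_def by auto
    interpret H: seminorm_on "span B'" "Minkowski_functional B'" by (rule seminorm_on_Minkowski_functional[OF B'(2)])
    obtain D where D: "frechet_derivatives_on (span B') (Minkowski_functional B') (\<phi> \<circ> f) D"
      and b: "bdd_above {opnorm_on (span B') (Minkowski_functional B') k (D k x) / (\<rho> ^ k * fact k * M k) | k x. k \<ge> 1 \<and> x \<in> span B'}"
      using convenient_maps_dual[OF f \<phi> B'] \<rho> unfolding B_Beurling_ge1_def by blast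
    obtain A where A: "0 \<le> A" "\<And>k x. 1 \<le> k \<Longrightarrow> x \<in> span B' \<Longrightarrow>
        opnorm_on (span B') (Minkowski_functional B') k (D k x) \<le> A * (\<rho> ^ k * fact k * M k)"
      using B_weighted_bound[OF M(1) \<rho>(1) b] by blast
    have h: "\<forall>y\<in>span B'. \<forall>ws. 1 \<le> length ws \<longrightarrow> set ws \<subseteq> span B' \<longrightarrow>
        \<bar>dder (\<phi> \<circ> f) ws y\<bar> \<le> A * (\<rho> ^ length ws * fact (length ws) * M (length ws)) * prod_list (map (Minkowski_functional B') ws)"
      using H.weighted_dder_le[OF D, of _ _ 0] A(2) by simp
    have "(1 + ?p x) ^ k * opnorm_on ?S ?p l (comp_der x) / (\<sigma> ^ (k + l) * fact k * fact l * L k * M l) \<le> A"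
      if l: "1 \<le> l" and x: "x \<in> ?S" for k l x
    proof -
      have w: "0 < \<sigma> ^ (k + l) * fact k * fact l * L k * M l" using \<sigma> pos by simp
      have "(1 + ?p x) ^ k * opnorm_on ?S ?p l (comp_der x) \<le> A * (\<sigma> ^ (k + l) * fact k * fact l * L k * M l)"
      proof (rule weighted_opnorm_le[OF x])
        show "0 \<le> A * (\<sigma> ^ (k + l) * fact k * fact l * L k * M l)" using A(1) w by simp
        fix vs assume vs: "length vs = l" "set vs \<subseteq> ?S"
        have "(1 + ?p x) ^ k * \<bar>comp_der x vs\<bar> \<le> A * (\<tau> ^ (k + l) * fact k * fact l * L k * M l) * 3 ^ l * prod_list (map ?p vs)"
          using est[OF A(1) less_imp_le[OF \<rho>(1)] h x, of vs k] vs l \<rho>(2) by simp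
        also have "\<dots> = (A * fact k * fact l * L k * M l * prod_list (map ?p vs)) * (\<tau> ^ (k + l) * 3 ^ l)" by (simp add: mult_ac)
        also have "\<dots> \<le> (A * fact k * fact l * L k * M l * prod_list (map ?p vs)) * \<sigma> ^ (k + l)"
        proof (rule mult_left_mono)
          have "\<tau> ^ (k + l) * 3 ^ l \<le> \<tau> ^ (k + l) * 3 ^ (k + l)" using \<tau> by (intro mult_left_mono power_increasing) auto
          also have "\<dots> = \<sigma> ^ (k + l)" unfolding \<tau>_def by (simp add: power_divide)
          finally show "\<tau> ^ (k + l) * 3 ^ l \<le> \<sigma> ^ (k + l)" .
          show "0 \<le> A * fact k * fact l * L k * M l * prod_list (map ?p vs)"
            using A(1) pos prod_list_p_nonneg[OF vs(2)] by (simp add: less_imp_le)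
        qed
        finally show "(1 + ?p x) ^ k * \<bar>comp_der x vs\<bar> \<le> A * (\<sigma> ^ (k + l) * fact k * fact l * L k * M l) * prod_list (map ?p vs)"
          by (simp add: mult_ac)
      qed
      then show ?thesis using w by (simp add: pos_divide_le_eq)
    qed
    then show "bdd_above {(1 + ?p x) ^ k * opnorm_on ?S ?p l (comp_der x) /
         (\<sigma> ^ (k + l) * fact k * fact l * L k * M l) | k l x. l \<ge> 1 \<and> x \<in> ?S}"
      by (intro bdd_aboveI[of _ A]) blast
  qed
qed

text \<open>A fixed test sequence \<open>r\<close> replaces the unknown rates. The set, the rate of
  \<open>f\<close> on it and the loss \<open>\<tau>\<close> all depend on \<open>r\<close>, which
  \<open>geometric_growth_if_rapidly_decreasing\<close> permits; only its conclusion produces one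
  rate for all \<open>k\<close>, \<open>l\<close> and \<open>x\<close>.\<close>

lemma comp_S_Roumieu_ge1:
  fixes M L :: "nat \<Rightarrow> real"
    and f :: "'f::convenient_space \<Rightarrow> 'g::convenient_space" and g :: "'e::convenient_space \<Rightarrow> 'f"
  assumes M: "weight_sequence M" "log_convex_sequence M" and L: "weight_sequence L"
    and f: "f \<in> convenient_maps (B_Roumieu_ge1 M)" and g: "g \<in> convenient_maps (S_Roumieu_ge1 L M)"
  shows "f \<circ> g \<in> convenient_maps (S_Roumieu_ge1 L M)"
proof (rule convenient_maps_compI[OF f g])
  show "bounded_derivatives_on S p h" if "h \<in> B_Roumieu_ge1 M S p" for S :: "'f set" and p h
    using that unfolding B_Roumieu_ge1_def mem_Collect_eq
    by (elim conjE exE) (rule B_weighted_bounded_derivatives[OF M(1)]; assumption)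
  show "bounded_derivatives_on S p h" if "h \<in> S_Roumieu_ge1 L M S p" for S :: "'e set" and p h
    using that unfolding S_Roumieu_ge1_def mem_Collect_eq
    by (elim conjE exE) (rule S_weighted_bounded_derivatives[OF M(1) L]; assumption)
  fix \<phi> :: "'g \<Rightarrow> real" and B :: "'e set" assume \<phi>: "dual \<phi>" and B: "closed B" "absolutely_convex B" "vn_bounded B"
  let ?S = "span B" and ?p = "Minkowski_functional B"
  assume "weakly_smooth_composition ?S ?p g (\<phi> \<circ> f)"
  then interpret weakly_smooth_composition ?S ?p g "\<phi> \<circ> f" .
  assume sm: "\<phi> \<circ> f \<circ> g \<in> smooth_functions_on ?S ?p"
  have pos: "0 < M n" "0 < L n" "1 \<le> M 1" for n using M(1) L unfolding weight_sequence_def by auto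
  let ?I = "{(k :: nat, l, x). 1 \<le> l \<and> x \<in> ?S}"
  \<comment> \<open>The weighted norms without the geometric factor, whose rate is to be found; the
    exponent belonging to it is \<open>k + l\<close>.\<close>
  define a where "a = (\<lambda>(k, l, x). (1 + ?p x) ^ k * opnorm_on ?S ?p l (comp_der x) / (fact k * fact l * L k * M l))"
  define n where "n = (\<lambda>(k :: nat, l, x :: 'e). k + l)"
  have "\<exists>C. \<exists>\<sigma>>0. \<forall>i\<in>?I. a i \<le> C * \<sigma> ^ n i"
  proof (rule geometric_growth_if_rapidly_decreasing)
    fix r assume r: "rapidly_decreasing r"
    have r0: "0 < r j" and rm: "r (i + j) \<le> r i * r j" for i j using r unfolding rapidly_decreasing_def by auto
    let ?\<omega> = "\<lambda>n. inverse (r n)"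
    have "\<exists>C. \<forall>x\<in>?S. \<forall>k vs. 1 \<le> length vs \<longrightarrow> set vs \<subseteq> ?S \<longrightarrow>
      (1 + ?p x) ^ k * \<bar>dder (\<psi> \<circ> g) vs x\<bar> \<le>
      C * (?\<omega> (k + length vs) * fact k * fact (length vs) * L k * M (length vs)) * prod_list (map ?p vs)" if \<psi>: "dual \<psi>" for \<psi>
    proof -
      obtain D \<sigma> where D: "frechet_derivatives_on ?S ?p (\<psi> \<circ> g) D" and \<sigma>: "0 < \<sigma>"
        and b: "bdd_above {(1 + ?p x) ^ k * opnorm_on ?S ?p l (D l x) /
         (\<sigma> ^ (k + l) * fact k * fact l * L k * M l) | k l x. l \<ge> 1 \<and> x \<in> ?S}"
        using convenient_maps_dual[OF g \<psi> B] unfolding S_Roumieu_ge1_def by blast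
      obtain C where C: "0 \<le> C" "\<And>k l x. 1 \<le> l \<Longrightarrow> x \<in> ?S \<Longrightarrow>
          (1 + ?p x) ^ k * opnorm_on ?S ?p l (D l x) \<le> C * (\<sigma> ^ (k + l) * fact k * fact l * L k * M l)"
        using S_weighted_bound[OF M(1) L \<sigma> b] by blast
      \<comment> \<open>The rate \<open>\<sigma>\<close> depends on the functional
        \<open>\<psi>\<close>; against \<open>r\<close> it shrinks to the constant \<open>K\<close>,
        which may depend on \<open>\<psi>\<close>.\<close>
      obtain K where K: "\<And>n. r n * \<sigma> ^ n \<le> K" using r \<sigma> unfolding rapidly_decreasing_def by blast
      have "(1 + ?p x) ^ k * opnorm_on ?S ?p l (D l x) \<le> (C * K) * (?\<omega> (k + l) * fact k * fact l * L k * M l)"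
        if "1 \<le> l" "x \<in> ?S" for k l x
      proof -
        have "\<sigma> ^ (k + l) \<le> K * ?\<omega> (k + l)" using K[of "k + l"] r0[of "k + l"] by (simp add: field_simps)
        then have "C * (\<sigma> ^ (k + l) * (fact k * fact l * L k * M l)) \<le> C * ((K * ?\<omega> (k + l)) * (fact k * fact l * L k * M l))"
          using C(1) pos by (intro mult_left_mono mult_right_mono) (auto simp: less_imp_le)
        then show ?thesis using C(2)[OF that, of k] by (simp add: mult_ac)
      qed
      then show ?thesis using weighted_dder_le[OF D] by blast
    qed
    from comp_der_weighted[OF M L, of ?\<omega>, OF _ _ this] r0 rm
    obtain B' where B': "closed B'" "absolutely_convex B'" "vn_bounded B'"
      and est: "\<And>A \<rho> x k vs. 0 \<le> A \<Longrightarrow> 0 \<le> \<rho> \<Longrightarrow> \<forall>y\<in>span B'. \<forall>ws. 1 \<le> length ws \<longrightarrow> set ws \<subseteq> span B' \<longrightarrow>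
        \<bar>dder (\<phi> \<circ> f) ws y\<bar> \<le> A * (\<rho> ^ length ws * fact (length ws) * M (length ws)) * prod_list (map (Minkowski_functional B') ws) \<Longrightarrow>
        x \<in> ?S \<Longrightarrow> 1 \<le> length vs \<Longrightarrow> set vs \<subseteq> ?S \<Longrightarrow> (1 + ?p x) ^ k * \<bar>comp_der x vs\<bar> \<le>
        A * (?\<omega> (k + length vs) * fact k * fact (length vs) * L k * M (length vs)) * (\<rho> * M 1 + 2) ^ length vs * prod_list (map ?p vs)"
      by (auto simp: inverse_mult_distrib[symmetric] intro!: le_imp_inverse_le simp del: inverse_mult_distrib)
    interpret H: seminorm_on "span B'" "Minkowski_functional B'" by (rule seminorm_on_Minkowski_functional[OF B'(2)])
    obtain D \<rho> where D: "frechet_derivatives_on (span B') (Minkowski_functional B') (\<phi> \<circ> f) D" and \<rho>: "0 < \<rho>"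
      and b: "bdd_above {opnorm_on (span B') (Minkowski_functional B') k (D k x) / (\<rho> ^ k * fact k * M k) | k x. k \<ge> 1 \<and> x \<in> span B'}"
      using convenient_maps_dual[OF f \<phi> B'] unfolding B_Roumieu_ge1_def by blast
    obtain A where A: "0 \<le> A" "\<And>k x. 1 \<le> k \<Longrightarrow> x \<in> span B' \<Longrightarrow>
        opnorm_on (span B') (Minkowski_functional B') k (D k x) \<le> A * (\<rho> ^ k * fact k * M k)"
      using B_weighted_bound[OF M(1) \<rho> b] by blast
    have h: "\<forall>y\<in>span B'. \<forall>ws. 1 \<le> length ws \<longrightarrow> set ws \<subseteq> span B' \<longrightarrow>
        \<bar>dder (\<phi> \<circ> f) ws y\<bar> \<le> A * (\<rho> ^ length ws * fact (length ws) * M (length ws)) * prod_list (map (Minkowski_functional B') ws)"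
      using H.weighted_dder_le[OF D, of _ _ 0] A(2) by simp
    define \<tau> where "\<tau> = \<rho> * M 1 + 2"
    have \<tau>: "1 \<le> \<tau>" unfolding \<tau>_def using \<rho> pos by simp
    have "a (k, l, x) * r (k + l) \<le> A * \<tau> ^ (k + l)" if l: "1 \<le> l" and x: "x \<in> ?S" for k l x
    proof -
      let ?w = "fact k * fact l * L k * M l"
      have w: "0 < ?w" using pos by simp
      have "(1 + ?p x) ^ k * opnorm_on ?S ?p l (comp_der x) \<le> A * (?\<omega> (k + l) * fact k * fact l * L k * M l) * \<tau> ^ l"
      proof (rule weighted_opnorm_le[OF x])
        show "0 \<le> A * (?\<omega> (k + l) * fact k * fact l * L k * M l) * \<tau> ^ l"
          using A(1) r0 pos \<tau> by (simp add: less_imp_le)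
        show "(1 + ?p x) ^ k * \<bar>comp_der x vs\<bar> \<le> A * (?\<omega> (k + l) * fact k * fact l * L k * M l) * \<tau> ^ l * prod_list (map ?p vs)"
          if "length vs = l" "set vs \<subseteq> ?S" for vs
          using est[OF A(1) less_imp_le[OF \<rho>] h x, of vs k] that l unfolding \<tau>_def by simp
      qed
      also have "\<dots> = (A * \<tau> ^ l / r (k + l)) * ?w" by (simp add: field_simps)
      finally have "a (k, l, x) \<le> A * \<tau> ^ l / r (k + l)" unfolding a_def using w by (simp add: pos_divide_le_eq)
      then have "a (k, l, x) * r (k + l) \<le> A * \<tau> ^ l" using r0[of "k + l"] by (simp add: pos_le_divide_eq)
      \<comment> \<open>Since \<open>\<tau> \<ge> 1\<close>, the loss may be counted for the decay
        exponent as well, to match \<open>n\<close>.\<close>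
      also have "\<dots> \<le> A * \<tau> ^ (k + l)" using \<tau> A(1) by (intro mult_left_mono power_increasing) auto
      finally show ?thesis .
    qed
    then show "\<exists>C \<tau>. 0 < \<tau> \<and> (\<forall>i\<in>?I. a i * r (n i) \<le> C * \<tau> ^ n i)"
      using \<tau> by (intro exI[of _ A] exI[of _ \<tau>]) (auto simp: n_def)
  qed
  then obtain C \<sigma> where \<sigma>: "0 < \<sigma>" and C: "\<And>i. i \<in> ?I \<Longrightarrow> a i \<le> C * \<sigma> ^ n i" by blast
  have "(1 + ?p x) ^ k * opnorm_on ?S ?p l (comp_der x) / (\<sigma> ^ (k + l) * fact k * fact l * L k * M l) \<le> C"
    if "1 \<le> l" "x \<in> ?S" for k l x
  proof -
    have "a (k, l, x) / \<sigma> ^ (k + l) \<le> C" using C[of "(k, l, x)"] that \<sigma> by (simp add: n_def pos_divide_le_eq)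
    then show ?thesis unfolding a_def by (simp add: mult_ac)
  qed
  then have "bdd_above {(1 + ?p x) ^ k * opnorm_on ?S ?p l (comp_der x) /
         (\<sigma> ^ (k + l) * fact k * fact l * L k * M l) | k l x. l \<ge> 1 \<and> x \<in> ?S}"
    by (intro bdd_aboveI[of _ C]) blast
  then show "\<phi> \<circ> f \<circ> g \<in> S_Roumieu_ge1 L M ?S ?p"
    unfolding S_Roumieu_ge1_def using sm comp_der_frechet \<sigma> by blast
qed

theorem mainTheorem11:
  fixes M L :: "nat \<Rightarrow> real"
    and f :: "'f::convenient_space \<Rightarrow> 'g::convenient_space"
    and g :: "'e::convenient_space \<Rightarrow> 'f"
  assumes "weight_sequence M" and "weight_sequence L" and "log_convex_sequence M"
  shows "(f \<in> convenient_maps B_ge1 \<and> g \<in> convenient_maps S_ge1 \<longrightarrow>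
            f \<circ> g \<in> convenient_maps S_ge1)
       \<and> (f \<in> convenient_maps (B_Beurling_ge1 M) \<and> g \<in> convenient_maps (S_Beurling_ge1 L M) \<longrightarrow>
            f \<circ> g \<in> convenient_maps (S_Beurling_ge1 L M))
       \<and> (f \<in> convenient_maps (B_Roumieu_ge1 M) \<and> g \<in> convenient_maps (S_Roumieu_ge1 L M) \<longrightarrow>
            f \<circ> g \<in> convenient_maps (S_Roumieu_ge1 L M))"
  using comp_S_ge1 comp_S_Beurling_ge1[OF assms(1,3,2)] comp_S_Roumieu_ge1[OF assms(1,3,2)] by blast

end
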